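(* Assume the standing hypotheses described in the context. Let $(\bar S,\bar w^0,\bar w,\bar\alpha,\bar y^0,\bar y,\bar\beta)$ be a canonical local minimizer for the space-time problem. Then, for every Boltyanski approximating cone $\Gamma$ of the target $\mathfrak{T}$ at $(\bar y^0,\bar y)(\bar S)$, there exists a multiplier $(p_0,p,\pi,\lambda)\in\mathbb{R}\times AC([0,\bar S],\mathbb{R}^n)\times(-\infty,0]\times[0,+\infty)$ such that: (i) (non-triviality) $(p_0,p,\lambda)\neq(0,0,0)$ (i.e. $p_0$, the function $p$ and $\lambda$ do not all vanish); moreover, if $\bar y^0(\bar S)>0$ then $(p,\lambda)\neq(0,0)$; (ii) (non-transversality) $(p_0,p(\bar S))\in -\lambda\Big(\frac{\partial\Psi}{\partial t}((\bar y^0,\bar y)(\bar S)),\frac{\partial\Psi}{\partial x}((\bar y^0,\bar y)(\bar S))\Big)-\Gamma^\perp$, and $\pi=0$ whenever $\bar\beta(\bar S)<K$; (iii) (adjoint equation) for a.e. $s\in[0,\bar S]$, $\frac{dp}{ds}(s)=-\frac{\partial H}{\partial x}\big(\bar y(s),p_0,p(s),\pi,\lambda,\bar w^0(s),\bar w(s),\bar\alpha(s)\big)$; (iv) (maximization) for a.e. $s\in[0,\bar S]$, $H\big(\bar y(s),p_0,p(s),\pi,\lambda,\bar w^0(s),\bar w(s),\bar\alpha(s)\big)=\mathbf{H}\big(\bar y(s),p_0,p(s),\pi,\lambda\big)$; (v) (vanishing of the Hamiltonian) $\mathbf{H}\big(\bar y(s),p_0,p(s),\pi,\lambda\big)=0$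 for all $s\in[0,\bar S]$.
   Context: Let $n,m,q\ge1$ be integers, $m=m_1+m_2$ with $m_1,m_2\ge 0$; $\mathbf{e}_i$ denotes the $i$-th canonical basis vector, $\mathbb{R}_+=[0,+\infty)$. A set $\mathcal{K}$ is a cone if $\alpha x\in\mathcal K$ for all $\alpha>0$, $x\in\mathcal K$. Standing hypotheses: (1) the target $\mathfrak{T}\subset\mathbb{R}_+\times\mathbb{R}^n$ is closed; $A\subset\mathbb{R}^q$ is compact; $\mathcal{C}=\mathcal{C}_1\times\mathcal{C}_2\subseteq\mathbb{R}^m$, where $\mathcal C_1\subseteq\mathbb{R}^{m_1}$ is a closed cone containing the lines $\{r\mathbf e_i:r\in\mathbb{R}\}$, $i=1,\dots,m_1$, and $\mathcal C_2\subseteq\mathbb{R}^{m_2}$ is a closed cone containing no straight line; (2) $f:\mathbb{R}^n\times A\to\mathbb{R}^n$ is continuous with continuous partial derivatives with respect to $x$; (3) $g_1,\dots,g_m:\mathbb{R}^n\to\mathbb{R}^n$ are $C^1$; (4) $\ell(x,u,a)=\ell_0(x,a)+\ell_1(x,u)$ on $\mathbb{R}^n\times\mathcal C\times A$, where the recession function $\hat\ell_1(x,w^0,w):=\lim_{r\to w^0}r\,\ell_1(x,w/r)$, $(x,w^0,w)\in\mathbb{R}^n\times\mathbb{R}_+\times\mathcal C$, exists, and $\ell_0,\hat\ell_1$ are continuous with continuous partial derivatives with respect to $x$; (5) $\Psi:\mathbb{R}\times\mathbb{R}^n\to\mathbb{R}$ is $C^1$. Fix $K\in(0,+\infty]$ and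 $\check x\in\mathbb{R}^n$. Extended Lagrangian: $\ell^e(x,w^0,w,a):=\ell_0(x,a)w^0+\hat\ell_1(x,w^0,w)$. Space-time process: $S>0$, $(w^0,w,\alpha)\in L^\infty([0,S],\mathbb{R}_+\times\mathcal C\times A)$ with $\operatorname{ess\,inf}(w^0+|w|)>0$, and $(y^0,y,\beta)$ the Carathéodory solution on $[0,S]$ of $\frac{dy^0}{ds}=w^0$, $\frac{dy}{ds}=f(y,\alpha)w^0+\sum_{i=1}^m g_i(y)w^i$, $\frac{d\beta}{ds}=|w|$, $(y^0,y,\beta)(0)=(0,\check x,0)$. It is feasible if $(y^0(S),y(S))\in\mathfrak T$ and $\beta(S)\le K$; its cost is $\Psi(y^0(S),y(S))+\int_0^S\ell^e(y,w^0,w,\alpha)\,ds$. It is canonical if $w^0+|w|=1$ a.e. A feasible process is a local minimizer (of the space-time problem) if there is $\delta>0$ such that its cost is $\le$ the cost of every feasible process with $|S-\bar S|+\sup_{s\ge0}|\tilde z(s)-\tilde{\bar z}(s)|<\delta$, where $z=(y^0,y,\beta)$ and $\tilde z$ is the extension of $z$ to $\mathbb{R}_+$ that is constant after the final time. Boltyanski approximating cone: a convex cone $\mathcal K\subseteq\mathbb{R}^N$ is one for $Z\subseteq\mathbb{R}^N$ at $z\in Z$ if there exist a convex cone $C\subset\mathbb{R}^M$ ($M\ge0$), a neighborhood $V$ of $0$ in $\mathbb{R}^M$, a continuous $F:V\cap C\to Z$ with $F(0)=z$ and a linear $L:\mathbb{R}^M\to\mathbb{R}^N$ with $F(v)=z+Lv+o(|v|)$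 on $V\cap C$ and $LC=\mathcal K$. Polar: $X^\perp=\{p:p\cdot x\le0\ \forall x\in X\}$. Hamiltonians: $W:=\{(w^0,w)\in\mathbb{R}_+\times\mathcal C:w^0+|w|=1\}$, $H(x,p_0,p,\pi,\lambda,w^0,w,a):=p_0w^0+p\cdot\big(f(x,a)w^0+\sum_{i=1}^m g_i(x)w^i\big)+\pi|w|-\lambda\ell^e(x,w^0,w,a)$, and $\mathbf H(x,p_0,p,\pi,\lambda):=\max_{(w^0,w,a)\in W\times A}H(x,p_0,p,\pi,\lambda,w^0,w,a)$. *)

theory Defs
  imports "HOL-Analysis.Analysis"
begin

definition pcone :: "'a::real_vector set \<Rightarrow> bool" where
  "pcone K \<longleftrightarrow> (\<forall>x\<in>K. \<forall>c::real. c > 0 \<longrightarrow> c *\<^sub>R x \<in> K)"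

definition polar :: "'a::real_inner set \<Rightarrow> 'a set" where
  "polar X = {p. \<forall>x\<in>X. inner p x \<le> 0}"

definition boltyanski_cone ::
  "'m::euclidean_space set \<Rightarrow> 'a::euclidean_space set \<Rightarrow> 'a set \<Rightarrow> 'a \<Rightarrow> bool" where
  "boltyanski_cone Cp K Z z \<longleftrightarrow>
     z \<in> Z \<and> convex K \<and> pcone K \<and> convex Cp \<and> pcone Cp \<and> 0 \<in> Cp \<and>
     (\<exists>V F L. 0 \<in> interior V \<and> continuous_on (V \<inter> Cp) F \<and> F ` (V \<inter> Cp) \<subseteq> Z \<and>
        F 0 = z \<and> linear L \<and> L ` Cp = K \<and>
        (\<forall>e>0. \<exists>d>0. \<forall>v\<in>V \<inter> Cp. norm v < d \<longrightarrow> norm (F v - z - L v) \<le> e * norm v))"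

definition AC_on :: "real \<Rightarrow> real \<Rightarrow> (real \<Rightarrow> 'a::real_normed_vector) \<Rightarrow> bool" where
  "AC_on a b h \<longleftrightarrow>
     (\<forall>e>0. \<exists>d>0. \<forall>I :: (real \<times> real) set.
        finite I \<longrightarrow>
        (\<forall>(u,v)\<in>I. a \<le> u \<and> u \<le> v \<and> v \<le> b) \<longrightarrow>
        (\<forall>(u,v)\<in>I. \<forall>(u',v')\<in>I. (u,v) \<noteq> (u',v') \<longrightarrow> {u<..<v} \<inter> {u'<..<v'} = {}) \<longrightarrow>
        (\<Sum>(u,v)\<in>I. v - u) < d \<longrightarrow>
        (\<Sum>(u,v)\<in>I. norm (h v - h u)) < e)"

definition C1_map :: "('a::real_normed_vector \<Rightarrow> 'b::real_normed_vector) \<Rightarrow> bool" where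
  "C1_map h \<longleftrightarrow> (\<exists>D. (\<forall>x. (h has_derivative blinfun_apply (D x)) (at x)) \<and> continuous_on UNIV D)"

definition cont_with_cont_dx ::
  "('a::real_normed_vector \<Rightarrow> 'p::topological_space \<Rightarrow> 'b::real_normed_vector) \<Rightarrow> 'p set \<Rightarrow> bool" where
  "cont_with_cont_dx h P \<longleftrightarrow>
     continuous_on (UNIV \<times> P) (\<lambda>(x,a). h x a) \<and>
     (\<exists>D. (\<forall>x. \<forall>a\<in>P. ((\<lambda>x. h x a) has_derivative blinfun_apply (D x a)) (at x)) \<and>
          continuous_on (UNIV \<times> P) (\<lambda>(x,a). D x a))"

definition standing_hyps ::
  "(real \<times> (real^'n)) set \<Rightarrow> (real^'q) set \<Rightarrow> 'm set \<Rightarrow> (real^'m) set \<Rightarrow> (real^'m) set \<Rightarrow> (real^'m) set \<Rightarrow>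
   (real^'n \<Rightarrow> real^'q \<Rightarrow> real^'n) \<Rightarrow> ('m \<Rightarrow> real^'n \<Rightarrow> real^'n) \<Rightarrow>
   (real^'n \<Rightarrow> real^'q \<Rightarrow> real) \<Rightarrow> (real^'n \<Rightarrow> real^'m \<Rightarrow> real) \<Rightarrow>
   (real^'n \<Rightarrow> real \<Rightarrow> real^'m \<Rightarrow> real) \<Rightarrow> (real \<times> (real^'n) \<Rightarrow> real) \<Rightarrow> bool" where
  "standing_hyps T A I1 C1 C2 C f g l0 l1 l1h Psi \<longleftrightarrow>
     \<comment> \<open>(1) target, control set for a, cone C = C1 x C2\<close>
     closed T \<and> T \<subseteq> {0..} \<times> UNIV \<and> compact A \<and>
     (\<forall>u\<in>C1. \<forall>i. i \<notin> I1 \<longrightarrow> u $ i = 0) \<and>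
     (\<forall>v\<in>C2. \<forall>i\<in>I1. v $ i = 0) \<and>
     C = {u + v | u v. u \<in> C1 \<and> v \<in> C2} \<and>
     closed C1 \<and> pcone C1 \<and> (\<forall>i\<in>I1. \<forall>r::real. r *\<^sub>R axis i 1 \<in> C1) \<and>
     closed C2 \<and> pcone C2 \<and> \<not> (\<exists>a v. v \<noteq> 0 \<and> (\<forall>r::real. a + r *\<^sub>R v \<in> C2)) \<and>
     \<comment> \<open>(2) drift\<close>
     cont_with_cont_dx f A \<and>
     \<comment> \<open>(3) control vector fields\<close>
     (\<forall>i. C1_map (g i)) \<and>
     \<comment> \<open>(4) Lagrangian and its recession function\<close>
     cont_with_cont_dx l0 A \<and>
     (\<forall>x w0 w. w0 \<ge> 0 \<and> w \<in> C \<longrightarrow>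
        ((\<lambda>r. r * l1 x ((1 / r) *\<^sub>R w)) \<longlongrightarrow> l1h x w0 w) (at w0 within {0<..})) \<and>
     cont_with_cont_dx (\<lambda>x (w0, w). l1h x w0 w) ({0..} \<times> C) \<and>
     \<comment> \<open>(5) final cost\<close>
     C1_map Psi"

definition ell_e ::
  "(real^'n \<Rightarrow> real^'q \<Rightarrow> real) \<Rightarrow> (real^'n \<Rightarrow> real \<Rightarrow> real^'m \<Rightarrow> real) \<Rightarrow>
   real^'n \<Rightarrow> real \<Rightarrow> real^'m \<Rightarrow> real^'q \<Rightarrow> real" where
  "ell_e l0 l1h x w0 w a = l0 x a * w0 + l1h x w0 w"

definition dyn ::
  "(real^'n \<Rightarrow> real^'q \<Rightarrow> real^'n) \<Rightarrow> ('m::finite \<Rightarrow> real^'n \<Rightarrow> real^'n) \<Rightarrow>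
   real^'n \<Rightarrow> real \<Rightarrow> real^'m \<Rightarrow> real^'q \<Rightarrow> real^'n" where
  "dyn f g x w0 w a = w0 *\<^sub>R f x a + (\<Sum>i\<in>UNIV. (w $ i) *\<^sub>R g i x)"

definition st_process ::
  "(real^'n \<Rightarrow> real^'q \<Rightarrow> real^'n) \<Rightarrow> ('m::finite \<Rightarrow> real^'n \<Rightarrow> real^'n) \<Rightarrow> real^'n \<Rightarrow>
   (real^'q) set \<Rightarrow> (real^'m) set \<Rightarrow> real \<Rightarrow>
   (real \<Rightarrow> real) \<Rightarrow> (real \<Rightarrow> real^'m) \<Rightarrow> (real \<Rightarrow> real^'q) \<Rightarrow>
   (real \<Rightarrow> real) \<Rightarrow> (real \<Rightarrow> real^'n) \<Rightarrow> (real \<Rightarrow> real) \<Rightarrow> bool" where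
  "st_process f g xc A C S w0 w \<alpha> y0 y \<beta> \<longleftrightarrow>
     S > 0 \<and>
     w0 \<in> borel_measurable (lebesgue_on {0..S}) \<and>
     w \<in> borel_measurable (lebesgue_on {0..S}) \<and>
     \<alpha> \<in> borel_measurable (lebesgue_on {0..S}) \<and>
     (\<exists>B. AE s in lebesgue_on {0..S}. \<bar>w0 s\<bar> \<le> B \<and> norm (w s) \<le> B \<and> norm (\<alpha> s) \<le> B) \<and>
     (AE s in lebesgue_on {0..S}. w0 s \<ge> 0 \<and> w s \<in> C \<and> \<alpha> s \<in> A) \<and>
     (\<exists>c>0. AE s in lebesgue_on {0..S}. w0 s + norm (w s) \<ge> c) \<and>
     AC_on 0 S y0 \<and> AC_on 0 S y \<and> AC_on 0 S \<beta> \<and>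
     y0 0 = 0 \<and> y 0 = xc \<and> \<beta> 0 = 0 \<and>
     (AE s in lebesgue_on {0..S}.
        (y0 has_real_derivative w0 s) (at s within {0..S}) \<and>
        (y has_vector_derivative dyn f g (y s) (w0 s) (w s) (\<alpha> s)) (at s within {0..S}) \<and>
        (\<beta> has_real_derivative norm (w s)) (at s within {0..S}))"

definition st_feasible ::
  "(real^'n \<Rightarrow> real^'q \<Rightarrow> real^'n) \<Rightarrow> ('m::finite \<Rightarrow> real^'n \<Rightarrow> real^'n) \<Rightarrow> real^'n \<Rightarrow>
   (real^'q) set \<Rightarrow> (real^'m) set \<Rightarrow> (real \<times> (real^'n)) set \<Rightarrow> ereal \<Rightarrow> real \<Rightarrow>
   (real \<Rightarrow> real) \<Rightarrow> (real \<Rightarrow> real^'m) \<Rightarrow> (real \<Rightarrow> real^'q) \<Rightarrow>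
   (real \<Rightarrow> real) \<Rightarrow> (real \<Rightarrow> real^'n) \<Rightarrow> (real \<Rightarrow> real) \<Rightarrow> bool" where
  "st_feasible f g xc A C T K S w0 w \<alpha> y0 y \<beta> \<longleftrightarrow>
     st_process f g xc A C S w0 w \<alpha> y0 y \<beta> \<and> (y0 S, y S) \<in> T \<and> ereal (\<beta> S) \<le> K"

definition st_cost ::
  "(real \<times> (real^'n) \<Rightarrow> real) \<Rightarrow> (real^'n \<Rightarrow> real^'q \<Rightarrow> real) \<Rightarrow> (real^'n \<Rightarrow> real \<Rightarrow> real^'m \<Rightarrow> real) \<Rightarrow>
   real \<Rightarrow> (real \<Rightarrow> real) \<Rightarrow> (real \<Rightarrow> real^'m) \<Rightarrow> (real \<Rightarrow> real^'q) \<Rightarrow>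
   (real \<Rightarrow> real) \<Rightarrow> (real \<Rightarrow> real^'n) \<Rightarrow> real" where
  "st_cost Psi l0 l1h S w0 w \<alpha> y0 y =
     Psi (y0 S, y S) + integral\<^sup>L (lebesgue_on {0..S}) (\<lambda>s. ell_e l0 l1h (y s) (w0 s) (w s) (\<alpha> s))"

definition ext_traj ::
  "real \<Rightarrow> (real \<Rightarrow> real) \<Rightarrow> (real \<Rightarrow> real^'n) \<Rightarrow> (real \<Rightarrow> real) \<Rightarrow> real \<Rightarrow> real \<times> (real^'n) \<times> real" where
  "ext_traj S y0 y \<beta> s = (y0 (min s S), y (min s S), \<beta> (min s S))"

definition st_local_minimizer ::
  "(real^'n \<Rightarrow> real^'q \<Rightarrow> real^'n) \<Rightarrow> ('m::finite \<Rightarrow> real^'n \<Rightarrow> real^'n) \<Rightarrow> real^'n \<Rightarrow>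
   (real^'q) set \<Rightarrow> (real^'m) set \<Rightarrow> (real \<times> (real^'n)) set \<Rightarrow> ereal \<Rightarrow>
   (real \<times> (real^'n) \<Rightarrow> real) \<Rightarrow> (real^'n \<Rightarrow> real^'q \<Rightarrow> real) \<Rightarrow> (real^'n \<Rightarrow> real \<Rightarrow> real^'m \<Rightarrow> real) \<Rightarrow>
   real \<Rightarrow> (real \<Rightarrow> real) \<Rightarrow> (real \<Rightarrow> real^'m) \<Rightarrow> (real \<Rightarrow> real^'q) \<Rightarrow>
   (real \<Rightarrow> real) \<Rightarrow> (real \<Rightarrow> real^'n) \<Rightarrow> (real \<Rightarrow> real) \<Rightarrow> bool" where
  "st_local_minimizer f g xc A C T K Psi l0 l1h Sb w0b wb \<alpha>b y0b yb \<beta>b \<longleftrightarrow>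
     st_feasible f g xc A C T K Sb w0b wb \<alpha>b y0b yb \<beta>b \<and>
     (\<exists>\<delta>>0. \<forall>S w0 w \<alpha> y0 y \<beta>.
        st_feasible f g xc A C T K S w0 w \<alpha> y0 y \<beta> \<longrightarrow>
        \<bar>S - Sb\<bar> + (SUP s\<in>{0..}. norm (ext_traj S y0 y \<beta> s - ext_traj Sb y0b yb \<beta>b s)) < \<delta> \<longrightarrow>
        st_cost Psi l0 l1h Sb w0b wb \<alpha>b y0b yb \<le> st_cost Psi l0 l1h S w0 w \<alpha> y0 y)"

definition canonical :: "real \<Rightarrow> (real \<Rightarrow> real) \<Rightarrow> (real \<Rightarrow> real^'m) \<Rightarrow> bool" where
  "canonical S w0 w \<longleftrightarrow> (AE s in lebesgue_on {0..S}. w0 s + norm (w s) = 1)"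

definition Wset :: "(real^'m) set \<Rightarrow> (real \<times> (real^'m)) set" where
  "Wset C = {(w0, w). w0 \<ge> 0 \<and> w \<in> C \<and> w0 + norm w = 1}"

definition Ham ::
  "(real^'n \<Rightarrow> real^'q \<Rightarrow> real^'n) \<Rightarrow> ('m::finite \<Rightarrow> real^'n \<Rightarrow> real^'n) \<Rightarrow>
   (real^'n \<Rightarrow> real^'q \<Rightarrow> real) \<Rightarrow> (real^'n \<Rightarrow> real \<Rightarrow> real^'m \<Rightarrow> real) \<Rightarrow>
   real^'n \<Rightarrow> real \<Rightarrow> real^'n \<Rightarrow> real \<Rightarrow> real \<Rightarrow> real \<Rightarrow> real^'m \<Rightarrow> real^'q \<Rightarrow> real" where
  "Ham f g l0 l1h x p0 p \<pi> lam w0 w a =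
     p0 * w0 + inner p (dyn f g x w0 w a) + \<pi> * norm w - lam * ell_e l0 l1h x w0 w a"

text \<open>Maximized Hamiltonian (the maximum over the compact set W x A, written as a supremum).\<close>
definition HamMax ::
  "(real^'n \<Rightarrow> real^'q \<Rightarrow> real^'n) \<Rightarrow> ('m::finite \<Rightarrow> real^'n \<Rightarrow> real^'n) \<Rightarrow>
   (real^'n \<Rightarrow> real^'q \<Rightarrow> real) \<Rightarrow> (real^'n \<Rightarrow> real \<Rightarrow> real^'m \<Rightarrow> real) \<Rightarrow>
   (real^'q) set \<Rightarrow> (real^'m) set \<Rightarrow>
   real^'n \<Rightarrow> real \<Rightarrow> real^'n \<Rightarrow> real \<Rightarrow> real \<Rightarrow> real" where
  "HamMax f g l0 l1h A C x p0 p \<pi> lam =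
     (SUP z\<in>Wset C \<times> A. Ham f g l0 l1h x p0 p \<pi> lam (fst (fst z)) (snd (fst z)) (snd z))"

end

theory Submission
  imports Defs
begin

text \<open>
  The running cost is adjoined to the state, \<open>z = (y\<^sup>0, y, \<beta>, c)\<close>, and the final pseudo-time is kept fixed.
  Because the dynamics and the extended Lagrangian are positively homogeneous in \<open>(w\<^sup>0, w)\<close>, fixing the
  final pseudo-time loses nothing: it suffices to vary the control by needles with values in the compact set
  \<open>1/2 \<le> w\<^sup>0 + |w| \<le> 2\<close>. Comparing the reference control with its multiples by \<open>2\<close> and \<open>1/2\<close>
  makes the Hamiltonian vanish along the reference process, and comparing it with the other controls makes it
  nonpositive on \<open>W \<times> A\<close>; both facts extend from almost every instant to every instant by continuity.

  The first-order effect of needles on the endpoint is read off by pairing the trajectory difference with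
  solutions of the adjoint equation, so no flow or fundamental matrix is needed. If the convex cone spanned by
  these effects, by the negative of the Boltyanski cone and by the slacks for the variation bound and for the
  cost were the whole space, it would admit a continuous conic right inverse, and Brouwer's theorem would produce
  nearby feasible processes of smaller cost. Hence a hyperplane supports the cone, and its normal is the
  terminal value of the multiplier.
\<close>

section \<open>Absolute continuity and indefinite integrals\<close>

text \<open>Two descriptions of a trajectory have to be reconciled: processes are absolutely
  continuous curves with a derivative almost everywhere, while fixed points, stability and needles
  are handled through integral equations. Hence the fundamental theorem for \<open>AC_on\<close> in
  one direction and Lebesgue differentiation in the other. Separation yields a nonzero covector with
  a component \<pi> that the non-triviality claim does not count. If only \<pi> survived, the
  vanishing Hamiltonian would give \<pi> |w| = 0, hence w = 0 almost everywhere and \<beta>(S) = 0 <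
  K, where slackness makes \<pi> vanish too. When y0(S) > 0 the same mechanism excludes a surviving
  pair (p0, \<pi>): p0 \<le> 0 because (1, 0) lies in W, \<pi> \<le> 0, and p0 w0 + \<pi> |w| = 0
  then forces w0 = 0.\<close>

lemma Lipschitz_imp_AC_on:
  fixes h :: "real \<Rightarrow> 'a::real_normed_vector"
  assumes lip: "\<And>s t. \<lbrakk>a \<le> s; s \<le> t; t \<le> b\<rbrakk> \<Longrightarrow> norm (h t - h s) \<le> B * (t - s)"
  shows "AC_on a b h"
  unfolding AC_on_def
proof (intro allI impI)
  fix e :: real assume "e > 0"
  \<comment> \<open>\<open>B\<close> may have either sign or vanish; \<open>|B| + 1\<close> makes
    the division legitimate.\<close>
  define d where "d = e / (\<bar>B\<bar> + 1)"
  have dpos: "d > 0" unfolding d_def using \<open>e > 0\<close> by simp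
  have small: "(\<Sum>(u,v)\<in>I. norm (h v - h u)) < e"
    if "finite I" and I: "\<forall>(u,v)\<in>I. a \<le> u \<and> u \<le> v \<and> v \<le> b"
      and less: "(\<Sum>(u,v)\<in>I. v - u) < d" for I :: "(real \<times> real) set"
  proof -
    have nn: "0 \<le> (\<Sum>(u,v)\<in>I. v - u)"
      using I by (intro sum_nonneg) auto
    have "(\<Sum>(u,v)\<in>I. norm (h v - h u)) \<le> (\<Sum>(u,v)\<in>I. (\<bar>B\<bar> + 1) * (v - u))"
    proof (rule sum_mono, clarify)
      fix u v assume "(u,v) \<in> I"
      then have uv: "a \<le> u" "u \<le> v" "v \<le> b" using I by auto
      have "norm (h v - h u) \<le> B * (v - u)" using lip uv by auto
      also have "\<dots> \<le> (\<bar>B\<bar> + 1) * (v - u)" using uv by (intro mult_right_mono) auto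
      finally show "norm (h v - h u) \<le> (\<bar>B\<bar> + 1) * (v - u)" .
    qed
    also have "\<dots> = (\<bar>B\<bar> + 1) * (\<Sum>(u,v)\<in>I. v - u)"
      by (simp add: sum_distrib_left case_prod_unfold)
    also have "\<dots> < (\<bar>B\<bar> + 1) * d"
      using less by (intro mult_strict_left_mono) auto
    also have "\<dots> = e" by (simp add: d_def)
    finally show ?thesis .
  qed
  show "\<exists>d>0. \<forall>I. finite I \<longrightarrow>
        (\<forall>(u,v)\<in>I. a \<le> u \<and> u \<le> v \<and> v \<le> b) \<longrightarrow>
        (\<forall>(u,v)\<in>I. \<forall>(u',v')\<in>I. (u,v) \<noteq> (u',v') \<longrightarrow> {u<..<v} \<inter> {u'<..<v'} = {}) \<longrightarrow>
        (\<Sum>(u,v)\<in>I. v - u) < d \<longrightarrow>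
        (\<Sum>(u,v)\<in>I. norm (h v - h u)) < e"
    by (rule exI[of _ d], intro conjI allI impI, rule dpos, rule small)
qed

text \<open>Converts an open neighbourhood of small measure into the smallness hypothesis of
  \<open>AC_on\<close>. Disjointness is asked of the open intervals only, since neighbouring pieces
  of a tagged division share endpoints.\<close>

lemma sum_length_le_measure:
  fixes J :: "(real \<times> real) set"
  assumes "finite J" and J: "\<And>u v. (u,v) \<in> J \<Longrightarrow> u \<le> v \<and> {u..v} \<subseteq> G"
    and dj: "\<And>u v u' v'. \<lbrakk>(u,v) \<in> J; (u',v') \<in> J; (u,v) \<noteq> (u',v')\<rbrakk> \<Longrightarrow> {u<..<v} \<inter> {u'<..<v'} = {}"
    and G: "G \<in> lmeasurable"
  shows "(\<Sum>(u,v)\<in>J. v - u) \<le> measure lebesgue G"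
proof -
  have "(\<Sum>(u,v)\<in>J. v - u) = (\<Sum>(u,v)\<in>J. measure lebesgue {u<..<v})"
    using J by (intro sum.cong) auto
  also have "\<dots> = (\<Sum>p\<in>J. measure lebesgue ((\<lambda>(u,v). {u<..<v}) p))"
    by (simp add: case_prod_unfold)
  also have "\<dots> = measure lebesgue (\<Union>p\<in>J. (\<lambda>(u,v). {u<..<v}) p)"
  proof (rule measure_negligible_finite_Union_image [OF \<open>finite J\<close>, symmetric])
    show "\<And>S. S \<in> J \<Longrightarrow> (\<lambda>(u,v). {u<..<v}) S \<in> lmeasurable"
      by (auto simp: lmeasurable_open)
    show "pairwise (\<lambda>x y. negligible ((\<lambda>(u,v). {u<..<v}) x \<inter> (\<lambda>(u,v). {u<..<v}) y)) J"
      unfolding pairwise_def using dj by fastforce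
  qed
  also have "\<dots> \<le> measure lebesgue G"
  proof (rule measure_mono_fmeasurable [OF _ _ G])
    show "(\<Union>p\<in>J. (\<lambda>(u,v). {u<..<v}) p) \<subseteq> G" using J greaterThanLessThan_subseteq_atLeastAtMost_iff by fastforce
    show "(\<Union>p\<in>J. (\<lambda>(u,v). {u<..<v}) p) \<in> sets lebesgue"
      using \<open>finite J\<close> by (intro sets.finite_UN) auto
  qed
  finally show ?thesis .
qed

text \<open>Tags in the exceptional set are kept inside an open set of small measure, where absolute
  continuity takes over from differentiability.\<close>

theorem fundamental_theorem_of_calculus_AC:
  fixes F :: "real \<Rightarrow> 'a::banach"
  assumes "a \<le> b" and AC: "AC_on a b F" and N: "negligible N"
    and der: "\<And>x. x \<in> {a..b} - N \<Longrightarrow> (F has_vector_derivative h x) (at x within {a..b})"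
  shows "(h has_integral (F b - F a)) {a..b}"
proof -
  \<comment> \<open>With the integrand set to zero on \<open>N\<close>, a tag in \<open>N\<close>
    contributes only the increment of \<open>F\<close>; the values on the null set are restored at
    the end.\<close>
  define k where "k x = (if x \<in> N then 0 else h x)" for x
  have "(k has_integral (F b - F a)) {a..b}"
    unfolding has_integral_real
  proof (intro allI impI)
    fix e :: real assume "e > 0"
    define e1 where "e1 = e / (2 * (b - a + 1))"
    have "e1 > 0" using \<open>e > 0\<close> \<open>a \<le> b\<close> by (simp add: e1_def)
    have "\<forall>x. \<exists>d>0. x \<in> {a..b} - N \<longrightarrow>
         (\<forall>y\<in>{a..b}. norm (y-x) < d \<longrightarrow> norm (F y - F x - (y-x) *\<^sub>R h x) \<le> e1 * norm (y-x))"
      using der[unfolded has_vector_derivative_def has_derivative_within_alt] \<open>e1 > 0\<close> by (meson zero_less_one)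
    then obtain d where d: "\<And>x. 0 < d x"
                 "\<And>x y. \<lbrakk>x \<in> {a..b} - N; y \<in> {a..b}; norm (y-x) < d x\<rbrakk>
                        \<Longrightarrow> norm (F y - F x - (y-x) *\<^sub>R h x) \<le> e1 * norm (y-x)"
      by metis
    obtain \<delta> where "\<delta> > 0" and \<delta>: "\<And>I. \<lbrakk>finite I; \<forall>(u,v)\<in>I. a \<le> u \<and> u \<le> v \<and> v \<le> b;
        \<forall>(u,v)\<in>I. \<forall>(u',v')\<in>I. (u,v) \<noteq> (u',v') \<longrightarrow> {u<..<v} \<inter> {u'<..<v'} = {};
        (\<Sum>(u,v)\<in>I. v - u) < \<delta>\<rbrakk> \<Longrightarrow> (\<Sum>(u,v)\<in>I. norm (F v - F u)) < e / 2"
      using AC[unfolded AC_on_def, THEN spec, of "e / 2"] \<open>e > 0\<close> by auto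
    obtain G where G: "open G" "N \<subseteq> G" "G - N \<in> lmeasurable" "emeasure lebesgue (G - N) < ennreal \<delta>"
      using sets_lebesgue_outer_open [OF negligible_imp_sets[OF N] \<open>\<delta> > 0\<close>] by blast
    have "(G - N) \<union> N = G" using G by blast
    then have GL: "G \<in> lmeasurable"
      using G negligible_imp_measurable[OF N] by (metis fmeasurable.Un)
    have "measure lebesgue G \<le> measure lebesgue (G - N) + measure lebesgue N"
      using measure_Un_le[of "G - N" lebesgue N] G N \<open>(G - N) \<union> N = G\<close>
      by (metis fmeasurableD negligible_imp_sets)
    also have "measure lebesgue N = 0" by (rule negligible_imp_measure0[OF N])
    also have "measure lebesgue (G - N) < \<delta>"
      using G \<open>\<delta> > 0\<close> by (simp add: emeasure_eq_measure2 ennreal_less_iff)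
    finally have mG: "measure lebesgue G < \<delta>" by simp
    define \<gamma> where "\<gamma> x = (if x \<in> N then G else ball x (d x))" for x
    have "gauge \<gamma>"
      unfolding gauge_def \<gamma>_def using G d(1) by auto
    moreover have "\<forall>p. p tagged_division_of {a..b} \<and> \<gamma> fine p \<longrightarrow>
        norm ((\<Sum>(x,K)\<in>p. measure lborel K *\<^sub>R k x) - (F b - F a)) < e"
    proof (intro allI impI, elim conjE)
      fix p assume ptag: "p tagged_division_of {a..b}" and fine: "\<gamma> fine p"
      have "finite p" using ptag by blast
      have ba: "b - a = (\<Sum>(x,K)\<in>p. Sup K - Inf K)" "F b - F a = (\<Sum>(x,K)\<in>p. F(Sup K) - F(Inf K))"
        using additive_tagged_division_1[where f= "\<lambda>x. x"] additive_tagged_division_1[where f= F]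
              \<open>a \<le> b\<close> ptag by auto
      have K: "\<exists>u v. K = {u..v} \<and> u \<le> v \<and> a \<le> u \<and> v \<le> b \<and> u \<le> x \<and> x \<le> v \<and> K \<subseteq> \<gamma> x"
        if "(x,K) \<in> p" for x K
      proof -
        have "x \<in> K" "K \<subseteq> {a..b}" "\<exists>u v. K = cbox u v" using ptag that by blast+
        moreover have "K \<subseteq> \<gamma> x" using fine that by blast
        ultimately show ?thesis by fastforce
      qed
      define p1 where "p1 = {q\<in>p. fst q \<notin> N}"
      define p2 where "p2 = {q\<in>p. fst q \<in> N}"
      define p3 where "p3 = {q\<in>p2. Inf (snd q) < Sup (snd q)}"
      have fin: "finite p1" "finite p2" "finite p3"
        using \<open>finite p\<close> by (auto simp: p1_def p2_def p3_def)
      define E where "E q = measure lborel (snd q) *\<^sub>R k (fst q) - (F (Sup (snd q)) - F (Inf (snd q)))" for q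
      have "(\<Sum>(x,K)\<in>p. measure lborel K *\<^sub>R k x) - (F b - F a) = sum E p"
        unfolding ba E_def by (simp add: sum_subtractf case_prod_unfold)
      also have "\<dots> = sum E p1 + sum E p2"
        unfolding p1_def p2_def using \<open>finite p\<close>
        by (subst sum.union_disjoint[symmetric]) (auto intro!: sum.cong)
      also have "norm \<dots> \<le> norm (sum E p1) + norm (sum E p2)" by (rule norm_triangle_ineq)
      finally have le: "norm ((\<Sum>(x,K)\<in>p. measure lborel K *\<^sub>R k x) - (F b - F a)) \<le> norm (sum E p1) + norm (sum E p2)" .
      \<comment> \<open>Straddle estimate: the tag lies between the endpoints, so the two one-sided
        errors add up to \<open>e1 * (v - u)\<close>, and \<open>e1\<close> is chosen so that the
        sum over the whole interval stays below e/2.\<close>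
      have "norm (sum E p1) \<le> (\<Sum>q\<in>p1. e1 * (Sup (snd q) - Inf (snd q)))"
      proof (rule sum_norm_le)
        fix q assume "q \<in> p1"
        then obtain x K where q: "q = (x,K)" "(x,K) \<in> p" "x \<notin> N" by (cases q) (auto simp: p1_def)
        obtain u v where uv: "K = {u..v}" "u \<le> v" "a \<le> u" "v \<le> b" "u \<le> x" "x \<le> v" "K \<subseteq> ball x (d x)"
          using K[OF q(2)] q by (auto simp: \<gamma>_def)
        have "u \<in> K" "v \<in> K" using uv by auto
        then have "u \<in> ball x (d x)" "v \<in> ball x (d x)" using uv(7) by blast+
        then have "norm (F u - F x - (u-x) *\<^sub>R h x) \<le> e1 * norm (u-x)"
          "norm (F v - F x - (v-x) *\<^sub>R h x) \<le> e1 * norm (v-x)"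
          using uv q d(2)[of x u] d(2)[of x v] by (auto simp: dist_real_def)
        moreover have "E q = (F u - F x - (u-x) *\<^sub>R h x) - (F v - F x - (v-x) *\<^sub>R h x)"
          using uv q by (simp add: E_def k_def algebra_simps)
        moreover have "e1 * norm (u-x) + e1 * norm (v-x) = e1 * (v - u)"
          using uv by (simp add: algebra_simps)
        ultimately show "norm (E q) \<le> e1 * (Sup (snd q) - Inf (snd q))"
          using norm_triangle_ineq4[of "F u - F x - (u-x) *\<^sub>R h x" "F v - F x - (v-x) *\<^sub>R h x"] uv q by simp
      qed
      also have "\<dots> \<le> (\<Sum>q\<in>p. e1 * (Sup (snd q) - Inf (snd q)))"
      proof (rule sum_mono2[OF \<open>finite p\<close>])
        show "p1 \<subseteq> p" by (auto simp: p1_def)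
        fix q assume "q \<in> p - p1"
        then show "0 \<le> e1 * (Sup (snd q) - Inf (snd q))"
          using K[of "fst q" "snd q"] \<open>e1 > 0\<close> by auto
      qed
      also have "\<dots> = e1 * (b - a)"
        by (simp add: ba sum_distrib_left case_prod_unfold)
      also have "\<dots> < e / 2"
        using \<open>e > 0\<close> \<open>a \<le> b\<close> by (simp add: e1_def field_simps)
      finally have S1: "norm (sum E p1) < e / 2" .
      \<comment> \<open>Degenerate intervals contribute nothing; discarding them is what makes a
        tagged piece recoverable from its pair of endpoints.\<close>
      have "sum E p2 = sum E p3"
      proof (rule sum.mono_neutral_right[OF fin(2)])
        show "p3 \<subseteq> p2" by (auto simp: p3_def)
        show "\<forall>q\<in>p2 - p3. E q = 0"
        proof
          fix q assume q: "q \<in> p2 - p3"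
          then obtain u v where "snd q = {u..v}" "u \<le> v" using K[of "fst q" "snd q"] by (auto simp: p2_def)
          then show "E q = 0" using q by (auto simp: E_def p3_def)
        qed
      qed
      define J where "J = (\<lambda>q. (Inf (snd q), Sup (snd q))) ` p3"
      have p3K: "\<exists>u v. snd q = {u..v} \<and> u < v \<and> a \<le> u \<and> v \<le> b \<and> {u..v} \<subseteq> G \<and> fst q \<in> N" if "q \<in> p3" for q
        using that K[of "fst q" "snd q"] by (force simp: p2_def p3_def \<gamma>_def)
      have dj: "interior (snd q) \<inter> interior (snd q') = {}" if "q \<in> p3" "q' \<in> p3" "q \<noteq> q'" for q q'
        using tagged_division_ofD(5)[OF ptag, of "fst q" "snd q" "fst q'" "snd q'"] that
        by (auto simp: p2_def p3_def)
      have inj: "inj_on (\<lambda>q. (Inf (snd q), Sup (snd q))) p3"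
      proof (rule inj_onI, rule ccontr)
        fix q q' assume q: "q \<in> p3" "q' \<in> p3" and eq: "(Inf (snd q), Sup (snd q)) = (Inf (snd q'), Sup (snd q'))"
          and "q \<noteq> q'"
        obtain u v where 1: "snd q = {u..v}" "u < v" using p3K[OF q(1)] by auto
        obtain u' v' where 2: "snd q' = {u'..v'}" "u' < v'" using p3K[OF q(2)] by auto
        have "interior (snd q) = {}" using dj[OF q \<open>q \<noteq> q'\<close>] 1 2 eq by simp
        then show False using 1 by simp
      qed
      have "norm (sum E p3) \<le> (\<Sum>q\<in>p3. norm (F (Sup (snd q)) - F (Inf (snd q))))"
      proof (rule sum_norm_le)
        fix q assume "q \<in> p3"
        then have "fst q \<in> N" using p3K by blast
        then show "norm (E q) \<le> norm (F (Sup (snd q)) - F (Inf (snd q)))"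
          by (simp add: E_def k_def norm_minus_commute)
      qed
      also have "\<dots> = (\<Sum>(u,v)\<in>J. norm (F v - F u))"
        unfolding J_def by (subst sum.reindex[OF inj]) simp
      also have "\<dots> < e / 2"
      proof (rule \<delta>)
        show "finite J" using fin by (simp add: J_def)
        show J1: "\<forall>(u,v)\<in>J. a \<le> u \<and> u \<le> v \<and> v \<le> b"
          using p3K by (force simp: J_def)
        show J2: "\<forall>(u,v)\<in>J. \<forall>(u',v')\<in>J. (u,v) \<noteq> (u',v') \<longrightarrow> {u<..<v} \<inter> {u'<..<v'} = {}"
        proof (clarsimp simp: J_def simp del: greaterThanLessThan_iff Int_greaterThanLessThan)
          fix x K x' K'
          assume q: "(x,K) \<in> p3" "(x',K') \<in> p3" and ne: "Inf K = Inf K' \<longrightarrow> Sup K \<noteq> Sup K'"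
          then have "(x,K) \<noteq> (x',K')" by auto
          then show "{Inf K<..<Sup K} \<inter> {Inf K'<..<Sup K'} = {}"
            using dj[OF q] p3K[OF q(1)] p3K[OF q(2)] by (auto simp del: Int_greaterThanLessThan)
        qed
        have "(\<Sum>(u,v)\<in>J. v - u) \<le> measure lebesgue G"
        proof (rule sum_length_le_measure[OF \<open>finite J\<close> _ _ GL])
          show "u \<le> v \<and> {u..v} \<subseteq> G" if "(u,v) \<in> J" for u v
            using that p3K unfolding J_def by fastforce
          show "{u<..<v} \<inter> {u'<..<v'} = {}" if "(u,v) \<in> J" "(u',v') \<in> J" "(u,v) \<noteq> (u',v')" for u v u' v'
            using J2[THEN bspec, OF that(1), unfolded prod.case, THEN bspec, OF that(2)] that(3) by simp
        qed
        with mG show "(\<Sum>(u,v)\<in>J. v - u) < \<delta>" by simp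
      qed
      finally have S2: "norm (sum E p2) < e / 2" using \<open>sum E p2 = sum E p3\<close> by simp
      show "norm ((\<Sum>(x,K)\<in>p. measure lborel K *\<^sub>R k x) - (F b - F a)) < e" using le S1 S2 by linarith
    qed
    ultimately show "\<exists>\<gamma>. gauge \<gamma> \<and> (\<forall>p. p tagged_division_of {a..b} \<and> \<gamma> fine p \<longrightarrow>
        norm ((\<Sum>(x,K)\<in>p. measure lborel K *\<^sub>R k x) - (F b - F a)) < e)"
      by (intro exI[of _ \<gamma>] conjI)
  qed
  then show ?thesis
    by (rule has_integral_spike[OF N, rotated]) (simp add: k_def)
qed

text \<open>Lebesgue differentiation supplies forward difference quotients; applied to the reflected
  function it supplies the backward ones, and the two exceptional sets are united. Extension by zero
  lets the quotients overrun the ends of the interval.\<close>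

lemma indefinite_integral_has_vector_derivative_AE:
  fixes f :: "real \<Rightarrow> 'b::euclidean_space"
  assumes f: "f integrable_on {a..b}"
  obtains N where "negligible N"
    "\<And>x. x \<in> {a..b} - N \<Longrightarrow>
       ((\<lambda>t. integral {a..t} f) has_vector_derivative f x) (at x within {a..b})"
proof -
  define k where "k x = (if x \<in> {a..b} then f x else 0)" for x
  have k: "k integrable_on UNIV"
    unfolding k_def by (rule integrable_restrict_UNIV[THEN iffD2, OF f])
  have kI: "k integrable_on {c..d}" for c d
    using k integrable_on_subcbox[of k UNIV c d] by simp
  have kI': "(\<lambda>x. k (-x)) integrable_on {c..d}" for c d
    using kI[of "-d" "-c"] Henstock_Kurzweil_Integration.integrable_reflect_real[where f=k and a="-d" and b="-c"] by simp
  obtain N1 where N1: "negligible N1" "\<And>x e. \<lbrakk>x \<notin> N1; 0 < e\<rbrakk> \<Longrightarrow>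
      \<exists>d>0. \<forall>h. 0 < h \<and> h < d \<longrightarrow> norm (integral {x..x+h} k /\<^sub>R h - k x) < e"
    using integrable_ccontinuous_explicit[of k] kI by auto
  obtain N2 where N2: "negligible N2" "\<And>x e. \<lbrakk>x \<notin> N2; 0 < e\<rbrakk> \<Longrightarrow>
      \<exists>d>0. \<forall>h. 0 < h \<and> h < d \<longrightarrow> norm (integral {x..x+h} (\<lambda>x. k (-x)) /\<^sub>R h - k (-x)) < e"
    using integrable_ccontinuous_explicit[of "\<lambda>x. k (-x)"] kI' by auto
  have "negligible (uminus ` N2)"
    by (rule negligible_differentiable_image_negligible[OF order_refl N2(1)])
      (auto intro!: derivative_intros simp: differentiable_on_def)
  then have N: "negligible (N1 \<union> uminus ` N2)" using N1(1) by (simp add: negligible_Un)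
  moreover have "((\<lambda>t. integral {a..t} f) has_vector_derivative f x) (at x within {a..b})"
    if x: "x \<in> {a..b} - (N1 \<union> uminus ` N2)" for x
    unfolding has_vector_derivative_def has_derivative_within_alt
  proof (intro conjI allI impI)
    show "bounded_linear (\<lambda>h. h *\<^sub>R f x)" by (rule bounded_linear_scaleR_left)
    fix e :: real assume "e > 0"
    have xx: "x \<notin> N1" "- x \<notin> N2" "a \<le> x" "x \<le> b" using x by force+
    obtain d1 where d1: "d1 > 0" "\<And>h. 0 < h \<Longrightarrow> h < d1 \<Longrightarrow> norm (integral {x..x+h} k /\<^sub>R h - k x) < e"
      using N1(2)[OF xx(1) \<open>e > 0\<close>] by blast
    obtain d2 where d2: "d2 > 0" "\<And>h. 0 < h \<Longrightarrow> h < d2 \<Longrightarrow> norm (integral {-x..-x+h} (\<lambda>x. k (-x)) /\<^sub>R h - k x) < e"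
      using N2(2)[OF xx(2) \<open>e > 0\<close>] by auto
    have scale: "norm (I - h *\<^sub>R v) \<le> e * h" if "0 < h" "norm (I /\<^sub>R h - v) < e" for I v :: 'b and h
    proof -
      have "I - h *\<^sub>R v = h *\<^sub>R (I /\<^sub>R h - v)" using that by (simp add: algebra_simps)
      then have "norm (I - h *\<^sub>R v) = h * norm (I /\<^sub>R h - v)" using that by simp
      also have "\<dots> \<le> h * e" using that by (intro mult_left_mono) auto
      finally show ?thesis by (simp add: mult.commute)
    qed
    have "norm (integral {a..y} f - integral {a..x} f - (y - x) *\<^sub>R f x) \<le> e * norm (y - x)"
      if y: "y \<in> {a..b}" "norm (y - x) < min d1 d2" for y
    proof (cases x y rule: linorder_cases)
      case less
      have "integral {a..x} f + integral {x..y} f = integral {a..y} f"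
        using xx y less f
        by (intro Henstock_Kurzweil_Integration.integral_combine) (auto intro: integrable_subinterval_real)
      moreover have "integral {x..y} f = integral {x..y} k"
        using xx y by (intro integral_cong) (auto simp: k_def)
      moreover have "norm (integral {x..y} k - (y - x) *\<^sub>R k x) \<le> e * (y - x)"
        using scale[of "y - x" "integral {x..y} k" "k x"] d1(2)[of "y - x"] less y by auto
      moreover have "k x = f x" using xx by (simp add: k_def)
      moreover have "integral {a..y} f - integral {a..x} f - (y - x) *\<^sub>R f x = integral {x..y} k - (y - x) *\<^sub>R k x"
        using calculation by (simp add: algebra_simps)
      ultimately show ?thesis using less by (simp only:) simp
    next
      case greater
      have "integral {a..y} f + integral {y..x} f = integral {a..x} f"
        using xx y greater f
        by (intro Henstock_Kurzweil_Integration.integral_combine) (auto intro: integrable_subinterval_real)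
      moreover have "integral {y..x} f = integral {y..x} k"
        using xx y by (intro integral_cong) (auto simp: k_def)
      moreover have "norm (integral {y..x} k - (x - y) *\<^sub>R k x) \<le> e * (x - y)"
        using scale[of "x - y" "integral {y..x} k" "k x"] d2(2)[of "x - y"] greater y by auto
      moreover have "k x = f x" using xx by (simp add: k_def)
      moreover have "integral {a..y} f - integral {a..x} f - (y - x) *\<^sub>R f x = - (integral {y..x} k - (x - y) *\<^sub>R k x)"
        using calculation by (simp add: algebra_simps)
      ultimately show ?thesis using greater by (simp only: norm_minus_cancel) simp
    qed simp
    then show "\<exists>d>0. \<forall>y\<in>{a..b}. norm (y - x) < d \<longrightarrow>
        norm (integral {a..y} f - integral {a..x} f - (y - x) *\<^sub>R f x) \<le> e * norm (y - x)"
      using d1 d2 by (metis min_less_iff_conj)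
  qed
  ultimately show ?thesis using that by blast
qed

text \<open>Multiplying the right-hand side \<open>v\<close> by the integrating factor
  \<open>exp (- L * t)\<close> gives a nonincreasing function, because
  \<open>v' = L u \<le> L v\<close>; its initial value is \<open>c\<close>.\<close>

lemma gronwall:
  fixes u :: "real \<Rightarrow> real"
  assumes u: "continuous_on {0..S} u" and "0 \<le> L"
    and le: "\<And>t. t \<in> {0..S} \<Longrightarrow> u t \<le> c + L * integral {0..t} u"
    and t: "t \<in> {0..S}"
  shows "u t \<le> c * exp (L * t)"
proof -
  define v where "v t = c + L * integral {0..t} u" for t
  have v': "(v has_real_derivative L * u s) (at s within {0..S})" if "s \<in> {0..S}" for s
    unfolding v_def using integral_has_real_derivative[OF u that]
    by (auto intro!: derivative_eq_intros)
  have "exp (- L * t) * v t \<le> exp (- L * 0) * v 0"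
  proof (rule DERIV_nonpos_imp_decreasing_open[where f="\<lambda>t. exp (- L * t) * v t"])
    show "0 \<le> t" using t by simp
    fix s assume s: "0 < s" "s < t"
    then have "(v has_real_derivative L * u s) (at s)"
      using v'[of s] t by (simp add: at_within_Icc_at)
    then have "((\<lambda>t. exp (- L * t) * v t) has_real_derivative
        (- L * exp (- L * s)) * v s + (L * u s) * exp (- L * s)) (at s)"
      by (auto intro!: derivative_eq_intros)
    moreover have "(- L * exp (- L * s)) * v s + (L * u s) * exp (- L * s) \<le> 0"
    proof -
      have "L * exp (- L * s) * u s \<le> L * exp (- L * s) * v s"
        using le[of s] s t \<open>0 \<le> L\<close> by (intro mult_left_mono) (auto simp: v_def)
      then show ?thesis by (simp add: algebra_simps)
    qed
    ultimately show "\<exists>y. ((\<lambda>t. exp (- L * t) * v t) has_real_derivative y) (at s) \<and> y \<le> 0" by blast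
  next
    have "continuous_on {0..S} v"
      using v' by (meson DERIV_continuous continuous_on_eq_continuous_within)
    then show "continuous_on {0..t} (\<lambda>t. exp (- L * t) * v t)"
      using t by (intro continuous_intros) (auto intro: continuous_on_subset)
  qed
  then have "exp (- L * t) * v t \<le> c" by (simp add: v_def)
  then have "exp (L * t) * (exp (- L * t) * v t) \<le> exp (L * t) * c"
    by (intro mult_left_mono) auto
  moreover have "exp (L * t) * (exp (- L * t) * v t) = v t"
    by (simp add: exp_minus)
  ultimately have "v t \<le> c * exp (L * t)" by (simp only: mult.commute)
  then show ?thesis using le[OF t] by (simp add: v_def)
qed

section \<open>Integrals of bounded measurable functions\<close>

lemma bounded_measurable_integrable_on:
  fixes h :: "real \<Rightarrow> 'a::euclidean_space"
  assumes "h \<in> borel_measurable (lebesgue_on {a..b})" "\<And>s. s \<in> {a..b} \<Longrightarrow> norm (h s) \<le> B"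
  shows "h integrable_on {a..b}"
proof (rule measurable_bounded_by_integrable_imp_integrable[OF assms(1) integrable_const_ivl])
  show "norm (h s) \<le> B" if "s \<in> {a..b}" for s using that by (rule assms(2))
  show "{a..b} \<in> sets lebesgue" by simp
qed

lemma norm_integral_bound_length:
  fixes h :: "real \<Rightarrow> 'a::euclidean_space"
  assumes "h integrable_on {a..b}" "\<And>s. s \<in> {a..b} \<Longrightarrow> norm (h s) \<le> B" "a \<le> b"
  shows "norm (integral {a..b} h) \<le> B * (b - a)"
proof -
  have "norm (integral {a..b} h) \<le> integral {a..b} (\<lambda>_. B)"
    by (rule integral_norm_bound_integral[OF assms(1) integrable_const_ivl assms(2)])
  also have "\<dots> = B * (b - a)" using assms(3) by simp
  finally show ?thesis .
qed

lemma integral_diff_interval: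
  fixes h :: "real \<Rightarrow> 'a::banach"
  assumes "h integrable_on {a..b}" "a \<le> s" "s \<le> t" "t \<le> b"
  shows "integral {a..t} h - integral {a..s} h = integral {s..t} h"
proof -
  have "h integrable_on {a..t}" by (rule integrable_subinterval_real[OF assms(1)]) (use assms(2-4) in simp)
  from Henstock_Kurzweil_Integration.integral_combine[OF assms(2,3) this] show ?thesis
    by (simp add: algebra_simps)
qed

lemma indefinite_integral_Lipschitz:
  fixes h :: "real \<Rightarrow> 'a::euclidean_space"
  assumes "h integrable_on {a..b}" "\<And>s. s \<in> {a..b} \<Longrightarrow> norm (h s) \<le> B" "a \<le> s" "s \<le> t" "t \<le> b"
  shows "norm (integral {a..t} h - integral {a..s} h) \<le> B * (t - s)"
  unfolding integral_diff_interval[OF assms(1,3-5)]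
proof (rule norm_integral_bound_length)
  show "h integrable_on {s..t}" by (rule integrable_subinterval_real[OF assms(1)]) (use assms(3-5) in simp)
  show "norm (h r) \<le> B" if "r \<in> {s..t}" for r by (rule assms(2)) (use that assms(3-5) in simp)
  show "s \<le> t" by fact
qed

section \<open>Control systems with bounded Lipschitz fields\<close>

text \<open>Since \<open>h\<close> is controlled only over \<open>UNIV \<times> U\<close>, the pair
  of state and control is first made a measurable map into that subspace and then composed with the
  restriction of \<open>h\<close>.\<close>

lemma borel_measurable_continuous_on_pair:
  fixes z :: "real \<Rightarrow> 'z::euclidean_space" and \<omega> :: "real \<Rightarrow> 'u::euclidean_space"
    and h :: "'z \<Rightarrow> 'u \<Rightarrow> 'b::topological_space"
  assumes h: "continuous_on (UNIV \<times> U) (\<lambda>(x,u). h x u)"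
    and z: "continuous_on {0..S} z" and \<omega>: "\<omega> \<in> borel_measurable (lebesgue_on {0..S})" "\<omega> \<in> {0..S} \<rightarrow> U"
  shows "(\<lambda>s. h (z s) (\<omega> s)) \<in> borel_measurable (lebesgue_on {0..S})"
proof -
  have "z \<in> borel_measurable (lebesgue_on {0..S})"
    by (rule continuous_imp_measurable_on_sets_lebesgue[OF z]) simp
  then have "(\<lambda>s. (z s, \<omega> s)) \<in> borel_measurable (lebesgue_on {0..S})"
    using \<omega>(1) by (rule borel_measurable_Pair)
  then have "(\<lambda>s. (z s, \<omega> s)) \<in> lebesgue_on {0..S} \<rightarrow>\<^sub>M restrict_space borel (UNIV \<times> U)"
    using \<omega>(2) by (intro measurable_restrict_space2) auto
  from measurable_compose[OF this borel_measurable_continuous_on_restrict[OF h]]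
  show ?thesis by simp
qed

text \<open>Picard iteration in a weighted supremum norm is a contraction on the whole interval at
  once, so local solutions need not be glued. The base time \<open>t0\<close> is free because
  trajectories are prescribed at 0 and costates at \<open>S\<close>.\<close>

lemma caratheodory_solution_exists:
  fixes \<Phi> :: "real \<Rightarrow> 'z::euclidean_space \<Rightarrow> 'z"
  assumes t0: "t0 \<in> {0..S}" and "0 < L"
    and meas: "\<And>z. continuous_on {0..S} z \<Longrightarrow> (\<lambda>s. \<Phi> s (z s)) \<in> borel_measurable (lebesgue_on {0..S})"
    and lip: "\<And>s x y. s \<in> {0..S} \<Longrightarrow> norm (\<Phi> s x - \<Phi> s y) \<le> L * norm (x - y)"
    and bd: "\<And>s. s \<in> {0..S} \<Longrightarrow> norm (\<Phi> s 0) \<le> B"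
  obtains z where "continuous_on {0..S} z"
    "\<And>t. t \<in> {0..S} \<Longrightarrow> z t = z0 + integral {0..t} (\<lambda>s. \<Phi> s (z s)) - integral {0..t0} (\<lambda>s. \<Phi> s (z s))"
proof -
  have int: "(\<lambda>s. \<Phi> s (z s)) integrable_on {0..S}" if z: "continuous_on {0..S} z" for z
  proof -
    obtain M where M: "\<And>s. s \<in> {0..S} \<Longrightarrow> norm (z s) \<le> M"
      using compact_imp_bounded[OF compact_continuous_image[OF z compact_Icc]]
      unfolding bounded_iff by blast
    have "norm (\<Phi> s (z s)) \<le> B + L * M" if "s \<in> {0..S}" for s
    proof -
      have "norm (\<Phi> s (z s)) \<le> norm (\<Phi> s 0) + norm (\<Phi> s (z s) - \<Phi> s 0)"
        by (rule norm_triangle_sub)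
      also have "norm (\<Phi> s (z s) - \<Phi> s 0) \<le> L * norm (z s)" using lip[OF that, of "z s" 0] by simp
      also have "\<dots> \<le> L * M" using M[OF that] \<open>0 < L\<close> by simp
      finally show ?thesis using bd[OF that] by linarith
    qed
    then show ?thesis using bounded_measurable_integrable_on[OF meas[OF z]] by blast
  qed
  \<comment> \<open>Bielecki weight: the rate is twice the Lipschitz constant, which produces the
    contraction factor 1/2 whatever the length of the interval.\<close>
  define w where "w t = exp (2 * L * \<bar>t - t0\<bar>)" for t
  have w_pos: "w t > 0" for t by (simp add: w_def)
  have w_cont: "continuous_on A w" for A unfolding w_def by (intro continuous_intros)
  \<comment> \<open>Clamping time to the interval turns the iterates into bounded continuous
    functions on the line, a complete metric space.\<close>
  define c where "c t = max 0 (min t S)" for t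
  have c_cont: "continuous_on A c" for A unfolding c_def by (intro continuous_intros)
  have c_in: "c t \<in> {0..S}" for t using t0 by (auto simp: c_def)
  have c_id: "c t = t" if "t \<in> {0..S}" for t using that by (auto simp: c_def)
  \<comment> \<open>The fixed point is sought for the rescaled curve \<open>\<psi>\<close>;
    \<open>Z \<psi>\<close> undoes the weight.\<close>
  define Z where "Z \<psi> s = w s *\<^sub>R apply_bcontfun \<psi> s" for \<psi> :: "real \<Rightarrow>\<^sub>C 'z" and s
  have Z_cont: "continuous_on A (Z \<psi>)" for A \<psi> unfolding Z_def by (intro continuous_intros w_cont) simp
  define I where "I \<psi> t = integral {0..t} (\<lambda>s. \<Phi> s (Z \<psi> s))" for \<psi> t
  define G where "G \<psi> t = z0 + I \<psi> t - I \<psi> t0" for \<psi> t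
  define T where "T \<psi> t = (1 / w (c t)) *\<^sub>R G \<psi> (c t)" for \<psi> t
  have G_cont: "continuous_on {0..S} (G \<psi>)" for \<psi>
    unfolding G_def I_def by (intro continuous_intros indefinite_integral_continuous_1 int Z_cont)
  have T_cont: "continuous_on UNIV (T \<psi>)" for \<psi>
    unfolding T_def
    using c_in w_pos
    by (intro continuous_intros continuous_on_compose2[OF G_cont c_cont] continuous_on_compose2[OF w_cont c_cont])
      (auto simp: less_imp_neq[symmetric])
  have T_bcont: "T \<psi> \<in> bcontfun" for \<psi>
  proof -
    have "range (T \<psi>) \<subseteq> (\<lambda>t. (1 / w t) *\<^sub>R G \<psi> t) ` {0..S}"
      using c_in by (auto simp: T_def)
    moreover have "compact ((\<lambda>t. (1 / w t) *\<^sub>R G \<psi> t) ` {0..S})"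
      using w_pos by (intro compact_continuous_image continuous_intros G_cont w_cont compact_Icc)
        (auto simp: less_imp_neq[symmetric])
    ultimately have "bounded (range (T \<psi>))" by (meson bounded_subset compact_imp_bounded)
    then show ?thesis using T_cont by (simp add: bcontfun_def)
  qed
  have contr: "norm (G \<psi> t - G \<psi>' t) \<le> (dist \<psi> \<psi>' / 2) * w t" if t: "t \<in> {0..S}" for \<psi> \<psi>' t
  proof -
    define d where "d = dist \<psi> \<psi>'"
    have "d \<ge> 0" by (simp add: d_def)
    define D where "D s = \<Phi> s (Z \<psi> s) - \<Phi> s (Z \<psi>' s)" for s
    have DI: "D integrable_on {0..S}" unfolding D_def by (intro integrable_diff int Z_cont)
    have ID: "I \<psi> r - I \<psi>' r = integral {0..r} D" if "r \<in> {0..S}" for r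
    proof -
      have "(\<lambda>s. \<Phi> s (Z \<psi> s)) integrable_on {0..r}" for \<psi>
        by (rule integrable_subinterval_real[OF int[OF Z_cont[of "{0..S}" \<psi>]]]) (use that in simp)
      then show ?thesis unfolding I_def D_def by (simp add: integral_diff)
    qed
    have Dle: "norm (D s) \<le> L * d * w s" if s: "s \<in> {0..S}" for s
    proof -
      have "norm (D s) \<le> L * norm (Z \<psi> s - Z \<psi>' s)" unfolding D_def by (rule lip[OF s])
      also have "norm (Z \<psi> s - Z \<psi>' s) = w s * dist (apply_bcontfun \<psi> s) (apply_bcontfun \<psi>' s)"
        using w_pos[of s] by (simp add: Z_def scaleR_diff_right[symmetric] dist_norm)
      also have "L * \<dots> \<le> L * (w s * d)"
        using w_pos[of s] \<open>0 < L\<close> dist_bounded[of \<psi> s \<psi>'] by (intro mult_left_mono) (auto simp: d_def)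
      finally show ?thesis by (simp add: mult_ac)
    qed
    have GG: "G \<psi> t - G \<psi>' t = integral {0..t} D - integral {0..t0} D"
      using ID[OF t] ID[OF t0] by (simp add: G_def algebra_simps)
    show ?thesis
    proof (cases "t0 \<le> t")
      case True
      \<comment> \<open>The weight is integrated exactly: its primitive carries the factor 1 / (2
        L), which turns \<open>L * d\<close> into \<open>d / 2\<close>.\<close>
      have "((\<lambda>s. L * d * exp (2 * L * (s - t0))) has_integral
          (d / 2 * exp (2 * L * (t - t0)) - d / 2 * exp (2 * L * (t0 - t0)))) {t0..t}"
        using True \<open>0 < L\<close>
        by (intro fundamental_theorem_of_calculus)
          (auto intro!: derivative_eq_intros simp: has_real_derivative_iff_has_vector_derivative[symmetric])
      then have hi: "((\<lambda>s. L * d * w s) has_integral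
          (d / 2 * exp (2 * L * (t - t0)) - d / 2 * exp (2 * L * (t0 - t0)))) {t0..t}"
        by (rule has_integral_eq[rotated]) (auto simp: w_def)
      have "G \<psi> t - G \<psi>' t = integral {t0..t} D"
        unfolding GG by (rule integral_diff_interval[OF DI]) (use t t0 True in auto)
      also have "norm \<dots> \<le> integral {t0..t} (\<lambda>s. L * d * w s)"
      proof (rule integral_norm_bound_integral)
        show "D integrable_on {t0..t}" by (rule integrable_subinterval_real[OF DI]) (use t t0 in auto)
        show "(\<lambda>s. L * d * w s) integrable_on {t0..t}" using hi by blast
        show "norm (D s) \<le> L * d * w s" if "s \<in> {t0..t}" for s using that t t0 by (intro Dle) auto
      qed
      also have "\<dots> = d / 2 * exp (2 * L * (t - t0)) - d / 2 * exp (2 * L * (t0 - t0))"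
        by (rule integral_unique[OF hi])
      also have "\<dots> \<le> d / 2 * w t" using True \<open>d \<ge> 0\<close> by (simp add: w_def)
      finally show ?thesis by (simp add: d_def)
    next
      case False
      have "((\<lambda>s. L * d * exp (2 * L * (t0 - s))) has_integral
          (- d / 2 * exp (2 * L * (t0 - t0)) - (- d / 2 * exp (2 * L * (t0 - t))))) {t..t0}"
        using False \<open>0 < L\<close>
        by (intro fundamental_theorem_of_calculus)
          (auto intro!: derivative_eq_intros simp: has_real_derivative_iff_has_vector_derivative[symmetric])
      then have hi: "((\<lambda>s. L * d * w s) has_integral
          (- d / 2 * exp (2 * L * (t0 - t0)) - (- d / 2 * exp (2 * L * (t0 - t))))) {t..t0}"
        by (rule has_integral_eq[rotated]) (auto simp: w_def)
      have "- (G \<psi> t - G \<psi>' t) = integral {0..t0} D - integral {0..t} D" by (simp add: GG)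
      also have "\<dots> = integral {t..t0} D"
        by (rule integral_diff_interval[OF DI]) (use t t0 False in auto)
      finally have "norm (G \<psi> t - G \<psi>' t) = norm (integral {t..t0} D)" by (metis norm_minus_cancel)
      also have "norm (integral {t..t0} D) \<le> integral {t..t0} (\<lambda>s. L * d * w s)"
      proof (rule integral_norm_bound_integral)
        show "D integrable_on {t..t0}" by (rule integrable_subinterval_real[OF DI]) (use t t0 in auto)
        show "(\<lambda>s. L * d * w s) integrable_on {t..t0}" using hi by blast
        show "norm (D s) \<le> L * d * w s" if "s \<in> {t..t0}" for s using that t t0 by (intro Dle) auto
      qed
      also have "\<dots> = - d / 2 * exp (2 * L * (t0 - t0)) - (- d / 2 * exp (2 * L * (t0 - t)))"
        by (rule integral_unique[OF hi])
      also have "\<dots> \<le> d / 2 * w t" using False \<open>d \<ge> 0\<close> by (simp add: w_def)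
      finally show ?thesis by (simp add: d_def)
    qed
  qed
  have "\<exists>!\<psi>. Bcontfun (T \<psi>) = \<psi>"
  proof (rule banach_fix_type[of "1/2"])
    show "\<forall>\<psi> \<psi>'. dist (Bcontfun (T \<psi>)) (Bcontfun (T \<psi>')) \<le> 1 / 2 * dist \<psi> \<psi>'"
    proof (intro allI dist_bound)
      fix \<psi> \<psi>' :: "real \<Rightarrow>\<^sub>C 'z" and t
      have "norm (T \<psi> t - T \<psi>' t) = norm (G \<psi> (c t) - G \<psi>' (c t)) / w (c t)"
        using w_pos[of "c t"] by (simp add: T_def scaleR_diff_right[symmetric] divide_inverse)
      also have "\<dots> \<le> dist \<psi> \<psi>' / 2"
        using contr[OF c_in, of \<psi> t \<psi>'] w_pos[of "c t"] by (simp add: divide_le_eq)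
      finally show "dist (apply_bcontfun (Bcontfun (T \<psi>)) t) (apply_bcontfun (Bcontfun (T \<psi>')) t) \<le> 1 / 2 * dist \<psi> \<psi>'"
        by (simp add: Bcontfun_inverse[OF T_bcont] dist_norm)
    qed
  qed auto
  then obtain \<psi> where "Bcontfun (T \<psi>) = \<psi>" by blast
  then have fix_eq: "apply_bcontfun \<psi> t = T \<psi> t" for t by (metis Bcontfun_inverse[OF T_bcont])
  have "Z \<psi> t = z0 + integral {0..t} (\<lambda>s. \<Phi> s (Z \<psi> s)) - integral {0..t0} (\<lambda>s. \<Phi> s (Z \<psi> s))"
    if "t \<in> {0..S}" for t
  proof -
    have "Z \<psi> t = w t *\<^sub>R T \<psi> t" by (simp add: Z_def fix_eq)
    also have "\<dots> = G \<psi> t" using w_pos[of t] by (simp add: T_def c_id[OF that])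
    finally show ?thesis by (simp add: G_def I_def)
  qed
  with Z_cont show ?thesis using that by blast
qed

text \<open>The global bound and Lipschitz constant give solutions on all of \<open>{0..S}\<close>
  for every admissible control, with estimates uniform in the control.\<close>

locale control_system =
  fixes X :: "'z::euclidean_space \<Rightarrow> 'u::euclidean_space \<Rightarrow> 'z"
    and U :: "'u set" and S :: real and z0 :: 'z and B L :: real
  assumes S_pos: "0 < S" and L_pos: "0 < L"
    and X_cont: "continuous_on (UNIV \<times> U) (\<lambda>(z,u). X z u)"
    and X_bound: "\<And>z u. u \<in> U \<Longrightarrow> norm (X z u) \<le> B"
    and X_lip: "\<And>x y u. u \<in> U \<Longrightarrow> norm (X x u - X y u) \<le> L * norm (x - y)"
begin

definition admissible :: "(real \<Rightarrow> 'u) \<Rightarrow> bool" where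
  "admissible \<omega> \<longleftrightarrow> \<omega> \<in> borel_measurable (lebesgue_on {0..S}) \<and> \<omega> \<in> {0..S} \<rightarrow> U"

definition trajectory :: "(real \<Rightarrow> 'u) \<Rightarrow> (real \<Rightarrow> 'z) \<Rightarrow> bool" where
  "trajectory \<omega> z \<longleftrightarrow> continuous_on {0..S} z \<and>
     (\<forall>t\<in>{0..S}. z t = z0 + integral {0..t} (\<lambda>s. X (z s) (\<omega> s)))"

lemma admissible_in: "admissible \<omega> \<Longrightarrow> s \<in> {0..S} \<Longrightarrow> \<omega> s \<in> U"
  by (auto simp: admissible_def)

lemma trajectoryD:
  assumes "trajectory \<omega> z"
  shows "continuous_on {0..S} z" "t \<in> {0..S} \<Longrightarrow> z t = z0 + integral {0..t} (\<lambda>s. X (z s) (\<omega> s))"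
  using assms by (auto simp: trajectory_def)

lemma field_measurable:
  assumes "admissible \<omega>" "continuous_on {0..S} z"
  shows "(\<lambda>s. X (z s) (\<omega> s)) \<in> borel_measurable (lebesgue_on {0..S})"
  using borel_measurable_continuous_on_pair[OF X_cont assms(2)] assms(1) by (auto simp: admissible_def)

lemma field_integrable:
  assumes "admissible \<omega>" "continuous_on {0..S} z"
  shows "(\<lambda>s. X (z s) (\<omega> s)) integrable_on {0..S}"
  by (rule bounded_measurable_integrable_on[OF field_measurable[OF assms]])
    (rule X_bound[OF admissible_in[OF assms(1)]])

lemma trajectory_exists:
  assumes "admissible \<omega>"
  obtains z where "trajectory \<omega> z"
proof -
  have 0: "0 \<in> {0..S}" using S_pos by simp
  show thesis
  proof (rule caratheodory_solution_exists[where \<Phi>="\<lambda>s x. X x (\<omega> s)" and ?z0.0=z0 and B=B,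
          OF 0 L_pos field_measurable[OF assms] X_lip[OF admissible_in[OF assms]] X_bound[OF admissible_in[OF assms]]])
    fix z assume "continuous_on {0..S} z"
      "\<And>t. t \<in> {0..S} \<Longrightarrow> z t = z0 + integral {0..t} (\<lambda>s. X (z s) (\<omega> s)) - integral {0..0} (\<lambda>s. X (z s) (\<omega> s))"
    then have "trajectory \<omega> z" by (simp add: trajectory_def)
    then show thesis by (rule that)
  qed
qed

lemma trajectory_Lipschitz:
  assumes "admissible \<omega>" "trajectory \<omega> z" "0 \<le> s" "s \<le> t" "t \<le> S"
  shows "norm (z t - z s) \<le> B * (t - s)"
proof -
  note I = field_integrable[OF assms(1) trajectoryD(1)[OF assms(2)]]
  have "norm (integral {0..t} (\<lambda>s. X (z s) (\<omega> s)) - integral {0..s} (\<lambda>s. X (z s) (\<omega> s))) \<le> B * (t - s)"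
    by (rule indefinite_integral_Lipschitz[OF I X_bound[OF admissible_in[OF assms(1)]] assms(3-5)])
  then show ?thesis
    using trajectoryD(2)[OF assms(2), of s] trajectoryD(2)[OF assms(2), of t] assms(3-5) by simp
qed

text \<open>Where the controls agree, the Lipschitz bound feeds Gronwall; where they differ,
  \<open>X_bound\<close> costs \<open>2 * B\<close> per unit of time. Hence a needle of length
  \<epsilon> moves the trajectory by O(\<epsilon>), however far its value is from the
  reference.\<close>

lemma trajectory_stability:
  assumes \<omega>: "admissible \<omega>" "trajectory \<omega> z" and \<omega>': "admissible \<omega>'" "trajectory \<omega>' z'"
    and E: "E \<in> lmeasurable" and eq: "\<And>s. s \<in> {0..S} - E \<Longrightarrow> \<omega> s = \<omega>' s" and t: "t \<in> {0..S}"
  shows "norm (z t - z' t) \<le> 2 * B * measure lebesgue E * exp (L * S)"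
proof -
  define m where "m = 2 * B * measure lebesgue E"
  note c = trajectoryD(1)[OF \<omega>(2)] trajectoryD(1)[OF \<omega>'(2)]
  have "0 \<in> {0..S}" using S_pos by simp
  then have "B \<ge> 0" using X_bound[OF admissible_in[OF \<omega>(1)], of 0 undefined] norm_ge_zero order_trans by blast
  then have "m \<ge> 0" by (simp add: m_def)
  define u where "u s = norm (z s - z' s)" for s
  have u: "continuous_on {0..S} u" unfolding u_def by (intro continuous_intros c)
  have uI: "u integrable_on {0..r}" if "r \<le> S" for r
    by (rule integrable_continuous_real) (rule continuous_on_subset[OF u], use that in auto)
  have le: "u r \<le> m + L * integral {0..r} u" if r: "r \<in> {0..S}" for r
  proof -
    note I = field_integrable[OF \<omega>(1) c(1)] field_integrable[OF \<omega>'(1) c(2)]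
    have I': "(\<lambda>s. X (z s) (\<omega> s)) integrable_on {0..r}" "(\<lambda>s. X (z' s) (\<omega>' s)) integrable_on {0..r}"
      by (rule integrable_subinterval_real[OF I(1)] integrable_subinterval_real[OF I(2)], use r in simp)+
    have EI: "(indicat_real E) integrable_on {0..r}"
      using E by (simp add: integrable_on_indicator fmeasurable_Int_fmeasurable)
    have EI': "integral {0..r} (indicat_real E) \<le> measure lebesgue E"
    proof -
      have "integral {0..r} (indicat_real E) = measure lebesgue (E \<inter> {0..r})"
        using E by (intro integral_indicator) (simp add: fmeasurable_Int_fmeasurable)
      also have "\<dots> \<le> measure lebesgue E"
        using E by (intro measure_mono_fmeasurable) (auto simp: fmeasurableD)
      finally show ?thesis .
    qed
    have "z r - z' r = integral {0..r} (\<lambda>s. X (z s) (\<omega> s) - X (z' s) (\<omega>' s))"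
      using trajectoryD(2)[OF \<omega>(2) r] trajectoryD(2)[OF \<omega>'(2) r] integral_diff[OF I'] by simp
    then have "u r = norm (integral {0..r} (\<lambda>s. X (z s) (\<omega> s) - X (z' s) (\<omega>' s)))"
      by (simp add: u_def)
    also have "\<dots> \<le> integral {0..r} (\<lambda>s. L * u s + 2 * B * indicat_real E s)"
    proof (rule integral_norm_bound_integral)
      show "(\<lambda>s. X (z s) (\<omega> s) - X (z' s) (\<omega>' s)) integrable_on {0..r}" by (rule integrable_diff[OF I'])
      show "(\<lambda>s. L * u s + 2 * B * indicat_real E s) integrable_on {0..r}"
        using uI EI r by (intro integrable_add integrable_on_mult_right) auto
      fix s assume "s \<in> {0..r}"
      then have s: "s \<in> {0..S}" using r by auto
      note U = admissible_in[OF \<omega>(1) s] admissible_in[OF \<omega>'(1) s]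
      show "norm (X (z s) (\<omega> s) - X (z' s) (\<omega>' s)) \<le> L * u s + 2 * B * indicat_real E s"
      proof (cases "s \<in> E")
        case True
        have "norm (X (z s) (\<omega> s) - X (z' s) (\<omega>' s)) \<le> B + B"
          by (rule norm_triangle_le_diff[OF add_mono[OF X_bound[OF U(1)] X_bound[OF U(2)]]])
        moreover have "0 \<le> L * u s" using L_pos by (simp add: u_def)
        ultimately show ?thesis using True by simp
      next
        case False
        then show ?thesis using eq[of s] s X_lip[OF U(1), of "z s" "z' s"] by (simp add: u_def)
      qed
    qed
    also have "\<dots> = L * integral {0..r} u + 2 * B * integral {0..r} (indicat_real E)"
      using uI EI r by (subst integral_add) (auto intro!: integrable_on_mult_right)
    also have "\<dots> \<le> L * integral {0..r} u + m"
      using EI' \<open>B \<ge> 0\<close> by (simp add: m_def mult_left_mono)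
    finally show ?thesis by simp
  qed
  have "u t \<le> m * exp (L * t)"
    by (rule gronwall[OF u _ le t]) (use L_pos in simp)
  also have "\<dots> \<le> m * exp (L * S)" using \<open>m \<ge> 0\<close> t L_pos by (intro mult_left_mono) auto
  finally show ?thesis by (simp add: u_def m_def)
qed

end

section \<open>Needle variations and costates\<close>

text \<open>The shift is by the lengths of all earlier needles, also of those at other instants: the
  endpoints are then linear in \<open>\<epsilon>\<close>, at the price of a displacement bounded by
  the total length. Half-open intervals let adjacent needles abut and make needles of length zero
  empty.\<close>

definition needle_interval :: "(nat \<Rightarrow> real) \<Rightarrow> (nat \<Rightarrow> real) \<Rightarrow> nat \<Rightarrow> real set" where
  "needle_interval \<tau> \<epsilon> j = {\<tau> j - sum \<epsilon> {..<Suc j} <.. \<tau> j - sum \<epsilon> {..<j}}"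

text \<open>Later needles overwrite earlier ones, which settles overlaps; the order is immaterial
  once the intervals are disjoint.\<close>

primrec needle_control ::
  "(real \<Rightarrow> 'u) \<Rightarrow> (nat \<Rightarrow> real) \<Rightarrow> (nat \<Rightarrow> 'u) \<Rightarrow> (nat \<Rightarrow> real) \<Rightarrow> nat \<Rightarrow> real \<Rightarrow> 'u" where
  "needle_control \<omega> \<tau> v \<epsilon> 0 = \<omega>"
| "needle_control \<omega> \<tau> v \<epsilon> (Suc j) =
     (\<lambda>t. if t \<in> needle_interval \<tau> \<epsilon> j then v j else needle_control \<omega> \<tau> v \<epsilon> j t)"

lemma needle_control_measurable:
  fixes \<omega> :: "real \<Rightarrow> 'u::euclidean_space"
  assumes "\<omega> \<in> borel_measurable (lebesgue_on {0..S})"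
  shows "needle_control \<omega> \<tau> v \<epsilon> k \<in> borel_measurable (lebesgue_on {0..S})"
proof (induction k)
  case (Suc k)
  have "needle_interval \<tau> \<epsilon> k \<inter> {0..S} \<in> sets (lebesgue_on {0..S})"
    by (simp add: sets_restrict_space_iff needle_interval_def)
  moreover have "{t \<in> space (lebesgue_on {0..S}). t \<in> needle_interval \<tau> \<epsilon> k} = needle_interval \<tau> \<epsilon> k \<inter> {0..S}"
    by auto
  ultimately have "{t \<in> space (lebesgue_on {0..S}). t \<in> needle_interval \<tau> \<epsilon> k} \<in> sets (lebesgue_on {0..S})"
    by simp
  from measurable_If[OF measurable_const Suc this] show ?case by simp
qed (use assms in simp)

lemma needle_control_outside:
  "(\<And>j. j < k \<Longrightarrow> t \<notin> needle_interval \<tau> \<epsilon> j) \<Longrightarrow> needle_control \<omega> \<tau> v \<epsilon> k t = \<omega> t"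
  by (induction k) auto

lemma needle_control_eq:
  assumes "\<And>j. j < k \<Longrightarrow> t \<in> needle_interval \<tau> \<epsilon> j \<longleftrightarrow> t \<in> needle_interval \<tau> \<epsilon>' j"
  shows "needle_control \<omega> \<tau> v \<epsilon> k t = needle_control \<omega> \<tau> v \<epsilon>' k t"
  using assms by (induction k) auto

lemma needle_control_in:
  "(\<And>j. j < k \<Longrightarrow> v j \<in> U) \<Longrightarrow> \<omega> t \<in> U \<Longrightarrow> needle_control \<omega> \<tau> v \<epsilon> k t \<in> U"
  by (induction k) auto

text \<open>Needles attached to the same instant are stacked to its left, in the order of their indices.\<close>

lemma needle_interval_disjoint:
  assumes pos: "\<And>j. j < k \<Longrightarrow> 0 \<le> \<epsilon> j" and "i < j" "j < k"
    and far: "\<tau> i \<noteq> \<tau> j \<Longrightarrow> sum \<epsilon> {..<k} \<le> \<bar>\<tau> i - \<tau> j\<bar>"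
  shows "needle_interval \<tau> \<epsilon> i \<inter> needle_interval \<tau> \<epsilon> j = {}"
proof -
  have mono: "sum \<epsilon> {..<a} \<le> sum \<epsilon> {..<b}" if "a \<le> b" "b \<le> k" for a b
    using that pos by (intro sum_mono2) auto
  have "0 \<le> sum \<epsilon> {..<i}" using pos assms by (intro sum_nonneg) auto
  moreover have "sum \<epsilon> {..<Suc i} \<le> sum \<epsilon> {..<j}" "sum \<epsilon> {..<j} \<le> sum \<epsilon> {..<Suc j}"
      "sum \<epsilon> {..<Suc j} \<le> sum \<epsilon> {..<k}" "sum \<epsilon> {..<i} \<le> sum \<epsilon> {..<Suc i}"
    using mono[of "Suc i" j] mono[of j "Suc j"] mono[of "Suc j" k] mono[of i "Suc i"] assms(2,3)
    by (simp_all del: sum.lessThan_Suc)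
  ultimately show ?thesis
    using far unfolding needle_interval_def by (cases "\<tau> i = \<tau> j"; cases "\<tau> i < \<tau> j") auto
qed

text \<open>Disjointness leaves at most one nonzero term at each time, so a change of control acts
  additively in the needles although \<open>F\<close> is an arbitrary function of the
  control.\<close>

lemma field_needle_diff:
  fixes F :: "'u \<Rightarrow> 'z::real_vector"
  assumes "\<And>i j. i < j \<Longrightarrow> j < k \<Longrightarrow> needle_interval \<tau> \<epsilon> i \<inter> needle_interval \<tau> \<epsilon> j = {}"
  shows "F (needle_control \<omega> \<tau> v \<epsilon> k s) - F (\<omega> s) =
    (\<Sum>j<k. indicat_real (needle_interval \<tau> \<epsilon> j) s *\<^sub>R (F (v j) - F (\<omega> s)))"
  using assms
proof (induction k)
  case (Suc k)
  show ?case
  proof (cases "s \<in> needle_interval \<tau> \<epsilon> k")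
    case True
    have "s \<notin> needle_interval \<tau> \<epsilon> j" if "j < k" for j using Suc.prems[OF that] True by auto
    then have "(\<Sum>j<k. indicat_real (needle_interval \<tau> \<epsilon> j) s *\<^sub>R (F (v j) - F (\<omega> s))) = 0"
      by (intro sum.neutral) auto
    then show ?thesis using True by simp
  next
    case False
    then show ?thesis using Suc by simp
  qed
qed simp

text \<open>Bounding only the positive elements allows lists with zeros, such as all the distances
  between the instants of the needles.\<close>

lemma finite_positive_lower_bound:
  fixes F :: "real set"
  assumes "finite F"
  obtains d where "d > 0" "\<And>x. x \<in> F \<Longrightarrow> x > 0 \<Longrightarrow> d \<le> x"
proof -
  have "finite {x\<in>F. x > 0}" using assms by simp
  then have "\<exists>d>0. \<forall>x\<in>{x\<in>F. x > 0}. d \<le> x"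
    by (intro exI[of _ "Min (insert 1 {x\<in>F. x > 0})"]) auto
  then show ?thesis using that by auto
qed

lemma norm_linear_le_sum_Basis:
  fixes x :: "'z::euclidean_space"
  shows "norm (\<Sum>b\<in>Basis. (x \<bullet> a b) *\<^sub>R b) \<le> norm x * (\<Sum>b\<in>(Basis::'z set). norm (a b :: 'z))"
proof -
  have "norm (\<Sum>b\<in>Basis. (x \<bullet> a b) *\<^sub>R b) \<le> (\<Sum>b\<in>(Basis::'z set). norm x * norm (a b))"
    by (rule sum_norm_le) (simp add: Cauchy_Schwarz_ineq2)
  then show ?thesis by (simp add: sum_distrib_left)
qed

text \<open>The sum is the transpose of \<open>a\<close> in coordinates. In this form, when
  \<open>a\<close> depends on time, measurability reduces to that of the images of basis
  vectors.\<close>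

lemma linear_adjoint_inner:
  fixes a :: "'z::euclidean_space \<Rightarrow> 'z"
  assumes "linear a"
  shows "(\<Sum>b\<in>Basis. (x \<bullet> a b) *\<^sub>R b) \<bullet> y = x \<bullet> a y"
proof -
  have "(\<Sum>b\<in>Basis. (x \<bullet> a b) *\<^sub>R b) \<bullet> y = (\<Sum>b\<in>Basis. (x \<bullet> a b) * (b \<bullet> y))"
    by (simp add: inner_sum_left)
  also have "\<dots> = x \<bullet> (\<Sum>b\<in>Basis. (y \<bullet> b) *\<^sub>R a b)"
    by (simp add: inner_sum_right inner_commute mult.commute)
  also have "(\<Sum>b\<in>Basis. (y \<bullet> b) *\<^sub>R a b) = a (\<Sum>b\<in>Basis. (y \<bullet> b) *\<^sub>R b)"
    using assms by (simp add: linear_sum linear_scale)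
  also have "\<dots> = a y" by (simp add: euclidean_representation)
  finally show ?thesis .
qed

section \<open>Sensitivity to the needle lengths and the adjoint equation\<close>

context control_system
begin

lemma admissible_needle:
  assumes "admissible \<omega>" "\<And>j. j < k \<Longrightarrow> v j \<in> U"
  shows "admissible (needle_control \<omega> \<tau> v \<epsilon> k)"
  using assms unfolding admissible_def by (auto intro!: needle_control_measurable needle_control_in)

text \<open>The two controls differ on a set of measure at most \<open>2 * k * \<sigma>\<close>, and
  stability multiplies this by \<open>2 * B * exp (L * S)\<close>. Comparison with zero lengths
  bounds the distance from the reference; comparison of two general length vectors gives the
  continuity that Brouwer's theorem asks for.\<close>

lemma trajectory_needle_Lipschitz:
  assumes \<omega>: "admissible \<omega>" and v: "\<And>j. j < k \<Longrightarrow> v j \<in> U"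
    and z: "trajectory (needle_control \<omega> \<tau> v \<epsilon> k) z" and z': "trajectory (needle_control \<omega> \<tau> v \<epsilon>' k) z'"
    and t: "t \<in> {0..S}"
  shows "norm (z t - z' t) \<le> 4 * B * real k * exp (L * S) * (\<Sum>i<k. \<bar>\<epsilon> i - \<epsilon>' i\<bar>)"
proof -
  define \<sigma> where "\<sigma> = (\<Sum>i<k. \<bar>\<epsilon> i - \<epsilon>' i\<bar>)"
  define a b a' b' where "a j = \<tau> j - sum \<epsilon> {..<Suc j}" and "b j = \<tau> j - sum \<epsilon> {..<j}"
    and "a' j = \<tau> j - sum \<epsilon>' {..<Suc j}" and "b' j = \<tau> j - sum \<epsilon>' {..<j}" for j
  \<comment> \<open>Membership in a needle can change only between its old and new left endpoints or
    between its old and new right ones; each of them moves by at most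
    \<open>\<sigma>\<close>.\<close>
  define E where "E j = {min (a j) (a' j)..max (a j) (a' j)} \<union> {min (b j) (b' j)..max (b j) (b' j)}" for j
  have S: "\<bar>sum \<epsilon> {..<j} - sum \<epsilon>' {..<j}\<bar> \<le> \<sigma>" if "j \<le> k" for j
  proof -
    have "\<bar>sum \<epsilon> {..<j} - sum \<epsilon>' {..<j}\<bar> \<le> (\<Sum>i<j. \<bar>\<epsilon> i - \<epsilon>' i\<bar>)"
      unfolding sum_subtractf[symmetric] by (rule sum_abs)
    also have "\<dots> \<le> \<sigma>" unfolding \<sigma>_def using that by (intro sum_mono2) auto
    finally show ?thesis .
  qed
  have mE: "measure lebesgue (E j) \<le> 2 * \<sigma>" if "j < k" for j
  proof -
    have "measure lebesgue (E j) \<le> measure lebesgue {min (a j) (a' j)..max (a j) (a' j)}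
        + measure lebesgue {min (b j) (b' j)..max (b j) (b' j)}"
      unfolding E_def by (intro measure_Un_le) auto
    also have "\<dots> = \<bar>a j - a' j\<bar> + \<bar>b j - b' j\<bar>" by (auto simp: min_def max_def)
    also have "\<dots> \<le> 2 * \<sigma>"
      using S[of j] S[of "Suc j"] that unfolding a_def a'_def b_def b'_def by (auto simp del: sum.lessThan_Suc)
    finally show ?thesis .
  qed
  have EL: "E j \<in> lmeasurable" for j unfolding E_def by (intro fmeasurable.Un) auto
  have UL: "(\<Union>j<k. E j) \<in> lmeasurable" by (intro fmeasurable.finite_UN) (auto simp: EL)
  have "measure lebesgue (\<Union>j<k. E j) \<le> (\<Sum>j<k. measure lebesgue (E j))"
    by (rule measure_UNION_le) (auto simp: fmeasurableD EL)
  also have "\<dots> \<le> (\<Sum>j<k. 2 * \<sigma>)" by (intro sum_mono mE) auto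
  finally have mU: "measure lebesgue (\<Union>j<k. E j) \<le> real k * (2 * \<sigma>)" by simp
  have eq: "needle_control \<omega> \<tau> v \<epsilon> k s = needle_control \<omega> \<tau> v \<epsilon>' k s" if "s \<in> {0..S} - (\<Union>j<k. E j)" for s
  proof (rule needle_control_eq)
    fix j assume "j < k"
    then have "s \<notin> E j" using that by auto
    then show "s \<in> needle_interval \<tau> \<epsilon> j \<longleftrightarrow> s \<in> needle_interval \<tau> \<epsilon>' j"
      unfolding E_def needle_interval_def a_def[symmetric] b_def[symmetric] a'_def[symmetric] b'_def[symmetric]
      by (auto simp: min_def max_def split: if_splits)
  qed
  have "0 \<le> B" using X_bound[OF admissible_in[OF \<omega>], of 0 undefined] S_pos norm_ge_zero order_trans
    by (metis atLeastAtMost_iff less_eq_real_def)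
  have "norm (z t - z' t) \<le> 2 * B * measure lebesgue (\<Union>j<k. E j) * exp (L * S)"
    by (rule trajectory_stability[OF admissible_needle[OF \<omega> v] z admissible_needle[OF \<omega> v] z' UL eq t])
  also have "\<dots> \<le> 2 * B * (real k * (2 * \<sigma>)) * exp (L * S)"
    using mU \<open>0 \<le> B\<close> by (intro mult_right_mono mult_left_mono) auto
  finally show ?thesis by (simp add: \<sigma>_def mult_ac)
qed

end

text \<open>\<open>A s\<close> stands for the state derivative of the field along the reference. Its
  approximation property is uniform in time although the reference control is merely
  measurable.\<close>

locale reference_trajectory = control_system +
  fixes ob :: "real \<Rightarrow> 'b" and zb :: "real \<Rightarrow> 'a" and A :: "real \<Rightarrow> 'a \<Rightarrow> 'a"
  assumes ob: "admissible ob" and zb: "trajectory ob zb"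
    and A_linear: "\<And>s. s \<in> {0..S} \<Longrightarrow> linear (A s)"
    and A_meas: "\<And>b. (\<lambda>s. A s b) \<in> borel_measurable (lebesgue_on {0..S})"
    and A_bound: "\<And>s x. s \<in> {0..S} \<Longrightarrow> norm (A s x) \<le> L * norm x"
    and A_approx: "\<And>e. e > 0 \<Longrightarrow> \<exists>d>0. \<forall>s\<in>{0..S}. \<forall>x. norm (x - zb s) < d \<longrightarrow>
        norm (X x (ob s) - X (zb s) (ob s) - A s (x - zb s)) \<le> e * norm (x - zb s)"
begin

definition adj :: "real \<Rightarrow> 'a \<Rightarrow> 'a" where
  "adj s x = (\<Sum>b\<in>Basis. (x \<bullet> A s b) *\<^sub>R b)"

text \<open>The adjoint equation with terminal value \<open>\<nu>\<close>. The integral nevertheless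
  runs from 0, so that increments of \<open>q\<close> are handled like those of a
  trajectory.\<close>

definition costate :: "'a \<Rightarrow> (real \<Rightarrow> 'a) \<Rightarrow> bool" where
  "costate \<nu> q \<longleftrightarrow> continuous_on {0..S} q \<and> q S = \<nu> \<and>
     (\<forall>t\<in>{0..S}. q t = q 0 + integral {0..t} (\<lambda>s. - adj s (q s)))"

lemma adj_inner: "s \<in> {0..S} \<Longrightarrow> adj s x \<bullet> y = x \<bullet> A s y"
  unfolding adj_def by (rule linear_adjoint_inner[OF A_linear])

lemma adj_linear: "linear (adj s)"
  by (rule linearI) (simp_all add: adj_def inner_add_left scaleR_add_left sum.distrib scaleR_sum_right)

lemma adj_bound: "s \<in> {0..S} \<Longrightarrow> norm (adj s x) \<le> L * real DIM('a) * norm x"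
proof -
  assume s: "s \<in> {0..S}"
  have "norm (adj s x) \<le> norm x * (\<Sum>b\<in>Basis. norm (A s b))"
    unfolding adj_def by (rule norm_linear_le_sum_Basis)
  also have "\<dots> \<le> norm x * (\<Sum>b\<in>(Basis::'a set). L)"
    using A_bound[OF s] by (intro mult_left_mono sum_mono) (auto simp: order_trans[OF A_bound[OF s]])
  finally show ?thesis by (simp add: mult_ac)
qed

lemma adj_measurable:
  assumes "continuous_on {0..S} q"
  shows "(\<lambda>s. adj s (q s)) \<in> borel_measurable (lebesgue_on {0..S})"
proof -
  have "q \<in> borel_measurable (lebesgue_on {0..S})"
    by (rule continuous_imp_measurable_on_sets_lebesgue[OF assms]) simp
  then show ?thesis unfolding adj_def using A_meas by measurable
qed

lemma costate_exists: obtains q where "costate \<nu> q"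
proof -
  have S: "S \<in> {0..S}" and L: "0 < L * real DIM('a)" using S_pos L_pos by auto
  show thesis
  proof (rule caratheodory_solution_exists[where \<Phi>="\<lambda>s x. - adj s x" and ?z0.0=\<nu> and B=0, OF S L])
    show "(\<lambda>s. - adj s (z s)) \<in> borel_measurable (lebesgue_on {0..S})" if "continuous_on {0..S} z" for z
      using adj_measurable[OF that] by measurable
    show "norm (- adj s x - - adj s y) \<le> L * real DIM('a) * norm (x - y)" if "s \<in> {0..S}" for s x y
    proof -
      have "- adj s x - - adj s y = - adj s (x - y)" by (simp add: linear_diff[OF adj_linear])
      then show ?thesis using adj_bound[OF that, of "x - y"] by (simp only: norm_minus_cancel)
    qed
    show "norm (- adj s 0) \<le> 0" for s by (simp add: linear_0[OF adj_linear])
  next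
    fix z assume z: "continuous_on {0..S} z"
      "\<And>t. t \<in> {0..S} \<Longrightarrow> z t = \<nu> + integral {0..t} (\<lambda>s. - adj s (z s)) - integral {0..S} (\<lambda>s. - adj s (z s))"
    have "costate \<nu> z"
      unfolding costate_def
    proof (intro conjI ballI)
      show "z S = \<nu>" using z(2)[of S] S_pos by simp
      fix t assume "t \<in> {0..S}"
      then show "z t = z 0 + integral {0..t} (\<lambda>s. - adj s (z s))"
        using z(2)[of t] z(2)[of 0] S_pos by simp
    qed (rule z)
    then show thesis by (rule that)
  qed
qed

lemma costate_facts:
  assumes "costate \<nu> q"
  shows "\<exists>Q. 0 \<le> Q \<and> (\<forall>s\<in>{0..S}. norm (q s) \<le> Q) \<and>
    (\<lambda>s. - adj s (q s)) integrable_on {0..S} \<and>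
    (\<forall>s t. 0 \<le> s \<longrightarrow> s \<le> t \<longrightarrow> t \<le> S \<longrightarrow> norm (q t - q s) \<le> L * real DIM('a) * Q * (t - s))"
proof -
  have qc: "continuous_on {0..S} q" and q: "\<And>t. t \<in> {0..S} \<Longrightarrow> q t = q 0 + integral {0..t} (\<lambda>s. - adj s (q s))"
    using assms unfolding costate_def by blast+
  obtain Q where Q: "\<And>s. s \<in> {0..S} \<Longrightarrow> norm (q s) \<le> Q"
    using compact_imp_bounded[OF compact_continuous_image[OF qc compact_Icc]]
    unfolding bounded_iff by blast
  have "0 \<le> Q" by (rule order_trans[OF norm_ge_zero Q[of 0]]) (use S_pos in simp)
  have bd: "norm (- adj s (q s)) \<le> L * real DIM('a) * Q" if "s \<in> {0..S}" for s
  proof -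
    have "norm (- adj s (q s)) \<le> L * real DIM('a) * norm (q s)" using adj_bound[OF that] by simp
    also have "\<dots> \<le> L * real DIM('a) * Q" using Q[OF that] L_pos by (intro mult_left_mono) auto
    finally show ?thesis .
  qed
  have "(\<lambda>s. - adj s (q s)) \<in> borel_measurable (lebesgue_on {0..S})"
    using adj_measurable[OF qc] by measurable
  from bounded_measurable_integrable_on[OF this bd]
  have I: "(\<lambda>s. - adj s (q s)) integrable_on {0..S}" .
  have "norm (q t - q s) \<le> L * real DIM('a) * Q * (t - s)" if st: "0 \<le> s" "s \<le> t" "t \<le> S" for s t
  proof -
    have "q t - q s = integral {0..t} (\<lambda>s. - adj s (q s)) - integral {0..s} (\<lambda>s. - adj s (q s))"
      using q[of t] q[of s] st by simp
    then show ?thesis using indefinite_integral_Lipschitz[OF I bd st] by simp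
  qed
  with \<open>0 \<le> Q\<close> Q I show ?thesis by (intro exI[of _ Q]) simp
qed

text \<open>Integrates the derivative of q . (z - zb), a function that starts from 0. This takes the
  place of variation of constants: paired with a terminal covector, the endpoint change becomes one
  integral along the trajectory.\<close>

lemma costate_duality:
  assumes q: "costate \<nu> q" and \<omega>: "admissible \<omega>" and z: "trajectory \<omega> z"
  shows "((\<lambda>s. q s \<bullet> (X (z s) (\<omega> s) - X (zb s) (ob s) - A s (z s - zb s)))
    has_integral (\<nu> \<bullet> (z S - zb S))) {0..S}"
proof -
  have q_eq: "\<And>t. t \<in> {0..S} \<Longrightarrow> q t = q 0 + integral {0..t} (\<lambda>s. - adj s (q s))" and qS: "q S = \<nu>"
    using q unfolding costate_def by blast+
  obtain Q where facts: "0 \<le> Q" "\<forall>s\<in>{0..S}. norm (q s) \<le> Q"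
    "(\<lambda>s. - adj s (q s)) integrable_on {0..S}"
    "\<forall>s t. 0 \<le> s \<longrightarrow> s \<le> t \<longrightarrow> t \<le> S \<longrightarrow> norm (q t - q s) \<le> L * real DIM('a) * Q * (t - s)"
    using costate_facts[OF q] by (elim exE conjE)
  note Q = facts(1) facts(2)[rule_format] and qI = facts(3) and qlip = facts(4)[rule_format]
  define \<delta> where "\<delta> t = z t - zb t" for t
  define D where "D s = X (z s) (\<omega> s) - X (zb s) (ob s)" for s
  note c = trajectoryD(1)[OF z] trajectoryD(1)[OF zb]
  note XI = field_integrable[OF \<omega> c(1)] field_integrable[OF ob c(2)]
  have DI: "D integrable_on {0..S}" unfolding D_def by (rule integrable_diff[OF XI])
  have \<delta>_eq: "\<delta> t = integral {0..t} D" if t: "t \<in> {0..S}" for t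
  proof -
    have "(\<lambda>s. X (z s) (\<omega> s)) integrable_on {0..t}" "(\<lambda>s. X (zb s) (ob s)) integrable_on {0..t}"
      by (rule integrable_subinterval_real[OF XI(1)] integrable_subinterval_real[OF XI(2)], use t in simp)+
    then show ?thesis
      unfolding \<delta>_def D_def using trajectoryD(2)[OF z t] trajectoryD(2)[OF zb t] by (simp add: integral_diff)
  qed
  have \<delta>lip: "norm (\<delta> t - \<delta> s) \<le> 2 * B * (t - s)" if "0 \<le> s" "s \<le> t" "t \<le> S" for s t
  proof -
    have "\<delta> t - \<delta> s = (z t - z s) - (zb t - zb s)" by (simp add: \<delta>_def)
    then have "norm (\<delta> t - \<delta> s) \<le> norm (z t - z s) + norm (zb t - zb s)" by (metis norm_triangle_ineq4)
    then show ?thesis using trajectory_Lipschitz[OF \<omega> z that] trajectory_Lipschitz[OF ob zb that] by simp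
  qed
  have \<delta>0: "\<delta> 0 = 0" using \<delta>_eq[of 0] S_pos by simp
  have B: "0 \<le> B" using X_bound[OF admissible_in[OF ob], of 0 undefined] S_pos norm_ge_zero order_trans
    by (metis atLeastAtMost_iff less_eq_real_def)
  have \<delta>bd: "norm (\<delta> t) \<le> 2 * B * S" if "t \<in> {0..S}" for t
  proof -
    have "norm (\<delta> t) \<le> 2 * B * t" using \<delta>lip[of 0 t] that \<delta>0 by simp
    also have "\<dots> \<le> 2 * B * S" using that B by (intro mult_left_mono) auto
    finally show ?thesis .
  qed
  \<comment> \<open>A product of bounded Lipschitz functions is Lipschitz, so the fundamental
    theorem applies off the two null sets where a derivative may fail.\<close>
  have AC: "AC_on 0 S (\<lambda>t. q t \<bullet> \<delta> t)"
  proof (rule Lipschitz_imp_AC_on)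
    fix s t :: real assume st: "0 \<le> s" "s \<le> t" "t \<le> S"
    have "q t \<bullet> \<delta> t - q s \<bullet> \<delta> s = q t \<bullet> (\<delta> t - \<delta> s) + (q t - q s) \<bullet> \<delta> s"
      by (simp add: inner_diff_left inner_diff_right)
    also have "norm \<dots> \<le> norm (q t) * norm (\<delta> t - \<delta> s) + norm (q t - q s) * norm (\<delta> s)"
      by (rule order_trans[OF norm_triangle_ineq]) (auto intro!: add_mono simp: Cauchy_Schwarz_ineq2)
    also have "\<dots> \<le> Q * (2 * B * (t - s)) + (L * real DIM('a) * Q * (t - s)) * (2 * B * S)"
      using Q(2)[of t] \<delta>lip[OF st] qlip[OF st] \<delta>bd[of s] st Q(1) B L_pos S_pos
      by (intro add_mono mult_mono) auto
    also have "\<dots> = (Q * (2 * B) + L * real DIM('a) * Q * (2 * B * S)) * (t - s)" by (simp add: algebra_simps)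
    finally show "norm (q t \<bullet> \<delta> t - q s \<bullet> \<delta> s) \<le> (Q * (2 * B) + L * real DIM('a) * Q * (2 * B * S)) * (t - s)" .
  qed
  obtain N1 where N1: "negligible N1" "\<And>x. x \<in> {0..S} - N1 \<Longrightarrow>
      ((\<lambda>t. integral {0..t} (\<lambda>s. - adj s (q s))) has_vector_derivative - adj x (q x)) (at x within {0..S})"
    using indefinite_integral_has_vector_derivative_AE[OF qI] by blast
  obtain N2 where N2: "negligible N2" "\<And>x. x \<in> {0..S} - N2 \<Longrightarrow>
      ((\<lambda>t. integral {0..t} D) has_vector_derivative D x) (at x within {0..S})"
    using indefinite_integral_has_vector_derivative_AE[OF DI] by blast
  have "((\<lambda>s. q s \<bullet> (D s - A s (\<delta> s))) has_integral (q S \<bullet> \<delta> S - q 0 \<bullet> \<delta> 0)) {0..S}"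
  proof (rule fundamental_theorem_of_calculus_AC[OF _ AC, of "N1 \<union> N2"])
    show "0 \<le> S" using S_pos by simp
    show "negligible (N1 \<union> N2)" using N1(1) N2(1) by (rule negligible_Un)
    fix x assume x: "x \<in> {0..S} - (N1 \<union> N2)"
    have q1: "((\<lambda>t. q 0 + integral {0..t} (\<lambda>s. - adj s (q s))) has_vector_derivative - adj x (q x)) (at x within {0..S})"
      using has_vector_derivative_add[OF has_vector_derivative_const N1(2)[of x], of "q 0"] x by simp
    have q': "(q has_vector_derivative - adj x (q x)) (at x within {0..S})"
      by (rule has_vector_derivative_transform[OF _ q_eq q1]) (use x in simp_all)
    have \<delta>': "(\<delta> has_vector_derivative D x) (at x within {0..S})"
      by (rule has_vector_derivative_transform[OF _ \<delta>_eq N2(2)]) (use x in simp_all)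
    have "((\<lambda>t. q t \<bullet> \<delta> t) has_vector_derivative (q x \<bullet> D x + (- adj x (q x)) \<bullet> \<delta> x)) (at x within {0..S})"
      using bounded_bilinear.has_vector_derivative[OF bounded_bilinear_inner q' \<delta>'] .
    \<comment> \<open>The transpose cancels the linear part of the dynamics; the control change and
      the remainder beyond first order are what is left.\<close>
    moreover have "q x \<bullet> D x + (- adj x (q x)) \<bullet> \<delta> x = q x \<bullet> (D x - A x (\<delta> x))"
      using adj_inner[of x "q x" "\<delta> x"] x by (simp add: inner_diff_right)
    ultimately show "((\<lambda>t. q t \<bullet> \<delta> t) has_vector_derivative q x \<bullet> (D x - A x (\<delta> x))) (at x within {0..S})"
      by simp
  qed
  then have "((\<lambda>s. q s \<bullet> (D s - A s (\<delta> s))) has_integral (\<nu> \<bullet> \<delta> S)) {0..S}" by (simp add: \<delta>0 qS)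
  then show ?thesis unfolding D_def \<delta>_def .
qed

end

section \<open>First-order effect of needles on the endpoint\<close>

lemma integral_indicator_interval:
  fixes h :: "real \<Rightarrow> 'a::euclidean_space"
  assumes h: "h integrable_on {c..d}" and ab: "c \<le> a" "a \<le> b" "b \<le> d"
  shows "((\<lambda>s. indicat_real {a<..b} s *\<^sub>R h s) has_integral (integral {c..b} h - integral {c..a} h)) {c..d}"
proof -
  have "h integrable_on {a..b}" by (rule integrable_subinterval_real[OF h]) (use ab in auto)
  then have "(h has_integral (integral {c..b} h - integral {c..a} h)) {a..b}"
    using integral_diff_interval[OF h ab] by (simp add: has_integral_integral)
  then have "((\<lambda>s. if s \<in> {a..b} then h s else 0) has_integral (integral {c..b} h - integral {c..a} h)) {c..d}"
    using ab by (subst has_integral_restrict) auto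
  then show ?thesis
    by (rule has_integral_spike[OF negligible_sing[of a], rotated]) (auto simp: indicator_def)
qed

text \<open>A needle lies near its instant \<open>\<tau>\<close> but need not touch it. Comparing
  both ends with \<open>\<tau>\<close> gives an error measured by \<open>\<sigma>\<close>, the
  distance to \<open>\<tau>\<close>, rather than by the length of the interval.\<close>

lemma has_vector_derivative_increment:
  fixes H :: "real \<Rightarrow> real"
  assumes H: "(H has_vector_derivative h) (at \<tau> within {0..S})" and "e > 0"
  obtains d where "d > 0" "\<And>\<sigma> a b. \<lbrakk>a \<in> {0..S}; b \<in> {0..S}; \<bar>a - \<tau>\<bar> \<le> \<sigma>; \<bar>b - \<tau>\<bar> \<le> \<sigma>; \<sigma> < d\<rbrakk>
      \<Longrightarrow> \<bar>H b - H a - (b - a) * h\<bar> \<le> 2 * e * \<sigma>"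
proof -
  obtain d where d: "d > 0" "\<And>y. y \<in> {0..S} \<Longrightarrow> norm (y - \<tau>) < d \<Longrightarrow> norm (H y - H \<tau> - (y - \<tau>) *\<^sub>R h) \<le> e * norm (y - \<tau>)"
    using H \<open>e > 0\<close> unfolding has_vector_derivative_def has_derivative_within_alt by blast
  have "\<bar>H b - H a - (b - a) * h\<bar> \<le> 2 * e * \<sigma>"
    if ab: "a \<in> {0..S}" "b \<in> {0..S}" "\<bar>a - \<tau>\<bar> \<le> \<sigma>" "\<bar>b - \<tau>\<bar> \<le> \<sigma>" "\<sigma> < d" for \<sigma> a b
  proof -
    have "\<bar>H y - H \<tau> - (y - \<tau>) * h\<bar> \<le> e * \<sigma>" if "y \<in> {0..S}" "\<bar>y - \<tau>\<bar> \<le> \<sigma>" for y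
    proof -
      have "\<bar>H y - H \<tau> - (y - \<tau>) * h\<bar> \<le> e * \<bar>y - \<tau>\<bar>" using d(2)[of y] that ab by simp
      also have "\<dots> \<le> e * \<sigma>" using that \<open>e > 0\<close> by simp
      finally show ?thesis .
    qed
    from this[OF ab(1,3)] this[OF ab(2,4)] show ?thesis by (simp add: algebra_simps abs_le_iff)
  qed
  with d(1) show ?thesis by (rule that)
qed

context reference_trajectory
begin

text \<open>A differentiation condition on the reference term alone: with a constant control value
  in place of the reference the integrand is continuous and can be differentiated everywhere.
  Interior instants leave room for needles on their left.\<close>

definition regular_instant :: "(real \<Rightarrow> 'a) \<Rightarrow> real \<Rightarrow> bool" where
  "regular_instant q t \<longleftrightarrow> t \<in> {0<..<S} \<and>
     ((\<lambda>r. integral {0..r} (\<lambda>s. q s \<bullet> X (zb s) (ob s)))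
        has_vector_derivative (q t \<bullet> X (zb t) (ob t))) (at t within {0..S})"

lemma inner_field_integrable:
  assumes q: "continuous_on {0..S} q" and \<omega>: "admissible \<omega>" and z: "continuous_on {0..S} z"
  shows "(\<lambda>s. q s \<bullet> X (z s) (\<omega> s)) integrable_on {0..S}"
proof -
  obtain Q where Q: "\<And>s. s \<in> {0..S} \<Longrightarrow> norm (q s) \<le> Q"
    using compact_imp_bounded[OF compact_continuous_image[OF q compact_Icc]]
    unfolding bounded_iff by blast
  have qm: "q \<in> borel_measurable (lebesgue_on {0..S})"
    by (rule continuous_imp_measurable_on_sets_lebesgue[OF q]) simp
  show ?thesis
  proof (rule bounded_measurable_integrable_on)
    show "(\<lambda>s. q s \<bullet> X (z s) (\<omega> s)) \<in> borel_measurable (lebesgue_on {0..S})"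
      using qm field_measurable[OF \<omega> z] by (rule borel_measurable_inner)
    fix s assume s: "s \<in> {0..S}"
    have "norm (q s \<bullet> X (z s) (\<omega> s)) \<le> norm (q s) * norm (X (z s) (\<omega> s))"
      by (simp add: Cauchy_Schwarz_ineq2)
    also have "\<dots> \<le> Q * B"
      using Q[OF s] X_bound[OF admissible_in[OF \<omega> s]] order_trans[OF norm_ge_zero Q[OF s]]
      by (intro mult_mono) auto
    finally show "norm (q s \<bullet> X (z s) (\<omega> s)) \<le> Q * B" .
  qed
qed

lemma regular_instant_AE:
  assumes q: "continuous_on {0..S} q"
  obtains N where "negligible N" "\<And>t. t \<in> {0<..<S} - N \<Longrightarrow> regular_instant q t"
proof -
  obtain N where "negligible N" "\<And>x. x \<in> {0..S} - N \<Longrightarrow>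
      ((\<lambda>r. integral {0..r} (\<lambda>s. q s \<bullet> X (zb s) (ob s))) has_vector_derivative q x \<bullet> X (zb x) (ob x)) (at x within {0..S})"
    using indefinite_integral_has_vector_derivative_AE[OF inner_field_integrable[OF q ob trajectoryD(1)[OF zb]]]
    by blast
  then show ?thesis using that[of N] unfolding regular_instant_def by simp
qed

lemma needle_first_order:
  assumes q: "continuous_on {0..S} q" and v: "v \<in> U" and reg: "regular_instant q \<tau>"
  shows "((\<lambda>r. integral {0..r} (\<lambda>s. q s \<bullet> (X (zb s) v - X (zb s) (ob s))))
       has_vector_derivative (q \<tau> \<bullet> (X (zb \<tau>) v - X (zb \<tau>) (ob \<tau>)))) (at \<tau> within {0..S})"
proof -
  note zc = trajectoryD(1)[OF zb]
  have \<tau>: "\<tau> \<in> {0..S}" and d: "((\<lambda>r. integral {0..r} (\<lambda>s. q s \<bullet> X (zb s) (ob s)))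
        has_vector_derivative (q \<tau> \<bullet> X (zb \<tau>) (ob \<tau>))) (at \<tau> within {0..S})"
    using reg unfolding regular_instant_def by auto
  have "continuous_on {0..S} (\<lambda>s. (\<lambda>(z,u). X z u) (zb s, v))"
    by (rule continuous_on_compose2[OF X_cont]) (use v in \<open>auto intro!: continuous_intros zc\<close>)
  then have Xv: "continuous_on {0..S} (\<lambda>s. q s \<bullet> X (zb s) v)"
    by (intro continuous_intros q) simp
  have "((\<lambda>r. integral {0..r} (\<lambda>s. q s \<bullet> X (zb s) v) - integral {0..r} (\<lambda>s. q s \<bullet> X (zb s) (ob s)))
      has_vector_derivative (q \<tau> \<bullet> X (zb \<tau>) v - q \<tau> \<bullet> X (zb \<tau>) (ob \<tau>))) (at \<tau> within {0..S})"
    by (rule has_vector_derivative_diff[OF integral_has_vector_derivative[OF Xv \<tau>] d])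
  then have "((\<lambda>r. integral {0..r} (\<lambda>s. q s \<bullet> (X (zb s) v - X (zb s) (ob s))))
      has_vector_derivative (q \<tau> \<bullet> X (zb \<tau>) v - q \<tau> \<bullet> X (zb \<tau>) (ob \<tau>))) (at \<tau> within {0..S})"
  proof (rule has_vector_derivative_transform[OF \<tau>, rotated])
    fix r assume r: "r \<in> {0..S}"
    have "(\<lambda>s. q s \<bullet> X (zb s) v) integrable_on {0..r}"
      by (rule integrable_subinterval_real[OF integrable_continuous_real[OF Xv]]) (use r in simp)
    moreover have "(\<lambda>s. q s \<bullet> X (zb s) (ob s)) integrable_on {0..r}"
      by (rule integrable_subinterval_real[OF inner_field_integrable[OF q ob zc]]) (use r in simp)
    ultimately show "integral {0..r} (\<lambda>s. q s \<bullet> (X (zb s) v - X (zb s) (ob s))) =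
        integral {0..r} (\<lambda>s. q s \<bullet> X (zb s) v) - integral {0..r} (\<lambda>s. q s \<bullet> X (zb s) (ob s))"
      by (simp add: inner_diff_right integral_diff)
  qed
  then show ?thesis by (simp add: inner_diff_right)
qed

text \<open>Duality expresses the endpoint change as one integral. Freezing the state on the
  reference alters the integrand by a small multiple of the total length \<sigma> off the needles
  and by O(\<sigma>) on them, both negligible after integration; integrals over short intervals next
  to regular instants remain.\<close>

theorem needle_expansion:
  assumes q: "costate \<nu> q" and v: "\<And>j. j < k \<Longrightarrow> v j \<in> U"
    and reg: "\<And>j. j < k \<Longrightarrow> regular_instant q (\<tau> j)" and "e > 0"
  obtains d where "d > 0"
    "\<And>\<epsilon> z. \<lbrakk>\<And>j. j < k \<Longrightarrow> 0 \<le> \<epsilon> j; sum \<epsilon> {..<k} < d; trajectory (needle_control ob \<tau> v \<epsilon> k) z\<rbrakk> \<Longrightarrow>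
       \<bar>\<nu> \<bullet> (z S - zb S) - (\<Sum>j<k. \<epsilon> j * (q (\<tau> j) \<bullet> (X (zb (\<tau> j)) (v j) - X (zb (\<tau> j)) (ob (\<tau> j)))))\<bar>
         \<le> e * sum \<epsilon> {..<k}"
proof -
  have qc: "continuous_on {0..S} q" using q unfolding costate_def by blast
  note zc = trajectoryD(1)[OF zb]
  obtain Q where Q: "0 \<le> Q" "\<forall>s\<in>{0..S}. norm (q s) \<le> Q"
    using costate_facts[OF q] by (elim exE conjE)
  have B: "0 \<le> B" by (rule order_trans[OF norm_ge_zero X_bound[OF admissible_in[OF ob, of 0]]]) (use S_pos in simp)
  \<comment> \<open>The constant of \<open>trajectory_needle_Lipschitz\<close>: perturbed
    trajectories stay within \<open>C * \<sigma>\<close> of the reference.\<close>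
  define C where "C = 4 * B * real k * exp (L * S)"
  have C: "0 \<le> C" using B by (simp add: C_def)
  \<comment> \<open>Three errors may each use \<open>e / 3\<close> per unit of
    \<open>\<sigma>\<close>: linearisation off the needles (\<open>e1\<close>), differentiation at
    the instants (\<open>e2\<close>), and the time spent on the needles (the last entry of
    \<open>d\<close>). The added 1 guards against vanishing constants.\<close>
  define e1 where "e1 = e / (3 * (Q * C * S + 1))"
  define e2 where "e2 = e / (6 * (real k + 1))"
  have QCS: "0 \<le> Q * C * S" using Q C S_pos by simp
  have e1: "e1 > 0" using \<open>e > 0\<close> QCS unfolding e1_def by (intro divide_pos_pos mult_pos_pos) auto
  have e2: "e2 > 0" using \<open>e > 0\<close> by (simp add: e2_def)
  define h where "h j s = q s \<bullet> (X (zb s) (v j) - X (zb s) (ob s))" for j s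
  obtain d1 where d1: "d1 > 0" "\<forall>s\<in>{0..S}. \<forall>x. norm (x - zb s) < d1 \<longrightarrow>
      norm (X x (ob s) - X (zb s) (ob s) - A s (x - zb s)) \<le> e1 * norm (x - zb s)"
    using A_approx[OF e1] by blast
  have "\<forall>j. \<exists>d>0. j < k \<longrightarrow> (\<forall>\<sigma> a b. a \<in> {0..S} \<longrightarrow> b \<in> {0..S} \<longrightarrow> \<bar>a - \<tau> j\<bar> \<le> \<sigma> \<longrightarrow> \<bar>b - \<tau> j\<bar> \<le> \<sigma> \<longrightarrow> \<sigma> < d
      \<longrightarrow> \<bar>integral {0..b} (h j) - integral {0..a} (h j) - (b - a) * h j (\<tau> j)\<bar> \<le> 2 * e2 * \<sigma>)"
  proof
    fix j
    show "\<exists>d>0. j < k \<longrightarrow> (\<forall>\<sigma> a b. a \<in> {0..S} \<longrightarrow> b \<in> {0..S} \<longrightarrow> \<bar>a - \<tau> j\<bar> \<le> \<sigma> \<longrightarrow> \<bar>b - \<tau> j\<bar> \<le> \<sigma> \<longrightarrow> \<sigma> < d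
      \<longrightarrow> \<bar>integral {0..b} (h j) - integral {0..a} (h j) - (b - a) * h j (\<tau> j)\<bar> \<le> 2 * e2 * \<sigma>)"
    proof (cases "j < k")
      case True
      have "((\<lambda>r. integral {0..r} (h j)) has_vector_derivative h j (\<tau> j)) (at (\<tau> j) within {0..S})"
        unfolding h_def by (rule needle_first_order[OF qc v[OF True] reg[OF True]])
      from has_vector_derivative_increment[OF this e2] obtain d where
        "d > 0" "\<And>\<sigma> a b. \<lbrakk>a \<in> {0..S}; b \<in> {0..S}; \<bar>a - \<tau> j\<bar> \<le> \<sigma>; \<bar>b - \<tau> j\<bar> \<le> \<sigma>; \<sigma> < d\<rbrakk>
          \<Longrightarrow> \<bar>integral {0..b} (h j) - integral {0..a} (h j) - (b - a) * h j (\<tau> j)\<bar> \<le> 2 * e2 * \<sigma>"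
        by blast
      then show ?thesis by (intro exI[of _ d]) simp
    qed (auto intro: exI[of _ 1])
  qed
  then obtain dd where dd: "\<And>j. dd j > 0" and dd': "\<And>j \<sigma> a b. \<lbrakk>j < k; a \<in> {0..S}; b \<in> {0..S}; \<bar>a - \<tau> j\<bar> \<le> \<sigma>; \<bar>b - \<tau> j\<bar> \<le> \<sigma>; \<sigma> < dd j\<rbrakk>
          \<Longrightarrow> \<bar>integral {0..b} (h j) - integral {0..a} (h j) - (b - a) * h j (\<tau> j)\<bar> \<le> 2 * e2 * \<sigma>"
    by metis
  \<comment> \<open>A total length below every positive distance between instants keeps needles at
    distinct instants apart; below every instant, it keeps them in \<open>{0..S}\<close>; below
    every \<open>dd j\<close>, it keeps them where differentiation is accurate.\<close>
  obtain d2 where d2: "d2 > 0" "\<And>x. x \<in> dd ` {..<k} \<union> \<tau> ` {..<k} \<union> (\<lambda>(i,j). \<bar>\<tau> i - \<tau> j\<bar>) ` ({..<k} \<times> {..<k}) \<Longrightarrow> x > 0 \<Longrightarrow> d2 \<le> x"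
    by (rule finite_positive_lower_bound[of "dd ` {..<k} \<union> \<tau> ` {..<k} \<union> (\<lambda>(i,j). \<bar>\<tau> i - \<tau> j\<bar>) ` ({..<k} \<times> {..<k})"]) auto
  define d where "d = Min {d2, d1 / (C + 1), e / (3 * (2 * Q * L * C + 1))}"
  have QLC: "0 \<le> 2 * Q * L * C" using Q C L_pos by simp
  have "d > 0" unfolding d_def using d2 d1 C \<open>e > 0\<close> QLC by (auto intro!: divide_pos_pos mult_pos_pos add_nonneg_pos)
  have dle: "d \<le> d2" "d \<le> d1 / (C + 1)" "d \<le> e / (3 * (2 * Q * L * C + 1))"
    unfolding d_def by auto
  show thesis
  proof (rule that[OF \<open>d > 0\<close>])
    fix \<epsilon> z assume pos: "\<And>j. j < k \<Longrightarrow> 0 \<le> \<epsilon> j" and small: "sum \<epsilon> {..<k} < d"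
      and z: "trajectory (needle_control ob \<tau> v \<epsilon> k) z"
    define \<sigma> where "\<sigma> = sum \<epsilon> {..<k}"
    define \<omega> where "\<omega> = needle_control ob \<tau> v \<epsilon> k"
    define I where "I j = needle_interval \<tau> \<epsilon> j" for j
    have \<sigma>0: "0 \<le> \<sigma>" unfolding \<sigma>_def using pos by (intro sum_nonneg) auto
    have \<omega>: "admissible \<omega>" unfolding \<omega>_def by (rule admissible_needle[OF ob v])
    have z\<omega>: "trajectory \<omega> z" using z by (simp add: \<omega>_def)
    have part: "0 \<le> sum \<epsilon> {..<j}" "sum \<epsilon> {..<j} \<le> \<sigma>" if "j \<le> k" for j
      unfolding \<sigma>_def using that pos by (auto intro!: sum_nonneg sum_mono2)
    define a b where "a j = \<tau> j - sum \<epsilon> {..<Suc j}" and "b j = \<tau> j - sum \<epsilon> {..<j}" for j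
    have I_ab: "I j = {a j <.. b j}" for j by (simp add: I_def needle_interval_def a_def b_def)
    have ab: "0 \<le> a j" "a j \<le> b j" "b j \<le> S" "b j - a j = \<epsilon> j" "\<bar>a j - \<tau> j\<bar> \<le> \<sigma>" "\<bar>b j - \<tau> j\<bar> \<le> \<sigma>" if j: "j < k" for j
    proof -
      have "0 < \<tau> j" "\<tau> j < S" using reg[OF j] by (simp_all add: regular_instant_def)
      moreover have "d2 \<le> \<tau> j" using calculation j by (intro d2(2)) auto
      moreover have "sum \<epsilon> {..<Suc j} \<le> \<sigma>" "0 \<le> sum \<epsilon> {..<Suc j}" using part[of "Suc j"] j by (simp_all del: sum.lessThan_Suc)
      moreover have "0 \<le> sum \<epsilon> {..<j}" "sum \<epsilon> {..<j} \<le> \<sigma>" using part[of j] j by auto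
      moreover have "sum \<epsilon> {..<Suc j} = sum \<epsilon> {..<j} + \<epsilon> j" by simp
      ultimately show "0 \<le> a j" "a j \<le> b j" "b j \<le> S" "b j - a j = \<epsilon> j" "\<bar>a j - \<tau> j\<bar> \<le> \<sigma>" "\<bar>b j - \<tau> j\<bar> \<le> \<sigma>"
        using small dle(1) pos[OF j] unfolding a_def b_def \<sigma>_def by linarith+
    qed
    have disj: "I i \<inter> I j = {}" if "i < j" "j < k" for i j
      unfolding I_def
    proof (rule needle_interval_disjoint[OF pos that])
      assume "\<tau> i \<noteq> \<tau> j"
      then have "d2 \<le> \<bar>\<tau> i - \<tau> j\<bar>" using that by (intro d2(2)) force+
      then show "sum \<epsilon> {..<k} \<le> \<bar>\<tau> i - \<tau> j\<bar>" using small dle(1) by linarith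
    qed
    define \<delta> where "\<delta> s = z s - zb s" for s
    have \<delta>: "norm (\<delta> s) \<le> C * \<sigma>" if s: "s \<in> {0..S}" for s
    proof -
      \<comment> \<open>Needles of length zero are empty, so the reference is itself a needle
        trajectory and the Lipschitz estimate applies to the pair.\<close>
      have "needle_control ob \<tau> v (\<lambda>_. 0) k = ob"
        by (rule ext, rule needle_control_outside) (simp add: needle_interval_def)
      then have "trajectory (needle_control ob \<tau> v (\<lambda>_. 0) k) zb" using zb by simp
      from trajectory_needle_Lipschitz[OF ob v z this s]
      have "norm (\<delta> s) \<le> C * (\<Sum>i<k. \<bar>\<epsilon> i - 0\<bar>)" by (simp add: C_def \<delta>_def)
      also have "(\<Sum>i<k. \<bar>\<epsilon> i - 0\<bar>) = \<sigma>" unfolding \<sigma>_def using pos by (intro sum.cong) auto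
      finally show ?thesis .
    qed
    have C\<sigma>: "C * \<sigma> < d1"
    proof (cases "C = 0")
      case False
      have "C * \<sigma> \<le> (C + 1) * \<sigma>" using \<sigma>0 by (intro mult_right_mono) auto
      also have "\<dots> < (C + 1) * d" using small C unfolding \<sigma>_def by (intro mult_strict_left_mono) auto
      also have "\<dots> \<le> (C + 1) * (d1 / (C + 1))" using dle(2) C by (intro mult_left_mono) auto
      also have "\<dots> = d1" using C by simp
      finally show ?thesis .
    qed (use d1 in simp)
    \<comment> \<open>\<open>R\<close> is the exact integrand from duality, \<open>P\<close> the
      needle effect with the state frozen on the reference; their integrals are to be
      compared.\<close>
    define R where "R s = q s \<bullet> (X (z s) (\<omega> s) - X (zb s) (ob s) - A s (\<delta> s))" for s
    define P where "P s = (\<Sum>j<k. indicat_real (I j) s *\<^sub>R h j s)" for s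
    have RI: "(R has_integral (\<nu> \<bullet> (z S - zb S))) {0..S}"
      unfolding R_def \<delta>_def by (rule costate_duality[OF q \<omega> z\<omega>])
    have hI: "h j integrable_on {0..S}" if "j < k" for j
    proof -
      have "admissible (\<lambda>_. v j)" using v[OF that] by (simp add: admissible_def)
      from integrable_diff[OF inner_field_integrable[OF qc this zc] inner_field_integrable[OF qc ob zc]]
      show ?thesis unfolding h_def by (simp add: inner_diff_right)
    qed
    have PI: "(P has_integral (\<Sum>j<k. integral {0..b j} (h j) - integral {0..a j} (h j))) {0..S}"
      unfolding P_def I_ab
      using ab by (intro has_integral_sum integral_indicator_interval hI) auto
    have Pint: "\<bar>(\<Sum>j<k. integral {0..b j} (h j) - integral {0..a j} (h j)) - (\<Sum>j<k. \<epsilon> j * h j (\<tau> j))\<bar> \<le> real k * (2 * e2 * \<sigma>)"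
    proof -
      have "\<bar>(\<Sum>j<k. integral {0..b j} (h j) - integral {0..a j} (h j)) - (\<Sum>j<k. \<epsilon> j * h j (\<tau> j))\<bar>
          = \<bar>\<Sum>j<k. integral {0..b j} (h j) - integral {0..a j} (h j) - \<epsilon> j * h j (\<tau> j)\<bar>"
        by (simp add: sum_subtractf)
      also have "\<dots> \<le> (\<Sum>j<k. \<bar>integral {0..b j} (h j) - integral {0..a j} (h j) - \<epsilon> j * h j (\<tau> j)\<bar>)"
        by (rule sum_abs)
      also have "\<dots> \<le> (\<Sum>j<k. 2 * e2 * \<sigma>)"
      proof (rule sum_mono)
        fix j assume "j \<in> {..<k}"
        then have j: "j < k" by simp
        have "d2 \<le> dd j" using j dd by (intro d2(2)) auto
        then have "\<sigma> < dd j" using small dle(1) by (simp add: \<sigma>_def)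
        have "\<bar>integral {0..b j} (h j) - integral {0..a j} (h j) - (b j - a j) * h j (\<tau> j)\<bar> \<le> 2 * e2 * \<sigma>"
          using ab[OF j] \<open>\<sigma> < dd j\<close> by (intro dd'[OF j]) auto
        then show "\<bar>integral {0..b j} (h j) - integral {0..a j} (h j) - \<epsilon> j * h j (\<tau> j)\<bar> \<le> 2 * e2 * \<sigma>"
          by (simp add: ab(4)[OF j])
      qed
      finally show ?thesis by simp
    qed
    \<comment> \<open>Pointwise bounds for \<open>R - P\<close>: \<open>c1\<close> off the needles,
      where linearisation makes it a small multiple of \<open>\<sigma>\<close>, and
      \<open>c2\<close> on them, where it is a possibly large multiple of \<open>\<sigma>\<close>
      but acts only for a total time \<open>\<sigma>\<close>.\<close>
    define c1 where "c1 = Q * (e1 * (C * \<sigma>))"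
    define c2 where "c2 = Q * (2 * L * (C * \<sigma>))"
    have c: "0 \<le> c1" "0 \<le> c2" unfolding c1_def c2_def using Q(1) e1 C \<sigma>0 L_pos by auto
    have mI: "((\<lambda>s. c1 + c2 * (\<Sum>j<k. indicat_real (I j) s *\<^sub>R 1)) has_integral
        c1 * S + c2 * (\<Sum>j<k. integral {0..b j} (\<lambda>_. 1) - integral {0..a j} (\<lambda>_. 1))) {0..S}"
    proof (intro has_integral_add has_integral_mult_right has_integral_sum)
      show "((\<lambda>s. c1) has_integral c1 * S) {0..S}"
        using has_integral_const_real[of c1 0 S] S_pos by (simp add: mult.commute)
      show "((\<lambda>s. indicat_real (I j) s *\<^sub>R 1) has_integral integral {0..b j} (\<lambda>_. 1) - integral {0..a j} (\<lambda>_. 1::real)) {0..S}"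
        if "j \<in> {..<k}" for j
        unfolding I_ab using ab[of j] that by (intro integral_indicator_interval) auto
    qed simp
    have rbound: "norm (R s - P s) \<le> c1 + c2 * (\<Sum>j<k. indicat_real (I j) s *\<^sub>R 1)" if s: "s \<in> {0..S}" for s
    proof -
      have "X (zb s) (\<omega> s) - X (zb s) (ob s) = (\<Sum>j<k. indicat_real (I j) s *\<^sub>R (X (zb s) (v j) - X (zb s) (ob s)))"
        unfolding \<omega>_def I_def by (rule field_needle_diff) (use disj in \<open>simp add: I_def\<close>)
      then have "P s = q s \<bullet> (X (zb s) (\<omega> s) - X (zb s) (ob s))"
        by (simp add: P_def h_def inner_sum_right)
      then have RP: "R s - P s = q s \<bullet> (X (z s) (\<omega> s) - X (zb s) (\<omega> s) - A s (\<delta> s))"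
        unfolding R_def by (simp add: inner_diff_right)
      have nn: "0 \<le> c2 * (\<Sum>j<k. indicat_real (I j) s *\<^sub>R 1)"
        using c by (intro mult_nonneg_nonneg sum_nonneg) auto
      have Qs: "norm (q s) \<le> Q" using Q(2) s by blast
      show ?thesis
      proof (cases "\<exists>j<k. s \<in> I j")
        case True
        then obtain j where j: "j < k" "s \<in> I j" by blast
        have "1 = indicat_real (I j) s *\<^sub>R (1::real)" using j by simp
        also have "\<dots> \<le> (\<Sum>j<k. indicat_real (I j) s *\<^sub>R 1)"
          using j by (intro member_le_sum) auto
        finally have 1: "c2 \<le> c2 * (\<Sum>j<k. indicat_real (I j) s *\<^sub>R 1)" using c(2) mult_left_mono by fastforce
        have "norm (X (z s) (\<omega> s) - X (zb s) (\<omega> s) - A s (\<delta> s)) \<le> L * norm (\<delta> s) + L * norm (\<delta> s)"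
          using X_lip[OF admissible_in[OF \<omega> s], of "z s" "zb s"] A_bound[OF s, of "\<delta> s"]
            norm_triangle_ineq4[of "X (z s) (\<omega> s) - X (zb s) (\<omega> s)" "A s (\<delta> s)"]
          unfolding \<delta>_def by linarith
        also have "\<dots> = 2 * L * norm (\<delta> s)" by simp
        also have "\<dots> \<le> 2 * L * (C * \<sigma>)" using \<delta>[OF s] L_pos by (intro mult_left_mono) auto
        finally have "norm (q s) * norm (X (z s) (\<omega> s) - X (zb s) (\<omega> s) - A s (\<delta> s)) \<le> c2"
          unfolding c2_def using Qs Q(1) by (intro mult_mono) auto
        then have "norm (R s - P s) \<le> c2"
          unfolding RP real_norm_def by (rule order_trans[OF Cauchy_Schwarz_ineq2])
        then show ?thesis using 1 c(1) by linarith
      next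
        case False
        then have "\<omega> s = ob s" unfolding \<omega>_def I_def by (intro needle_control_outside) auto
        moreover have "norm (z s - zb s) < d1" using \<delta>[OF s] C\<sigma> by (simp add: \<delta>_def)
        ultimately have "norm (X (z s) (\<omega> s) - X (zb s) (\<omega> s) - A s (\<delta> s)) \<le> e1 * norm (\<delta> s)"
          using d1(2) s by (simp add: \<delta>_def)
        also have "\<dots> \<le> e1 * (C * \<sigma>)" using \<delta>[OF s] e1 by (intro mult_left_mono) auto
        finally have "norm (q s) * norm (X (z s) (\<omega> s) - X (zb s) (\<omega> s) - A s (\<delta> s)) \<le> c1"
          unfolding c1_def using Qs Q(1) by (intro mult_mono) auto
        then have "norm (R s - P s) \<le> c1"
          unfolding RP real_norm_def by (rule order_trans[OF Cauchy_Schwarz_ineq2])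
        then show ?thesis using nn by linarith
      qed
    qed
    note RPI = has_integral_diff[OF RI PI]
    have "norm (integral {0..S} (\<lambda>s. R s - P s)) \<le> integral {0..S} (\<lambda>s. c1 + c2 * (\<Sum>j<k. indicat_real (I j) s *\<^sub>R 1))"
      by (rule integral_norm_bound_integral[OF has_integral_integrable[OF RPI] has_integral_integrable[OF mI] rbound])
    also have "\<dots> = c1 * S + c2 * (\<Sum>j<k. integral {0..b j} (\<lambda>_. 1) - integral {0..a j} (\<lambda>_. 1))"
      by (rule integral_unique[OF mI])
    also have "(\<Sum>j<k. integral {0..b j} (\<lambda>_. 1) - integral {0..a j} (\<lambda>_. 1::real)) = \<sigma>"
      unfolding \<sigma>_def using ab by (intro sum.cong refl) (simp, smt (verit))
    finally have rint: "\<bar>\<nu> \<bullet> (z S - zb S) - (\<Sum>j<k. integral {0..b j} (h j) - integral {0..a j} (h j))\<bar> \<le> c1 * S + c2 * \<sigma>"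
      by (simp add: integral_unique[OF RPI])
    have t1: "c1 * S \<le> e / 3 * \<sigma>"
    proof -
      have "c1 * S = (Q * C * S) * e1 * \<sigma>" by (simp add: c1_def mult_ac)
      also have "\<dots> \<le> (Q * C * S + 1) * e1 * \<sigma>" using e1 \<sigma>0 by (intro mult_right_mono) auto
      also have "(Q * C * S + 1) * e1 = e / 3" using QCS by (simp add: e1_def field_simps)
      finally show ?thesis .
    qed
    have t2: "c2 * \<sigma> \<le> e / 3 * \<sigma>"
    proof -
      have "c2 = 2 * Q * L * C * \<sigma>" by (simp add: c2_def mult_ac)
      also have "\<dots> \<le> (2 * Q * L * C + 1) * \<sigma>" using \<sigma>0 by (intro mult_right_mono) auto
      also have "\<dots> \<le> (2 * Q * L * C + 1) * (e / (3 * (2 * Q * L * C + 1)))"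
        using small dle(3) QLC by (intro mult_left_mono) (auto simp: \<sigma>_def)
      also have "\<dots> = e / 3" using QLC by (simp add: field_simps)
      finally show ?thesis using \<sigma>0 by (intro mult_right_mono) auto
    qed
    have t3: "real k * (2 * e2 * \<sigma>) \<le> e / 3 * \<sigma>"
    proof -
      have "real k * (2 * e2) \<le> (real k + 1) * (2 * e2)" using e2 by (intro mult_right_mono) auto
      also have "\<dots> = e / 3" by (simp add: e2_def field_simps)
      finally have "real k * (2 * e2) * \<sigma> \<le> e / 3 * \<sigma>" using \<sigma>0 by (intro mult_right_mono) auto
      then show ?thesis by (simp add: mult.assoc)
    qed
    have "\<bar>\<nu> \<bullet> (z S - zb S) - (\<Sum>j<k. \<epsilon> j * h j (\<tau> j))\<bar> \<le> e / 3 * \<sigma> + e / 3 * \<sigma> + e / 3 * \<sigma>"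
      using rint Pint t1 t2 t3 by linarith
    then show "\<bar>\<nu> \<bullet> (z S - zb S) - (\<Sum>j<k. \<epsilon> j * (q (\<tau> j) \<bullet> (X (zb (\<tau> j)) (v j) - X (zb (\<tau> j)) (ob (\<tau> j)))))\<bar>
         \<le> e * sum \<epsilon> {..<k}"
      by (simp add: h_def \<sigma>_def)
  qed
qed

end

section \<open>Conic right inverses and Brouwer\<close>

text \<open>A functional separating the cone from the missed point cannot be negative on any ray of
  the cone, since rays can be scaled at will; the hyperplane may therefore be taken through the
  origin. The cone is spanned by the \<open>E n\<close> and by the image of \<open>Q\<close> under
  \<open>- M\<close>, whence the opposite signs.\<close>

lemma convex_cone_alternative:
  fixes E :: "'n \<Rightarrow> 'w::euclidean_space" and M :: "'p::real_vector \<Rightarrow> 'w"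
  assumes Q: "convex Q" "pcone Q" "0 \<in> Q" and M: "linear M"
    and y: "\<And>F c p. finite F \<Longrightarrow> F \<subseteq> N \<Longrightarrow> (\<And>n. 0 \<le> c n) \<Longrightarrow> p \<in> Q \<Longrightarrow> y \<noteq> (\<Sum>n\<in>F. c n *\<^sub>R E n) - M p"
  obtains \<nu> where "\<nu> \<noteq> 0" "\<And>n. n \<in> N \<Longrightarrow> \<nu> \<bullet> E n \<le> 0" "\<And>p. p \<in> Q \<Longrightarrow> 0 \<le> \<nu> \<bullet> M p"
proof -
  define K where "K = {(\<Sum>n\<in>F. c n *\<^sub>R E n) - M p | F c p. finite F \<and> F \<subseteq> N \<and> (\<forall>n. 0 \<le> c n) \<and> p \<in> Q}"
  have "y \<notin> K"
  proof
    assume "y \<in> K"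
    then obtain F c p where "y = (\<Sum>n\<in>F. c n *\<^sub>R E n) - M p" "finite F" "F \<subseteq> N" "\<forall>n. 0 \<le> c n" "p \<in> Q"
      unfolding K_def by blast
    then show False using y[of F c p] by simp
  qed
  have Kadd: "s *\<^sub>R k + t *\<^sub>R k' \<in> K" if k: "k \<in> K" "k' \<in> K" and st: "0 < s" "0 < t" for k k' s t
  proof -
    obtain F c p where 1: "k = (\<Sum>n\<in>F. c n *\<^sub>R E n) - M p" "finite F" "F \<subseteq> N" "\<forall>n. 0 \<le> c n" "p \<in> Q"
      using k(1) unfolding K_def by blast
    obtain F' c' p' where 2: "k' = (\<Sum>n\<in>F'. c' n *\<^sub>R E n) - M p'" "finite F'" "F' \<subseteq> N" "\<forall>n. 0 \<le> c' n" "p' \<in> Q"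
      using k(2) unfolding K_def by blast
    \<comment> \<open>Combinations over two finite sets are merged over their union, with
      coefficients extended by zero.\<close>
    define d where "d n = s * (if n \<in> F then c n else 0) + t * (if n \<in> F' then c' n else 0)" for n
    have "(\<Sum>n\<in>F \<union> F'. d n *\<^sub>R E n) = s *\<^sub>R (\<Sum>n\<in>F \<union> F'. (if n \<in> F then c n else 0) *\<^sub>R E n)
        + t *\<^sub>R (\<Sum>n\<in>F \<union> F'. (if n \<in> F' then c' n else 0) *\<^sub>R E n)"
      by (simp add: d_def scaleR_add_left sum.distrib scaleR_sum_right)
    also have "(\<Sum>n\<in>F \<union> F'. (if n \<in> F then c n else 0) *\<^sub>R E n) = (\<Sum>n\<in>F. c n *\<^sub>R E n)"
      using 1 2 by (intro sum.mono_neutral_cong_right) auto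
    also have "(\<Sum>n\<in>F \<union> F'. (if n \<in> F' then c' n else 0) *\<^sub>R E n) = (\<Sum>n\<in>F'. c' n *\<^sub>R E n)"
      using 1 2 by (intro sum.mono_neutral_cong_right) auto
    finally have "s *\<^sub>R k + t *\<^sub>R k' = (\<Sum>n\<in>F \<union> F'. d n *\<^sub>R E n) - M (s *\<^sub>R p + t *\<^sub>R p')"
      by (simp add: 1(1) 2(1) linear_add[OF M] linear_scale[OF M] algebra_simps)
    moreover have "s *\<^sub>R p + t *\<^sub>R p' \<in> Q"
    proof -
      have "(s / (s + t)) *\<^sub>R p + (t / (s + t)) *\<^sub>R p' \<in> Q"
        using st by (intro convexD[OF Q(1) 1(5) 2(5)]) (auto simp: add_divide_distrib[symmetric])
      then have "(s + t) *\<^sub>R ((s / (s + t)) *\<^sub>R p + (t / (s + t)) *\<^sub>R p') \<in> Q"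
        using Q(2) st unfolding pcone_def by (meson add_pos_pos)
      moreover have "(s + t) *\<^sub>R ((s / (s + t)) *\<^sub>R p + (t / (s + t)) *\<^sub>R p') = s *\<^sub>R p + t *\<^sub>R p'"
        using st by (simp add: scaleR_add_right)
      ultimately show ?thesis by simp
    qed
    moreover have "\<forall>n. 0 \<le> d n" using 1 2 st by (simp add: d_def)
    ultimately show ?thesis unfolding K_def using 1 2
      by (intro CollectI exI[of _ "F \<union> F'"] exI[of _ d] exI[of _ "s *\<^sub>R p + t *\<^sub>R p'"]) auto
  qed
  have K0: "0 \<in> K"
    unfolding K_def using Q(3) linear_0[OF M]
    by (intro CollectI exI[of _ "{}"] exI[of _ "\<lambda>_. 0"] exI[of _ "0::'p"]) auto
  have Kcone: "t *\<^sub>R k \<in> K" if "k \<in> K" "0 < t" for k t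
    using Kadd[OF that(1) K0 that(2), of 1] by simp
  have "convex K"
    unfolding convex_def
  proof (intro ballI allI impI)
    fix k k' s t assume *: "k \<in> K" "k' \<in> K" "0 \<le> s" "0 \<le> t" "s + t = (1::real)"
    show "s *\<^sub>R k + t *\<^sub>R k' \<in> K"
      using Kadd[OF *(1,2), of s t] * by (cases "s = 0"; cases "t = 0") auto
  qed
  then have "convex ((\<lambda>k. - y + k) ` K)" by (rule convex_translation)
  moreover have "0 \<notin> (\<lambda>k. - y + k) ` K" using \<open>y \<notin> K\<close> by (auto simp: neg_eq_iff_add_eq_0[symmetric])
  ultimately obtain a where a: "a \<noteq> 0" "\<forall>x\<in>(\<lambda>k. - y + k) ` K. 0 \<le> a \<bullet> x"
    using separating_hyperplane_set_0 by blast
  have ak: "0 \<le> a \<bullet> k" if "k \<in> K" for k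
  proof (rule ccontr)
    assume "\<not> 0 \<le> a \<bullet> k"
    then have neg: "a \<bullet> k < 0" by simp
    \<comment> \<open>Large enough for \<open>a \<bullet> (t *\<^sub>R k)\<close> to fall below
      \<open>a \<bullet> y\<close>.\<close>
    define t where "t = (\<bar>a \<bullet> y\<bar> + 1) / - (a \<bullet> k)"
    have "t > 0" unfolding t_def using neg by (intro divide_pos_pos) auto
    then have "t *\<^sub>R k \<in> K" using Kcone[OF that] by blast
    then have "0 \<le> a \<bullet> (- y + t *\<^sub>R k)" using a(2) by blast
    moreover have "a \<bullet> (t *\<^sub>R k) = - (\<bar>a \<bullet> y\<bar> + 1)" using neg by (simp add: t_def)
    ultimately show False by (simp add: inner_add_right inner_diff_right)
  qed
  show ?thesis
  proof (rule that[of "- a"])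
    show "- a \<noteq> 0" using a by simp
    show "- a \<bullet> E n \<le> 0" if "n \<in> N" for n
    proof -
      have "E n \<in> K" unfolding K_def using that Q(3) linear_0[OF M]
        by (intro CollectI exI[of _ "{n}"] exI[of _ "\<lambda>_. 1"] exI[of _ "0::'p"]) auto
      from ak[OF this] show ?thesis by simp
    qed
    show "0 \<le> - a \<bullet> M p" if "p \<in> Q" for p
    proof -
      have "- M p \<in> K" unfolding K_def using that
        by (intro CollectI exI[of _ "{}"] exI[of _ "\<lambda>_. 0"] exI[of _ p]) auto
      from ak[OF this] show ?thesis by simp
    qed
  qed
qed

lemma pcone_convex_conic_sum:
  assumes Q: "convex Q" "pcone Q" "0 \<in> Q" and "finite I"
    and "\<And>i. i \<in> I \<Longrightarrow> 0 \<le> c i \<and> p i \<in> Q"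
  shows "(\<Sum>i\<in>I. c i *\<^sub>R p i) \<in> Q"
  using assms(4,5)
proof (induction I)
  case (insert i I)
  \<comment> \<open>\<open>pcone\<close> covers positive factors, \<open>0 \<in> Q\<close> the
    factor zero. Addition is then averaging, by convexity, followed by doubling.\<close>
  have sc: "t *\<^sub>R x \<in> Q" if "0 \<le> t" "x \<in> Q" for t x
    using that Q(2,3) unfolding pcone_def by (cases "t = 0") auto
  have "(1/2) *\<^sub>R (c i *\<^sub>R p i) + (1/2) *\<^sub>R (\<Sum>i\<in>I. c i *\<^sub>R p i) \<in> Q"
    using insert sc by (intro convexD[OF Q(1)]) auto
  then have "2 *\<^sub>R ((1/2) *\<^sub>R (c i *\<^sub>R p i) + (1/2) *\<^sub>R (\<Sum>i\<in>I. c i *\<^sub>R p i)) \<in> Q"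
    by (intro sc) auto
  then show ?case using insert by (simp add: scaleR_add_right)
qed (use Q in simp)

text \<open>A solution is a fixed point of \<open>\<lambda>y. w - (G y - y)\<close>, which maps the
  ball into itself because the perturbation and the target each use half of the radius. Continuity
  is enough, so an endpoint map that is differentiable only at 0 can be treated.\<close>

lemma locally_onto_identity_perturbation:
  fixes G :: "'w::euclidean_space \<Rightarrow> 'w"
  assumes "r > 0" and G: "continuous_on (cball 0 r) G"
    and close: "\<And>y. y \<in> cball 0 r \<Longrightarrow> norm (G y - y) \<le> r / 2" and w: "norm w \<le> r / 2"
  obtains y where "y \<in> cball 0 r" "G y = w"
proof -
  have self: "(\<lambda>y. w - (G y - y)) \<in> cball 0 r \<rightarrow> cball 0 r"
  proof
    fix y assume "y \<in> cball (0::'w) r"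
    then have "norm (w - (G y - y)) \<le> r / 2 + r / 2"
      using norm_triangle_ineq4[of w "G y - y"] close[of y] w by linarith
    then show "w - (G y - y) \<in> cball 0 r" by simp
  qed
  have "continuous_on (cball 0 r) (\<lambda>y. w - (G y - y))" by (intro continuous_intros G)
  from brouwer_ball[OF \<open>r > 0\<close> this self] obtain y where y: "y \<in> cball 0 r" "w - (G y - y) = y" .
  have "w = y + (G y - y)" using y(2) by (simp only: diff_eq_eq)
  then have "G y = w" by simp
  with y(1) show ?thesis by (rule that)
qed

text \<open>A chain rule for expansions at one point of a set \<open>D\<close>: the inner map is
  asked for a linear bound instead of a derivative. It serves \<theta> along the endpoints and
  \<open>F\<close> along the cone points; \<open>C + 1\<close> avoids a division by zero.\<close>

lemma first_order_along:
  fixes h :: "'x::real_normed_vector \<Rightarrow> 'w::real_normed_vector" and g :: "'y::real_normed_vector \<Rightarrow> 'x"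
  assumes h: "\<And>e. e > 0 \<Longrightarrow> \<exists>d>0. \<forall>x\<in>D. norm (x - x0) < d \<longrightarrow> norm (h x - h x0 - h' (x - x0)) \<le> e * norm (x - x0)"
    and g: "\<And>y. norm y < d0 \<Longrightarrow> g y \<in> D \<and> norm (g y - x0) \<le> C * norm y" and "d0 > 0" "C \<ge> 0" "e > 0"
  shows "\<exists>d>0. \<forall>y. norm y < d \<longrightarrow> norm (h (g y) - h x0 - h' (g y - x0)) \<le> e * norm y"
proof -
  have "e / (C + 1) > 0" using assms by (intro divide_pos_pos) auto
  from h[OF this] obtain d where d: "d > 0" "\<And>x. x \<in> D \<Longrightarrow> norm (x - x0) < d \<Longrightarrow>
      norm (h x - h x0 - h' (x - x0)) \<le> e / (C + 1) * norm (x - x0)" by blast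
  show ?thesis
  proof (intro exI[of _ "min d0 (d / (C + 1))"] conjI allI impI)
    show "0 < min d0 (d / (C + 1))" using \<open>d0 > 0\<close> d(1) \<open>C \<ge> 0\<close> by simp
    fix y :: 'y assume y: "norm y < min d0 (d / (C + 1))"
    then have gy: "g y \<in> D" "norm (g y - x0) \<le> C * norm y" using g by auto
    have "(C + 1) * norm y < d" using y \<open>C \<ge> 0\<close> by (simp add: field_simps)
    moreover have "C * norm y \<le> (C + 1) * norm y" by (simp add: algebra_simps)
    ultimately have "C * norm y < d" by linarith
    then have "norm (h (g y) - h x0 - h' (g y - x0)) \<le> e / (C + 1) * norm (g y - x0)"
      using gy by (intro d) auto
    also have "\<dots> \<le> e / (C + 1) * ((C + 1) * norm y)"
      using gy \<open>e > 0\<close> \<open>C \<ge> 0\<close> by (intro mult_left_mono) (auto simp: algebra_simps intro: order_trans)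
    also have "\<dots> = e * norm y" using \<open>C \<ge> 0\<close> by simp
    finally show "norm (h (g y) - h x0 - h' (g y - x0)) \<le> e * norm y" .
  qed
qed

lemma posneg_sum_Basis:
  fixes y :: "'w::euclidean_space"
  shows "(\<Sum>b\<in>Basis. max (y \<bullet> b) 0 *\<^sub>R b + max (- (y \<bullet> b)) 0 *\<^sub>R (- b)) = y"
proof -
  have "max (y \<bullet> b) 0 *\<^sub>R b + max (- (y \<bullet> b)) 0 *\<^sub>R (- b) = (y \<bullet> b) *\<^sub>R b" for b by (simp add: max_def)
  then show ?thesis by (simp add: euclidean_representation)
qed

text \<open>Conic representations of the signed basis vectors, combined positively homogeneously, give the
  continuous right inverse.\<close>

lemma conic_right_inverse:
  fixes E :: "'n \<Rightarrow> 'w::euclidean_space" and M :: "'p::real_normed_vector \<Rightarrow> 'w"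
  assumes Q: "convex Q" "pcone Q" "0 \<in> Q" and M: "linear M"
    and all: "\<And>y. \<exists>F c p. finite F \<and> F \<subseteq> N \<and> (\<forall>n. 0 \<le> c n) \<and> p \<in> Q \<and> y = (\<Sum>n\<in>F. c n *\<^sub>R E n) - M p"
  obtains k and n :: "nat \<Rightarrow> 'n" and C \<epsilon> p where "\<forall>j<k. n j \<in> N" "0 \<le> C"
    "\<forall>y j. 0 \<le> \<epsilon> y j" "\<forall>y. p y \<in> Q" "\<forall>j. continuous_on UNIV (\<lambda>y. \<epsilon> y j)" "continuous_on UNIV p"
    "\<forall>y. (\<Sum>j<k. \<epsilon> y j *\<^sub>R E (n j)) - M (p y) = y"
    "\<forall>y. (\<Sum>j<k. \<epsilon> y j) \<le> C * norm y" "\<forall>y. norm (p y) \<le> C * norm y"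
proof -
  obtain F c p where "\<forall>y. finite (F y) \<and> F y \<subseteq> N \<and> (\<forall>n. 0 \<le> c y n) \<and> p y \<in> Q \<and>
      y = (\<Sum>n\<in>F y. c y n *\<^sub>R E n) - M (p y)"
    using all by metis
  then have F: "finite (F y)" "F y \<subseteq> N" "0 \<le> c y n" "p y \<in> Q" "(\<Sum>n\<in>F y. c y n *\<^sub>R E n) - M (p y) = y" for y n
    by (blast, blast, blast, blast, metis)
  \<comment> \<open>The representations just chosen depend on \<open>y\<close> in no controlled way;
    only those of the finitely many signed basis vectors are kept.\<close>
  define Bs where "Bs = (Basis::'w set) \<union> uminus ` Basis"
  define FF where "FF = (\<Union>b\<in>Bs. F b)"
  have "finite Bs" by (simp add: Bs_def)
  then have "finite FF" using F(1) by (simp add: FF_def)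
  have FFN: "FF \<subseteq> N" using F(2) by (auto simp: FF_def)
  \<comment> \<open>The numbering turns the finitely many elements involved into a list, the format
    in which needles are indexed.\<close>
  obtain k n where n: "bij_betw n {..<k::nat} FF"
    using ex_bij_betw_nat_finite[OF \<open>finite FF\<close>] by (metis atLeast0LessThan)
  define d where "d b m = (if m \<in> F b then c b m else 0)" for b m
  have d0: "0 \<le> d b m" for b m using F(3) by (simp add: d_def)
  have rep: "(\<Sum>j<k. d b (n j) *\<^sub>R E (n j)) - M (p b) = b" if "b \<in> Bs" for b
  proof -
    have "(\<Sum>j<k. d b (n j) *\<^sub>R E (n j)) = (\<Sum>m\<in>FF. d b m *\<^sub>R E m)"
      by (rule sum.reindex_bij_betw[OF n])
    also have "\<dots> = (\<Sum>m\<in>F b. c b m *\<^sub>R E m)"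
      using that \<open>finite FF\<close> by (intro sum.mono_neutral_cong_right) (auto simp: d_def FF_def)
    finally show ?thesis using F(5)[of b] by simp
  qed
  \<comment> \<open>Positive and negative parts of the coordinates of \<open>y\<close> serve as
    weights: they are continuous, nonnegative and bounded by the norm of \<open>y\<close>, and these
    properties pass to the coefficients up to a constant.\<close>
  define \<epsilon> where "\<epsilon> y j = (\<Sum>b\<in>Basis. max (y \<bullet> b) 0 * d b (n j) + max (- (y \<bullet> b)) 0 * d (- b) (n j))" for y j
  define P where "P y = (\<Sum>b\<in>Basis. max (y \<bullet> b) 0 *\<^sub>R p b) + (\<Sum>b\<in>Basis. max (- (y \<bullet> b)) 0 *\<^sub>R p (- b))" for y
  define C1 where "C1 = (\<Sum>j<k. \<Sum>b\<in>Basis. d b (n j) + d (- b) (n j))"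
  define C2 where "C2 = (\<Sum>b\<in>Basis. norm (p b)) + (\<Sum>b\<in>Basis. norm (p (- b)))"
  have C: "0 \<le> C1" "0 \<le> C2" unfolding C1_def C2_def by (auto intro!: sum_nonneg add_nonneg_nonneg d0)
  have Q2: "x + x' \<in> Q" if "x \<in> Q" "x' \<in> Q" for x x'
    using pcone_convex_conic_sum[OF Q, of "{True,False}" "\<lambda>_. 1" "\<lambda>i. if i then x else x'"] that by simp
  have mx: "max (y \<bullet> b) 0 \<le> norm y" "max (- (y \<bullet> b)) 0 \<le> norm y" if "b \<in> Basis" for y b :: 'w
    using Basis_le_norm[OF that, of y] by auto
  have 1: "(\<Sum>j<k. \<epsilon> y j *\<^sub>R E (n j)) - M (P y) = y" for y
  proof -
    have "(\<Sum>j<k. \<epsilon> y j *\<^sub>R E (n j)) = (\<Sum>j<k. \<Sum>b\<in>Basis. max (y \<bullet> b) 0 *\<^sub>R (d b (n j) *\<^sub>R E (n j))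
          + max (- (y \<bullet> b)) 0 *\<^sub>R (d (- b) (n j) *\<^sub>R E (n j)))"
      unfolding \<epsilon>_def scaleR_sum_left by (simp add: scaleR_add_left)
    also have "\<dots> = (\<Sum>b\<in>Basis. \<Sum>j<k. max (y \<bullet> b) 0 *\<^sub>R (d b (n j) *\<^sub>R E (n j))
          + max (- (y \<bullet> b)) 0 *\<^sub>R (d (- b) (n j) *\<^sub>R E (n j)))"
      by (rule sum.swap)
    also have "\<dots> = (\<Sum>b\<in>Basis. max (y \<bullet> b) 0 *\<^sub>R (\<Sum>j<k. d b (n j) *\<^sub>R E (n j))
          + max (- (y \<bullet> b)) 0 *\<^sub>R (\<Sum>j<k. d (- b) (n j) *\<^sub>R E (n j)))"
      by (simp only: sum.distrib scaleR_sum_right)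
    also have "\<dots> = (\<Sum>b\<in>Basis. max (y \<bullet> b) 0 *\<^sub>R (b + M (p b)) + max (- (y \<bullet> b)) 0 *\<^sub>R (- b + M (p (- b))))"
    proof (rule sum.cong[OF refl])
      fix b :: 'w assume "b \<in> Basis"
      then have "b \<in> Bs" "- b \<in> Bs" by (auto simp: Bs_def)
      from rep[OF this(1)] rep[OF this(2)]
      have "(\<Sum>j<k. d b (n j) *\<^sub>R E (n j)) = b + M (p b)" "(\<Sum>j<k. d (- b) (n j) *\<^sub>R E (n j)) = - b + M (p (- b))"
        by (simp_all add: algebra_simps)
      then show "max (y \<bullet> b) 0 *\<^sub>R (\<Sum>j<k. d b (n j) *\<^sub>R E (n j)) + max (- (y \<bullet> b)) 0 *\<^sub>R (\<Sum>j<k. d (- b) (n j) *\<^sub>R E (n j))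
        = max (y \<bullet> b) 0 *\<^sub>R (b + M (p b)) + max (- (y \<bullet> b)) 0 *\<^sub>R (- b + M (p (- b)))" by simp
    qed
    also have "\<dots> = (\<Sum>b\<in>Basis. max (y \<bullet> b) 0 *\<^sub>R b + max (- (y \<bullet> b)) 0 *\<^sub>R (- b)) + M (P y)"
      unfolding P_def linear_add[OF M] linear_sum[OF M] linear_scale[OF M] sum.distrib[symmetric]
      by (intro sum.cong refl) (simp add: algebra_simps)
    finally show ?thesis by (simp only: posneg_sum_Basis add_diff_cancel_right')
  qed
  have 2: "0 \<le> \<epsilon> y j" for y j unfolding \<epsilon>_def by (intro sum_nonneg add_nonneg_nonneg mult_nonneg_nonneg d0) auto
  have 3: "P y \<in> Q" for y
    unfolding P_def using F(4) by (intro Q2 pcone_convex_conic_sum[OF Q]) auto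
  have 4: "continuous_on UNIV (\<lambda>y. \<epsilon> y j)" for j unfolding \<epsilon>_def by (intro continuous_intros)
  have 5: "continuous_on UNIV P" unfolding P_def by (intro continuous_intros)
  have 6: "(\<Sum>j<k. \<epsilon> y j) \<le> (C1 + C2) * norm y" for y
  proof -
    have "(\<Sum>j<k. \<epsilon> y j) \<le> (\<Sum>j<k. \<Sum>b\<in>Basis. norm y * d b (n j) + norm y * d (- b) (n j))"
      unfolding \<epsilon>_def by (intro sum_mono add_mono mult_right_mono mx d0)
    also have "\<dots> = C1 * norm y" 
      by (simp only: C1_def mult.commute[of _ "norm y"] sum_distrib_left distrib_left)
    also have "\<dots> \<le> (C1 + C2) * norm y" using C by (intro mult_right_mono) auto
    finally show ?thesis .
  qed
  have 7: "norm (P y) \<le> (C1 + C2) * norm y" for y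
  proof -
    have "norm (P y) \<le> (\<Sum>b\<in>Basis. norm y * norm (p b)) + (\<Sum>b\<in>Basis. norm y * norm (p (- b)))"
      unfolding P_def by (intro norm_triangle_le add_mono sum_norm_le) (auto intro!: mult_right_mono mx)
    also have "\<dots> = C2 * norm y" 
      by (simp only: C2_def mult.commute[of _ "norm y"] sum_distrib_left distrib_left)
    also have "\<dots> \<le> (C1 + C2) * norm y" using C by (intro mult_right_mono) auto
    finally show ?thesis .
  qed
  have 8: "n j \<in> N" if "j < k" for j using n FFN that by (auto simp: bij_betw_def)
  show ?thesis
    by (rule that[of k n "C1 + C2" \<epsilon> P]; intro allI impI 8 add_nonneg_nonneg[OF C] 2 3 4 5 1 6 7)
qed

section \<open>Separation of the endpoint variations\<close>

context reference_trajectory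
begin

text \<open>Costates of the basis vectors, and with them a common null set of irregular instants,
  can be fixed before any separating covector is known; by linearity they then produce the costate
  of that covector.\<close>

lemma costate_combination:
  assumes q: "\<And>b. b \<in> Basis \<Longrightarrow> costate b (qq b)"
  shows "costate (\<Sum>b\<in>Basis. c b *\<^sub>R b) (\<lambda>t. \<Sum>b\<in>Basis. c b *\<^sub>R qq b t)"
proof -
  have q1: "continuous_on {0..S} (qq b)" "qq b S = b"
      "\<And>t. t \<in> {0..S} \<Longrightarrow> qq b t = qq b 0 + integral {0..t} (\<lambda>s. - adj s (qq b s))"
    if "b \<in> Basis" for b using q[OF that] unfolding costate_def by blast+
  show ?thesis
    unfolding costate_def
  proof (intro conjI ballI)
    show "continuous_on {0..S} (\<lambda>t. \<Sum>b\<in>Basis. c b *\<^sub>R qq b t)"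
      by (intro continuous_intros q1)
    show "(\<Sum>b\<in>Basis. c b *\<^sub>R qq b S) = (\<Sum>b\<in>Basis. c b *\<^sub>R b)" by (simp add: q1)
    fix t assume t: "t \<in> {0..S}"
    have I: "(\<lambda>s. - adj s (qq b s)) integrable_on {0..t}" if "b \<in> Basis" for b
    proof -
      have "(\<lambda>s. - adj s (qq b s)) integrable_on {0..S}" using costate_facts[OF q[OF that]] by blast
      then show ?thesis by (rule integrable_subinterval_real) (use t in simp)
    qed
    have "integral {0..t} (\<lambda>s. - adj s (\<Sum>b\<in>Basis. c b *\<^sub>R qq b s)) =
        integral {0..t} (\<lambda>s. \<Sum>b\<in>Basis. c b *\<^sub>R (- adj s (qq b s)))"
      by (simp add: linear_sum[OF adj_linear] linear_scale[OF adj_linear] sum_negf)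
    also have "\<dots> = (\<Sum>b\<in>Basis. c b *\<^sub>R integral {0..t} (\<lambda>s. - adj s (qq b s)))"
      unfolding integral_cmul[symmetric] by (rule integral_sum[OF finite_Basis integrable_cmul[OF I]])
    finally have *: "integral {0..t} (\<lambda>s. - adj s (\<Sum>b\<in>Basis. c b *\<^sub>R qq b s)) =
        (\<Sum>b\<in>Basis. c b *\<^sub>R integral {0..t} (\<lambda>s. - adj s (qq b s)))" .
    have "(\<Sum>b\<in>Basis. c b *\<^sub>R qq b t) = (\<Sum>b\<in>Basis. c b *\<^sub>R (qq b 0 + integral {0..t} (\<lambda>s. - adj s (qq b s))))"
      using q1(3)[OF _ t] by (intro sum.cong refl arg_cong[where f="\<lambda>x. _ *\<^sub>R x"])
    then show "(\<Sum>b\<in>Basis. c b *\<^sub>R qq b t) = (\<Sum>b\<in>Basis. c b *\<^sub>R qq b 0) +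
        integral {0..t} (\<lambda>s. - adj s (\<Sum>b\<in>Basis. c b *\<^sub>R qq b s))"
      unfolding * by (simp only: scaleR_add_right sum.distrib)
  qed
qed

text \<open>When \<open>qq b\<close> is the costate with terminal value \<open>b\<close>, this is
  the jump of the field at the needle instant, transported to the final time by the linearised
  dynamics.\<close>

definition needle_velocity :: "('a \<Rightarrow> real \<Rightarrow> 'a) \<Rightarrow> real \<times> 'b \<Rightarrow> 'a" where
  "needle_velocity qq n = (\<Sum>b\<in>Basis. (qq b (fst n) \<bullet> (X (zb (fst n)) (snd n) - X (zb (fst n)) (ob (fst n)))) *\<^sub>R b)"

lemma needle_velocity_inner:
  "b \<in> Basis \<Longrightarrow> needle_velocity qq n \<bullet> b =
     qq b (fst n) \<bullet> (X (zb (fst n)) (snd n) - X (zb (fst n)) (ob (fst n)))"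
  unfolding needle_velocity_def by (rule inner_sum_left_Basis)

lemma needle_expansion_vector:
  assumes q: "\<And>b. b \<in> Basis \<Longrightarrow> costate b (qq b)" and v: "\<And>j. j < k \<Longrightarrow> v j \<in> U"
    and reg: "\<And>b j. b \<in> Basis \<Longrightarrow> j < k \<Longrightarrow> regular_instant (qq b) (\<tau> j)" and "e > 0"
  shows "\<exists>d>0. \<forall>\<epsilon> z. (\<forall>j<k. 0 \<le> \<epsilon> j) \<longrightarrow> sum \<epsilon> {..<k} < d \<longrightarrow> trajectory (needle_control ob \<tau> v \<epsilon> k) z \<longrightarrow>
       norm (z S - zb S - (\<Sum>j<k. \<epsilon> j *\<^sub>R needle_velocity qq (\<tau> j, v j))) \<le> e * sum \<epsilon> {..<k}"
proof -
  \<comment> \<open>Components are controlled one by one and recombined through the sum of their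
    absolute values, hence the division by the dimension.\<close>
  define e' where "e' = e / real DIM('a)"
  have "e' > 0" using \<open>e > 0\<close> by (simp add: e'_def)
  have "\<forall>b\<in>Basis. \<exists>d>0. \<forall>\<epsilon> z. (\<forall>j<k. 0 \<le> \<epsilon> j) \<longrightarrow> sum \<epsilon> {..<k} < d \<longrightarrow> trajectory (needle_control ob \<tau> v \<epsilon> k) z \<longrightarrow>
      \<bar>b \<bullet> (z S - zb S) - (\<Sum>j<k. \<epsilon> j * (qq b (\<tau> j) \<bullet> (X (zb (\<tau> j)) (v j) - X (zb (\<tau> j)) (ob (\<tau> j)))))\<bar>
         \<le> e' * sum \<epsilon> {..<k}"
  proof
    fix b :: 'a assume b: "b \<in> Basis"
    obtain d where "d > 0" "\<And>\<epsilon> z. \<lbrakk>\<And>j. j < k \<Longrightarrow> 0 \<le> \<epsilon> j; sum \<epsilon> {..<k} < d; trajectory (needle_control ob \<tau> v \<epsilon> k) z\<rbrakk> \<Longrightarrow>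
       \<bar>b \<bullet> (z S - zb S) - (\<Sum>j<k. \<epsilon> j * (qq b (\<tau> j) \<bullet> (X (zb (\<tau> j)) (v j) - X (zb (\<tau> j)) (ob (\<tau> j)))))\<bar>
         \<le> e' * sum \<epsilon> {..<k}"
      by (rule needle_expansion[OF q[OF b] v reg[OF b] \<open>e' > 0\<close>]) blast+
    then show "\<exists>d>0. \<forall>\<epsilon> z. (\<forall>j<k. 0 \<le> \<epsilon> j) \<longrightarrow> sum \<epsilon> {..<k} < d \<longrightarrow> trajectory (needle_control ob \<tau> v \<epsilon> k) z \<longrightarrow>
      \<bar>b \<bullet> (z S - zb S) - (\<Sum>j<k. \<epsilon> j * (qq b (\<tau> j) \<bullet> (X (zb (\<tau> j)) (v j) - X (zb (\<tau> j)) (ob (\<tau> j)))))\<bar>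
         \<le> e' * sum \<epsilon> {..<k}"
      by (intro exI[of _ d]) simp
  qed
  then obtain dd where dd: "\<And>b. b \<in> Basis \<Longrightarrow> dd b > 0"
    and dd': "\<And>b \<epsilon> z. b \<in> Basis \<Longrightarrow> (\<forall>j<k. 0 \<le> \<epsilon> j) \<Longrightarrow> sum \<epsilon> {..<k} < dd b \<Longrightarrow> trajectory (needle_control ob \<tau> v \<epsilon> k) z \<Longrightarrow>
      \<bar>b \<bullet> (z S - zb S) - (\<Sum>j<k. \<epsilon> j * (qq b (\<tau> j) \<bullet> (X (zb (\<tau> j)) (v j) - X (zb (\<tau> j)) (ob (\<tau> j)))))\<bar>
         \<le> e' * sum \<epsilon> {..<k}"
    unfolding bchoice_iff by blast
  obtain d where d: "d > 0" "\<And>x. x \<in> dd ` (Basis::'a set) \<Longrightarrow> x > 0 \<Longrightarrow> d \<le> x"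
    using finite_positive_lower_bound[of "dd ` (Basis::'a set)"] by auto
  show ?thesis
  proof (intro exI[of _ d] conjI allI impI)
    fix \<epsilon> z assume pos: "\<forall>j<k. 0 \<le> \<epsilon> j" and small: "sum \<epsilon> {..<k} < d" and z: "trajectory (needle_control ob \<tau> v \<epsilon> k) z"
    define w where "w = z S - zb S - (\<Sum>j<k. \<epsilon> j *\<^sub>R needle_velocity qq (\<tau> j, v j))"
    have "norm w \<le> (\<Sum>b\<in>Basis. \<bar>w \<bullet> b\<bar>)" by (rule norm_le_l1)
    also have "\<dots> \<le> (\<Sum>b\<in>(Basis::'a set). e' * sum \<epsilon> {..<k})"
    proof (rule sum_mono)
      fix b :: 'a assume b: "b \<in> Basis"
      have "w \<bullet> b = b \<bullet> (z S - zb S) - (\<Sum>j<k. \<epsilon> j * (qq b (\<tau> j) \<bullet> (X (zb (\<tau> j)) (v j) - X (zb (\<tau> j)) (ob (\<tau> j)))))"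
        unfolding w_def
        by (simp add: inner_diff_left inner_sum_left needle_velocity_inner[OF b] inner_commute[of b])
      also have "\<bar>\<dots>\<bar> \<le> e' * sum \<epsilon> {..<k}"
        using dd[OF b] d(2)[of "dd b"] b small by (intro dd'[OF b pos _ z]) auto
      finally show "\<bar>w \<bullet> b\<bar> \<le> e' * sum \<epsilon> {..<k}" .
    qed
    also have "\<dots> = e * sum \<epsilon> {..<k}" by (simp add: e'_def)
    finally show "norm (z S - zb S - (\<Sum>j<k. \<epsilon> j *\<^sub>R needle_velocity qq (\<tau> j, v j))) \<le> e * sum \<epsilon> {..<k}"
      by (simp add: w_def)
  qed (rule d)
qed

text \<open>The maximum principle in separation form: \<open>\<theta>\<close> lists the endpoint data (constraints and cost),
  \<open>F\<close> parametrises the allowed values of \<open>\<theta>\<close> by the cone \<open>Q\<close>, and \<open>dir\<close> is the cost direction.\<close>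

theorem endpoint_separation:
  fixes \<theta> :: "'a \<Rightarrow> 'w::euclidean_space" and F :: "'p::euclidean_space \<Rightarrow> 'w"
  assumes \<theta>: "continuous_on UNIV \<theta>" "(\<theta> has_derivative \<theta>') (at (zb S))"
    and Q: "convex Q" "pcone Q" "0 \<in> Q" and V: "0 \<in> interior V" and F: "continuous_on (V \<inter> Q) F" "F 0 = \<theta> (zb S)"
    and M: "linear M" "\<And>e. e > 0 \<Longrightarrow> \<exists>d>0. \<forall>p\<in>V \<inter> Q. norm p < d \<longrightarrow> norm (F p - F 0 - M p) \<le> e * norm p"
    and "\<eta> > 0"
    and optimal: "\<And>\<omega> z p r. \<lbrakk>admissible \<omega>; trajectory \<omega> z; \<And>t. t \<in> {0..S} \<Longrightarrow> norm (z t - zb t) < \<eta>;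
        p \<in> V \<inter> Q; norm p < \<eta>; r > 0\<rbrakk> \<Longrightarrow> \<theta> (z S) \<noteq> F p - r *\<^sub>R dir"
  shows "\<exists>\<nu> q N. \<nu> \<noteq> 0 \<and> costate (\<Sum>b\<in>Basis. (\<nu> \<bullet> \<theta>' b) *\<^sub>R b) q \<and> (\<forall>p\<in>Q. 0 \<le> \<nu> \<bullet> M p) \<and> negligible N \<and>
    (\<forall>t\<in>{0<..<S} - N. \<forall>u\<in>U. q t \<bullet> (X (zb t) u - X (zb t) (ob t)) \<le> 0)"
proof -
  have "\<forall>b\<in>(Basis::'a set). \<exists>q N. costate b q \<and> negligible N \<and> (\<forall>t\<in>{0<..<S} - N. regular_instant q t)"
  proof
    fix b :: 'a
    obtain q where q: "costate b q" by (rule costate_exists)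
    then have "continuous_on {0..S} q" by (simp add: costate_def)
    from regular_instant_AE[OF this] obtain N where "negligible N" "\<And>t. t \<in> {0<..<S} - N \<Longrightarrow> regular_instant q t"
      by blast
    with q show "\<exists>q N. costate b q \<and> negligible N \<and> (\<forall>t\<in>{0<..<S} - N. regular_instant q t)" by blast
  qed
  then obtain qq NN where qq: "\<And>b. b \<in> (Basis::'a set) \<Longrightarrow> costate b (qq b)"
    and NN: "\<And>b. b \<in> (Basis::'a set) \<Longrightarrow> negligible (NN b)"
    and reg: "\<And>b t. b \<in> (Basis::'a set) \<Longrightarrow> t \<in> {0<..<S} - NN b \<Longrightarrow> regular_instant (qq b) t"
    by metis
  define N where "N = (\<Union>b\<in>(Basis::'a set). NN b)"
  have "negligible N" unfolding N_def by (rule negligible_Union) (use NN in auto)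
  define nds where "nds = ({0<..<S} - N) \<times> U"
  define D where "D = needle_velocity qq"
  have lin: "linear \<theta>'" using \<theta>(2) by (rule has_derivative_linear)
  show ?thesis
  \<comment> \<open>A cone smaller than the whole space is separated and gives the covector; a cone
    that fills the space is refuted by reaching forbidden endpoint data.\<close>
  proof (cases "\<forall>y. \<exists>F c p. finite F \<and> F \<subseteq> nds \<and> (\<forall>n. 0 \<le> c n) \<and> p \<in> Q \<and> y = (\<Sum>n\<in>F. c n *\<^sub>R \<theta>' (D n)) - M p")
    case False
    then obtain y where y: "\<not> (\<exists>F c p. finite F \<and> F \<subseteq> nds \<and> (\<forall>n. 0 \<le> c n) \<and> p \<in> Q \<and> y = (\<Sum>n\<in>F. c n *\<^sub>R \<theta>' (D n)) - M p)"
      unfolding not_all by (elim exE)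
    have "y \<noteq> (\<Sum>n\<in>F. c n *\<^sub>R \<theta>' (D n)) - M p" if "finite F" "F \<subseteq> nds" "\<And>n. 0 \<le> c n" "p \<in> Q" for F c p
    proof
      assume eq: "y = (\<Sum>n\<in>F. c n *\<^sub>R \<theta>' (D n)) - M p"
      show False
        by (rule notE[OF y], rule exI[of _ F], rule exI[of _ c], rule exI[of _ p], intro conjI allI that eq)
    qed
    from convex_cone_alternative[of Q M nds y "\<lambda>n. \<theta>' (D n)", OF Q M(1) this]
    obtain \<nu> where \<nu>: "\<nu> \<noteq> 0" "\<And>n. n \<in> nds \<Longrightarrow> \<nu> \<bullet> \<theta>' (D n) \<le> 0" "\<And>p. p \<in> Q \<Longrightarrow> 0 \<le> \<nu> \<bullet> M p"
      by blast
    define q where "q t = (\<Sum>b\<in>Basis. (\<nu> \<bullet> \<theta>' b) *\<^sub>R qq b t)" for t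
    have "costate (\<Sum>b\<in>Basis. (\<nu> \<bullet> \<theta>' b) *\<^sub>R b) q"
      unfolding q_def by (rule costate_combination[OF qq])
    moreover have "q t \<bullet> (X (zb t) u - X (zb t) (ob t)) \<le> 0" if "t \<in> {0<..<S} - N" "u \<in> U" for t u
    proof -
      have "q t \<bullet> (X (zb t) u - X (zb t) (ob t)) = \<nu> \<bullet> \<theta>' (D (t,u))"
        unfolding q_def D_def needle_velocity_def
        by (simp add: linear_sum[OF lin] linear_scale[OF lin] inner_sum_left inner_sum_right mult.commute)
      also have "\<dots> \<le> 0" using that by (intro \<nu>(2)) (auto simp: nds_def)
      finally show ?thesis .
    qed
    ultimately show ?thesis using \<nu> \<open>negligible N\<close> by blast
  next
    case True
    from conic_right_inverse[OF Q M(1) True[rule_format]]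
    obtain k n C \<epsilon> p where rep: "\<forall>j<(k::nat). n j \<in> nds" "0 \<le> C" "\<forall>y j. 0 \<le> \<epsilon> y j" "\<forall>y. p y \<in> Q"
        "\<forall>j. continuous_on UNIV (\<lambda>y. \<epsilon> y j)" "continuous_on UNIV p"
        "\<forall>y. (\<Sum>j<k. \<epsilon> y j *\<^sub>R \<theta>' (D (n j))) - M (p y) = y"
        "\<forall>y. (\<Sum>j<k. \<epsilon> y j) \<le> C * norm y" "\<forall>y. norm (p y) \<le> C * norm y" .
    note n = rep(1)[rule_format] and C = rep(2) and \<epsilon>0 = rep(3)[rule_format] and pQ = rep(4)[rule_format]
      and \<epsilon>c = rep(5)[rule_format] and pc = rep(6) and id = rep(7)[rule_format]
      and \<epsilon>C = rep(8)[rule_format] and pC = rep(9)[rule_format]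
    define \<tau> v where "\<tau> j = fst (n j)" and "v j = snd (n j)" for j
    have v: "v j \<in> U" if "j < k" for j using n[OF that] by (auto simp: nds_def v_def)
    have regj: "regular_instant (qq b) (\<tau> j)" if "b \<in> Basis" "j < k" for b j
      using reg[OF that(1), of "\<tau> j"] n[OF that(2)] that(1) by (auto simp: nds_def \<tau>_def N_def)
    define \<omega> where "\<omega> y = needle_control ob \<tau> v (\<epsilon> y) k" for y
    have \<omega>: "admissible (\<omega> y)" for y unfolding \<omega>_def by (rule admissible_needle[OF ob v])
    \<comment> \<open>Any choice of trajectories will do: \<open>zlip\<close> bounds the distance
      between them in terms of the needle lengths alone, which also makes the endpoint continuous in
      \<open>y\<close>.\<close>
    define z where "z y = (SOME z. trajectory (\<omega> y) z)" for y
    have z: "trajectory (\<omega> y) (z y)" for y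
      unfolding z_def using trajectory_exists[OF \<omega>[of y]] by (metis someI)
    have B: "0 \<le> B" by (rule order_trans[OF norm_ge_zero X_bound[OF admissible_in[OF ob, of 0]]]) (use S_pos in simp)
    define C1 where "C1 = 4 * B * real k * exp (L * S)"
    have C1: "0 \<le> C1" using B by (simp add: C1_def)
    have zlip: "norm (z y t - z y' t) \<le> C1 * (\<Sum>i<k. \<bar>\<epsilon> y i - \<epsilon> y' i\<bar>)" if "t \<in> {0..S}" for y y' t
      unfolding C1_def using z that unfolding \<omega>_def by (intro trajectory_needle_Lipschitz[OF ob v])
    have zzb: "norm (z y t - zb t) \<le> C1 * C * norm y" if t: "t \<in> {0..S}" for y t
    proof -
      have "needle_control ob \<tau> v (\<lambda>_. 0) k = ob"
        by (rule ext, rule needle_control_outside) (simp add: needle_interval_def)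
      then have "trajectory (needle_control ob \<tau> v (\<lambda>_. 0) k) zb" using zb by simp
      from trajectory_needle_Lipschitz[OF ob v z[unfolded \<omega>_def] this t]
      have "norm (z y t - zb t) \<le> C1 * (\<Sum>i<k. \<epsilon> y i)" using \<epsilon>0 by (simp add: C1_def)
      also have "\<dots> \<le> C1 * (C * norm y)" using \<epsilon>C C1 by (intro mult_left_mono) auto
      finally show ?thesis by (simp add: mult.assoc)
    qed
    \<comment> \<open>The mismatch between the data reached by the needles and the data allowed by
      the cone. The right inverse is built so that, to first order at 0, \<open>G\<close> is the
      identity.\<close>
    define G where "G y = \<theta> (z y S) - F (p y)" for y
    have S: "S \<in> {0..S}" using S_pos by simp
    have zc: "continuous_on UNIV (\<lambda>y. z y S)"
      unfolding continuous_on_iff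
    proof (intro ballI allI impI)
      fix y :: 'w and e :: real assume "e > 0"
      \<comment> \<open>A modulus that is continuous and vanishes at \<open>y\<close>; it carries
        the continuity of the coefficients over to the endpoints.\<close>
      define h where "h y' = C1 * (\<Sum>i<k. \<bar>\<epsilon> y' i - \<epsilon> y i\<bar>)" for y'
      have hc: "continuous_on UNIV h" unfolding h_def by (intro continuous_intros \<epsilon>c)
      obtain d where d: "d > 0" "\<And>y'. y' \<in> UNIV \<Longrightarrow> dist y' y \<le> d \<Longrightarrow> dist (h y') (h y) < e"
        using continuous_onE[OF hc UNIV_I \<open>e > 0\<close>] by blast
      have "h y = 0" by (simp add: h_def)
      have "dist (z y' S) (z y S) < e" if "dist y' y < d" for y'
        using d(2)[of y'] that zlip[OF S, of y' y] \<open>h y = 0\<close> unfolding h_def[of y', symmetric]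
        by (simp add: dist_norm)
      with d(1) show "\<exists>d>0. \<forall>y'\<in>UNIV. dist y' y < d \<longrightarrow> dist (z y' S) (z y S) < e" by blast
    qed
    obtain dV where dV: "dV > 0" "ball 0 dV \<subseteq> V"
      using V by (meson open_contains_ball_eq open_interior interior_subset subset_trans)
    define d0 where "d0 = dV / (C + 1)"
    have d0: "d0 > 0" using dV C by (simp add: d0_def)
    have pV: "p y \<in> V \<inter> Q" if "norm y < d0" for y
    proof -
      have "norm (p y) \<le> (C + 1) * norm y" using pC[of y] norm_ge_zero[of y] unfolding distrib_right by linarith
      also have "\<dots> < dV" using that C by (simp add: d0_def field_simps)
      finally show ?thesis using dV pQ by auto
    qed
    have Gc: "continuous_on (cball 0 r) G" if "r < d0" for r
      unfolding G_def
    proof (intro continuous_intros)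
      show "continuous_on (cball 0 r) (\<lambda>y. \<theta> (z y S))"
        by (rule continuous_on_compose2[OF \<theta>(1) continuous_on_subset[OF zc]]) auto
      show "continuous_on (cball 0 r) (\<lambda>y. F (p y))"
        by (rule continuous_on_compose2[OF F(1) continuous_on_subset[OF pc]]) (use pV that in auto)
    qed
    obtain K where K: "K > 0" "\<And>x. norm (\<theta>' x) \<le> norm x * K"
      using bounded_linear.pos_bounded[OF has_derivative_bounded_linear[OF \<theta>(2)]] by blast
    \<comment> \<open>Three first-order errors receive a third of \<open>e\<close> each: those of
      the needle expansion, of \<theta> and of \<open>F\<close>. The factor
      \<open>K * (C + 1)\<close> in \<open>e1\<close> compensates for the norm of \<theta>' and for
      the size of the coefficients.\<close>
    have littleo: "\<exists>d>0. \<forall>y. norm y < d \<longrightarrow> norm (G y - y) \<le> e * norm y" if "e > 0" for e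
    proof -
      define e3 where "e3 = e / 3"
      have "e3 > 0" using that by (simp add: e3_def)
      define e1 where "e1 = e3 / (K * (C + 1))"
      have e1: "e1 > 0" using \<open>e3 > 0\<close> K C by (simp add: e1_def)
      have "\<exists>d>0. \<forall>\<epsilon> z. (\<forall>j<k. 0 \<le> \<epsilon> j) \<longrightarrow> sum \<epsilon> {..<k} < d \<longrightarrow> trajectory (needle_control ob \<tau> v \<epsilon> k) z \<longrightarrow>
         norm (z S - zb S - (\<Sum>j<k. \<epsilon> j *\<^sub>R needle_velocity qq (\<tau> j, v j))) \<le> e1 * sum \<epsilon> {..<k}"
        by (rule needle_expansion_vector[OF qq v regj e1])
      then obtain d1 where d1: "d1 > 0" "\<forall>\<epsilon> z. (\<forall>j<k. 0 \<le> \<epsilon> j) \<longrightarrow> sum \<epsilon> {..<k} < d1 \<longrightarrow> trajectory (needle_control ob \<tau> v \<epsilon> k) z \<longrightarrow>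
         norm (z S - zb S - (\<Sum>j<k. \<epsilon> j *\<^sub>R needle_velocity qq (\<tau> j, v j))) \<le> e1 * sum \<epsilon> {..<k}"
        by (elim exE conjE)
      have o1: "norm (z y S - zb S - (\<Sum>j<k. \<epsilon> y j *\<^sub>R D (n j))) \<le> e1 * ((C + 1) * norm y)" if "norm y < d1 / (C + 1)" for y
      proof -
        have 1: "C * norm y \<le> (C + 1) * norm y" by (simp add: algebra_simps)
        have "(C + 1) * norm y < d1" using that C by (simp add: field_simps)
        then have "sum (\<epsilon> y) {..<k} < d1" using \<epsilon>C[of y] 1 by linarith
        from d1(2)[rule_format, OF _ this z[unfolded \<omega>_def]] \<epsilon>0
        have "norm (z y S - zb S - (\<Sum>j<k. \<epsilon> y j *\<^sub>R D (n j))) \<le> e1 * sum (\<epsilon> y) {..<k}"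
          by (simp add: D_def \<tau>_def v_def)
        also have "\<dots> \<le> e1 * ((C + 1) * norm y)" using e1 \<epsilon>C[of y] 1 by (intro mult_left_mono) auto
        finally show ?thesis .
      qed
      have "\<exists>d>0. \<forall>x\<in>UNIV. norm (x - zb S) < d \<longrightarrow> norm (\<theta> x - \<theta> (zb S) - \<theta>' (x - zb S)) \<le> e * norm (x - zb S)"
        if "e > 0" for e
        using \<theta>(2) that unfolding has_derivative_at_alt by simp
      from first_order_along[of UNIV "zb S" \<theta> \<theta>' 1 "\<lambda>y. z y S" "C1 * C", OF this _ _ _ \<open>e3 > 0\<close>] zzb[OF S] C C1
      obtain d2 where d2: "d2 > 0" "\<And>y. norm y < d2 \<Longrightarrow> norm (\<theta> (z y S) - \<theta> (zb S) - \<theta>' (z y S - zb S)) \<le> e3 * norm y"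
        by auto
      have "\<exists>d>0. \<forall>p\<in>V \<inter> Q. norm (p - 0) < d \<longrightarrow> norm (F p - F 0 - M (p - 0)) \<le> e * norm (p - 0)" if "e > 0" for e
        using M(2)[OF that] by simp
      from first_order_along[of "V \<inter> Q" 0 F M d0 p C, OF this _ d0 C \<open>e3 > 0\<close>] pV pC
      obtain d3 where d3: "d3 > 0" "\<And>y. norm y < d3 \<Longrightarrow> norm (F (p y) - F 0 - M (p y)) \<le> e3 * norm y"
        by auto
      define d where "d = min (d1 / (C + 1)) (min d2 d3)"
      have "norm (G y - y) \<le> e * norm y" if y: "norm y < d" for y
      proof -
        define a1 where "a1 = \<theta> (z y S) - \<theta> (zb S) - \<theta>' (z y S - zb S)"
        define a2 where "a2 = z y S - zb S - (\<Sum>j<k. \<epsilon> y j *\<^sub>R D (n j))"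
        define a3 where "a3 = F (p y) - F 0 - M (p y)"
        have "(\<Sum>j<k. \<epsilon> y j *\<^sub>R \<theta>' (D (n j))) = \<theta>' (\<Sum>j<k. \<epsilon> y j *\<^sub>R D (n j))"
          by (simp add: linear_sum[OF lin] linear_scale[OF lin])
        then have "G y - y = a1 + \<theta>' a2 - a3"
          using id[of y] unfolding a1_def a2_def a3_def G_def 
          by (simp add: F(2) linear_diff[OF lin] linear_add[OF lin] algebra_simps)
        moreover have "norm a1 \<le> e3 * norm y" unfolding a1_def using y by (intro d2) (simp add: d_def)
        moreover have "norm a3 \<le> e3 * norm y" unfolding a3_def using y by (intro d3) (simp add: d_def)
        moreover have "norm (\<theta>' a2) \<le> e3 * norm y"
        proof -
          have "norm a2 \<le> e1 * ((C + 1) * norm y)" unfolding a2_def using y by (intro o1) (simp add: d_def)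
          then have "norm a2 * K \<le> e1 * ((C + 1) * norm y) * K" using K by (intro mult_right_mono) auto
          also have "\<dots> = (e1 * (K * (C + 1))) * norm y" by (simp add: mult_ac)
          also have "e1 * (K * (C + 1)) = e3"
          proof -
            have "K * (C + 1) \<noteq> 0" using K(1) C by simp
            then show ?thesis by (simp add: e1_def)
          qed
          finally show ?thesis using K(2)[of a2] by linarith
        qed
        ultimately show ?thesis
          using norm_triangle_ineq4[of "a1 + \<theta>' a2" a3] norm_triangle_ineq[of a1 "\<theta>' a2"] by (simp add: e3_def)
      qed
      moreover have "d > 0" using d1 d2 d3 C by (simp add: d_def)
      ultimately show ?thesis by blast
    qed
    obtain d where d: "d > 0" "\<And>y. norm y < d \<Longrightarrow> norm (G y - y) \<le> 1/2 * norm y" using littleo[of "1/2"] by auto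
    \<comment> \<open>\<open>C2\<close> dominates the constants for the trajectory and for the cone
      point, so a radius below \<open>\<eta> / C2\<close> keeps both within
      \<open>\<eta>\<close>.\<close>
    define C2 where "C2 = C1 * C + C + 1"
    have C2: "C2 > 0" "C1 * C \<le> C2" "C \<le> C2" using C C1 by (auto simp: C2_def intro: add_nonneg_pos)
    define r where "r = min (d0 / 2) (min (d / 2) (\<eta> / (2 * C2)))"
    have r: "r > 0" "r < d0" "r < d" "C2 * r < \<eta>"
    proof -
      show "r > 0" unfolding r_def using d0 d C2 \<open>\<eta> > 0\<close> by simp
      show "r < d0" "r < d" unfolding r_def using d0 d by auto
      have "C2 * r \<le> C2 * (\<eta> / (2 * C2))" using C2 by (intro mult_left_mono) (auto simp: r_def)
      also have "\<dots> < \<eta>" using C2 \<open>\<eta> > 0\<close> by simp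
      finally show "C2 * r < \<eta>" .
    qed
    \<comment> \<open>Makes \<open>\<rho> *\<^sub>R dir\<close> at most r/2 long, so that its
      negative is a value Brouwer's theorem guarantees: a strict displacement against
      \<open>dir\<close>, which optimality excludes.\<close>
    define \<rho> where "\<rho> = r / (2 * (norm dir + 1))"
    have "\<rho> > 0" using r unfolding \<rho>_def by (intro divide_pos_pos) (auto intro: add_nonneg_pos)
    have "norm (- (\<rho> *\<^sub>R dir)) \<le> r / 2"
    proof -
      have "norm (- (\<rho> *\<^sub>R dir)) = \<rho> * norm dir" using \<open>\<rho> > 0\<close> by simp
      also have "\<dots> \<le> \<rho> * (norm dir + 1)" using \<open>\<rho> > 0\<close> by (intro mult_left_mono) auto
      also have "\<dots> = r / 2"
      proof -
        have "norm dir + 1 \<noteq> 0" by (smt (verit) norm_ge_zero)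
        then show ?thesis by (simp add: \<rho>_def field_simps)
      qed
      finally show ?thesis .
    qed
    moreover have "norm (G y - y) \<le> r / 2" if "y \<in> cball 0 r" for y
    proof -
      have "norm y \<le> r" using that by simp
      then show ?thesis using d(2)[of y] r by linarith
    qed
    ultimately obtain y where y: "y \<in> cball 0 r" "G y = - (\<rho> *\<^sub>R dir)"
      using locally_onto_identity_perturbation[OF r(1) Gc[OF r(2)]] by blast
    have ny: "norm y \<le> r" using y by simp
    have le: "c * norm y < \<eta>" if "0 \<le> c" "c \<le> C2" for c
    proof -
      have "c * norm y \<le> C2 * r" using that ny C2 by (intro mult_mono) auto
      then show ?thesis using r(4) by linarith
    qed
    have "\<theta> (z y S) \<noteq> F (p y) - \<rho> *\<^sub>R dir"
    proof (rule optimal[OF \<omega> z])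
      show "norm (z y t - zb t) < \<eta>" if "t \<in> {0..S}" for t
        using zzb[OF that, of y] le[of "C1 * C"] C C1 C2 by (auto intro: le_less_trans)
      show "p y \<in> V \<inter> Q" using ny r by (intro pV) auto
      show "norm (p y) < \<eta>" using pC[of y] le[of C] C C2 by (auto intro: le_less_trans)
      show "\<rho> > 0" by fact
    qed
    moreover have "\<theta> (z y S) = F (p y) - \<rho> *\<^sub>R dir" using y(2) by (simp add: G_def algebra_simps)
    ultimately show ?thesis by blast
  qed
qed

end

section \<open>Smooth systems\<close>

locale smooth_reference =
  fixes X :: "'z::euclidean_space \<Rightarrow> 'u::euclidean_space \<Rightarrow> 'z" and D :: "'z \<Rightarrow> 'u \<Rightarrow> 'z \<Rightarrow>\<^sub>L 'z"
    and U :: "'u set" and S :: real and ob :: "real \<Rightarrow> 'u" and zb :: "real \<Rightarrow> 'z"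
  assumes S_pos: "0 < S" and U_compact: "compact U"
    and X_cont: "continuous_on (UNIV \<times> U) (\<lambda>(z,u). X z u)"
    and X_deriv: "\<And>z u. u \<in> U \<Longrightarrow> ((\<lambda>z. X z u) has_derivative blinfun_apply (D z u)) (at z)"
    and D_cont: "continuous_on (UNIV \<times> U) (\<lambda>(z,u). D z u)"
    and ob_meas: "ob \<in> borel_measurable (lebesgue_on {0..S})" and ob_in: "ob \<in> {0..S} \<rightarrow> U"
    and zb_cont: "continuous_on {0..S} zb"
    and zb_eq: "\<And>t. t \<in> {0..S} \<Longrightarrow> zb t = zb 0 + integral {0..t} (\<lambda>s. X (zb s) (ob s))"
begin

section \<open>Compactness estimates around the reference\<close>

definition adjoint_field :: "real \<Rightarrow> 'z \<Rightarrow> 'z" where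
  "adjoint_field s x = (\<Sum>b\<in>Basis. (x \<bullet> blinfun_apply (D (zb s) (ob s)) b) *\<^sub>R b)"

lemma adjoint_field_inner: "adjoint_field s x \<bullet> y = x \<bullet> blinfun_apply (D (zb s) (ob s)) y"
  unfolding adjoint_field_def
  by (rule linear_adjoint_inner) (rule bounded_linear.linear[OF blinfun.bounded_linear_right])

text \<open>The margin 1 leaves a tube of unit radius about the reference inside the ball, where a
  projection onto the ball changes nothing.\<close>

lemma cutoff_constants:
  obtains R L B where "0 < R" "\<forall>s\<in>{0..S}. norm (zb s) + 1 \<le> R" "0 < L"
    "\<forall>z\<in>cball 0 R. \<forall>u\<in>U. norm (X z u) \<le> B" "\<forall>z\<in>cball 0 R. \<forall>u\<in>U. norm (D z u) \<le> L"
proof -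
  obtain R0 where R0: "\<And>s. s \<in> {0..S} \<Longrightarrow> norm (zb s) \<le> R0"
    using compact_imp_bounded[OF compact_continuous_image[OF zb_cont compact_Icc]]
    unfolding bounded_iff by blast
  define R where "R = \<bar>R0\<bar> + 1"
  have comp: "compact (cball (0::'z) R \<times> U)" by (intro compact_Times compact_cball U_compact)
  have "bounded ((\<lambda>(z,u). X z u) ` (cball 0 R \<times> U))"
    by (intro compact_imp_bounded compact_continuous_image[OF _ comp] continuous_on_subset[OF X_cont]) auto
  then obtain B where B: "\<And>x. x \<in> (\<lambda>(z,u). X z u) ` (cball 0 R \<times> U) \<Longrightarrow> norm x \<le> B"
    unfolding bounded_iff by blast
  have "bounded ((\<lambda>(z,u). D z u) ` (cball 0 R \<times> U))"
    by (intro compact_imp_bounded compact_continuous_image[OF _ comp] continuous_on_subset[OF D_cont]) auto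
  then obtain L where L: "\<And>x. x \<in> (\<lambda>(z,u). D z u) ` (cball 0 R \<times> U) \<Longrightarrow> norm x \<le> L"
    unfolding bounded_iff by blast
  show ?thesis
  proof (rule that[of R "\<bar>L\<bar> + 1" B])
    show "0 < R" "0 < \<bar>L\<bar> + 1" by (auto simp: R_def)
    show "\<forall>s\<in>{0..S}. norm (zb s) + 1 \<le> R" using R0 by (force simp: R_def)
    show "\<forall>z\<in>cball 0 R. \<forall>u\<in>U. norm (X z u) \<le> B"
      by (intro ballI B) force
    show "\<forall>z\<in>cball 0 R. \<forall>u\<in>U. norm (D z u) \<le> \<bar>L\<bar> + 1"
    proof (intro ballI)
      fix z u assume "z \<in> cball (0::'z) R" "u \<in> U"
      then have "norm (D z u) \<le> L" by (intro L) force
      then show "norm (D z u) \<le> \<bar>L\<bar> + 1" by linarith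
    qed
  qed
qed

text \<open>One radius serves all times, however irregular the reference control is in time, because
  \<open>D\<close> is uniformly continuous on a compact set of states and control values. The mean
  value inequality then runs on the convex set \<open>G\<close>.\<close>

lemma uniform_linearization:
  assumes R: "\<And>s. s \<in> {0..S} \<Longrightarrow> norm (zb s) + 1 \<le> R" and "e > 0"
  shows "\<exists>d>0. d \<le> 1 \<and> (\<forall>s\<in>{0..S}. \<forall>x. norm (x - zb s) < d \<longrightarrow>
        norm (X x (ob s) - X (zb s) (ob s) - blinfun_apply (D (zb s) (ob s)) (x - zb s)) \<le> e * norm (x - zb s))"
proof -
  have comp: "compact (cball (0::'z) R \<times> U)" by (intro compact_Times compact_cball U_compact)
  have "uniformly_continuous_on (cball 0 R \<times> U) (\<lambda>(z,u). D z u)"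
    by (rule compact_uniformly_continuous[OF continuous_on_subset[OF D_cont] comp]) auto
  then obtain d where d: "d > 0" "\<And>p p'. p \<in> cball 0 R \<times> U \<Longrightarrow> p' \<in> cball 0 R \<times> U \<Longrightarrow> dist p' p < d \<Longrightarrow>
      dist ((\<lambda>(z,u). D z u) p') ((\<lambda>(z,u). D z u) p) < e"
    using \<open>e > 0\<close> unfolding uniformly_continuous_on_def by meson
  have "norm (X x (ob s) - X (zb s) (ob s) - blinfun_apply (D (zb s) (ob s)) (x - zb s)) \<le> e * norm (x - zb s)"
    if s: "s \<in> {0..S}" and x: "norm (x - zb s) < min d 1" for s x
  proof -
    define G where "G = cball 0 R \<inter> ball (zb s) (min d 1)"
    have u: "ob s \<in> U" using ob_in s by auto
    have z: "zb s \<in> G" unfolding G_def using R[OF s] d(1) by simp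
    have "norm x \<le> norm (zb s) + norm (x - zb s)" by (rule norm_triangle_sub)
    then have xG: "x \<in> G" unfolding G_def using R[OF s] x by (simp add: dist_norm norm_minus_commute)
    have "convex G" unfolding G_def by (intro convex_Int convex_cball convex_ball)
    have "norm (X x (ob s) - X (zb s) (ob s) - blinfun_apply (D (zb s) (ob s)) (x - zb s)) \<le> norm (x - zb s) * e"
    proof (rule differentiable_bound_linearization[where S=G and f'="\<lambda>z. blinfun_apply (D z (ob s))"])
      fix t :: real assume t: "t \<in> {0..1}"
      have "(1 - t) *\<^sub>R zb s + t *\<^sub>R x \<in> G"
        using t by (intro convexD[OF \<open>convex G\<close> z xG]) auto
      then show "zb s + t *\<^sub>R (x - zb s) \<in> G" by (simp add: algebra_simps)
    next
      fix y assume y: "y \<in> G"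
      show "((\<lambda>z. X z (ob s)) has_derivative blinfun_apply (D y (ob s))) (at y within G)"
        by (rule has_derivative_at_withinI[OF X_deriv[OF u]])
      have "dist (D y (ob s)) (D (zb s) (ob s)) < e"
        using d(2)[of "(zb s, ob s)" "(y, ob s)"] y z u unfolding G_def by (simp add: dist_Pair_Pair dist_commute)
      then have "norm (D y (ob s) - D (zb s) (ob s)) \<le> e" by (simp add: dist_norm)
      moreover have "(\<lambda>h. blinfun_apply (D y (ob s)) h) - (\<lambda>h. blinfun_apply (D (zb s) (ob s)) h)
          = blinfun_apply (D y (ob s) - D (zb s) (ob s))"
        by (rule ext) (simp add: blinfun.diff_left)
      ultimately show "onorm (blinfun_apply (D y (ob s)) - blinfun_apply (D (zb s) (ob s))) \<le> e"
        by (simp add: norm_blinfun.rep_eq)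
    qed (rule z)
    then show ?thesis by (simp add: mult.commute)
  qed
  then show ?thesis using d(1) by (intro exI[of _ "min d 1"]) auto
qed

text \<open>Precomposing the field with the projection onto a large ball makes it bounded and globally Lipschitz
  without affecting trajectories close to the reference one.\<close>

theorem pontryagin_separation:
  fixes \<theta> :: "'z \<Rightarrow> 'w::euclidean_space" and F :: "'p::euclidean_space \<Rightarrow> 'w"
  assumes \<theta>: "continuous_on UNIV \<theta>" "(\<theta> has_derivative \<theta>') (at (zb S))"
    and Q: "convex Q" "pcone Q" "0 \<in> Q" and V: "0 \<in> interior V" and F: "continuous_on (V \<inter> Q) F" "F 0 = \<theta> (zb S)"
    and M: "linear M" "\<And>e. e > 0 \<Longrightarrow> \<exists>d>0. \<forall>p\<in>V \<inter> Q. norm p < d \<longrightarrow> norm (F p - F 0 - M p) \<le> e * norm p"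
    and "\<eta> > 0"
    and optimal: "\<And>\<omega> z p r. \<lbrakk>\<omega> \<in> borel_measurable (lebesgue_on {0..S}); \<omega> \<in> {0..S} \<rightarrow> U; continuous_on {0..S} z;
        \<And>t. t \<in> {0..S} \<Longrightarrow> z t = zb 0 + integral {0..t} (\<lambda>s. X (z s) (\<omega> s));
        \<And>t. t \<in> {0..S} \<Longrightarrow> norm (z t - zb t) < \<eta>;
        p \<in> V \<inter> Q; norm p < \<eta>; r > 0\<rbrakk> \<Longrightarrow> \<theta> (z S) \<noteq> F p - r *\<^sub>R dir"
  shows "\<exists>\<nu> q N. \<nu> \<noteq> 0 \<and> AC_on 0 S q \<and> continuous_on {0..S} q \<and> q S = (\<Sum>b\<in>Basis. (\<nu> \<bullet> \<theta>' b) *\<^sub>R b) \<and>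
    (\<forall>b\<in>Basis. (\<forall>s\<in>{0..S}. blinfun_apply (D (zb s) (ob s)) b = 0) \<longrightarrow> (\<forall>t\<in>{0..S}. q t \<bullet> b = q S \<bullet> b)) \<and>
    (\<forall>p\<in>Q. 0 \<le> \<nu> \<bullet> M p) \<and> negligible N \<and>
    (\<forall>t\<in>{0..S} - N. (q has_vector_derivative - adjoint_field t (q t)) (at t within {0..S})) \<and>
    (\<forall>t\<in>{0<..<S} - N. \<forall>u\<in>U. q t \<bullet> (X (zb t) u - X (zb t) (ob t)) \<le> 0)"
proof -
  from cutoff_constants obtain R L B where cst: "0 < R" "\<forall>s\<in>{0..S}. norm (zb s) + 1 \<le> R" "0 < L"
    "\<forall>z\<in>cball 0 R. \<forall>u\<in>U. norm (X z u) \<le> B" "\<forall>z\<in>cball 0 R. \<forall>u\<in>U. norm (D z u) \<le> L" .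
  note R = cst(1) cst(2)[rule_format] and L = cst(3) and B = cst(4)[rule_format] and DL = cst(5)[rule_format]
  define P where "P = closest_point (cball (0::'z) R)"
  have ne: "cball (0::'z) R \<noteq> {}" using R(1) by simp
  have P_in: "P x \<in> cball 0 R" for x unfolding P_def by (rule closest_point_in_set[OF closed_cball ne])
  have P_lip: "norm (P x - P y) \<le> norm (x - y)" for x y
    using closest_point_lipschitz[OF convex_cball closed_cball ne, of x y] by (simp add: P_def dist_norm)
  have P_id: "P x = x" if "norm x \<le> R" for x unfolding P_def using that by (intro closest_point_self) simp
  have P_near: "P x = x" if "s \<in> {0..S}" "norm (x - zb s) \<le> 1" for s x
  proof (rule P_id)
    have "norm x \<le> norm (zb s) + norm (x - zb s)" by (rule norm_triangle_sub)
    then show "norm x \<le> R" using R(2)[OF that(1)] that(2) by linarith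
  qed
  have P_zb: "P (zb s) = zb s" if "s \<in> {0..S}" for s using P_near[OF that, of "zb s"] by simp
  have X_lip: "norm (X x u - X y u) \<le> L * norm (x - y)" if u: "u \<in> U" and xy: "x \<in> cball 0 R" "y \<in> cball 0 R" for x y u
  proof (rule differentiable_bound[OF convex_cball _ _ xy])
    show "((\<lambda>z. X z u) has_derivative blinfun_apply (D z u)) (at z within cball 0 R)" for z
      by (rule has_derivative_at_withinI[OF X_deriv[OF u]])
    show "onorm (blinfun_apply (D z u)) \<le> L" if "z \<in> cball 0 R" for z
      using DL[OF that u] by (simp add: norm_blinfun.rep_eq)
  qed
  \<comment> \<open>The projection is nonexpansive with values in the ball, so the bounds valid on
    the ball become global with the same constants.\<close>
  interpret cut: control_system "\<lambda>z u. X (P z) u" U S "zb 0" B L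
  proof
    have "continuous_on (UNIV \<times> U) (\<lambda>p. (\<lambda>(z,u). X z u) (P (fst p), snd p))"
    proof (rule continuous_on_compose2[OF X_cont])
      have "continuous_on UNIV P" unfolding P_def by (rule continuous_on_closest_point[OF convex_cball closed_cball ne])
      from continuous_on_compose2[OF this continuous_on_fst[OF continuous_on_id]]
      have "continuous_on (UNIV \<times> U) (\<lambda>p. P (fst p))" by simp
      then show "continuous_on (UNIV \<times> U) (\<lambda>p. (P (fst p), snd p))"
        by (rule continuous_on_Pair) (rule continuous_on_snd[OF continuous_on_id])
    qed auto
    then show "continuous_on (UNIV \<times> U) (\<lambda>(z,u). X (P z) u)" by (simp add: case_prod_unfold)
    show "norm (X (P z) u) \<le> B" if "u \<in> U" for z u by (rule B[OF P_in that])
    show "norm (X (P x) u - X (P y) u) \<le> L * norm (x - y)" if "u \<in> U" for x y u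
    proof -
      have "norm (X (P x) u - X (P y) u) \<le> L * norm (P x - P y)" by (rule X_lip[OF that P_in P_in])
      also have "\<dots> \<le> L * norm (x - y)" using P_lip L by (intro mult_left_mono) auto
      finally show ?thesis .
    qed
  qed (use S_pos L in auto)
  have adm: "cut.admissible ob" using ob_meas ob_in by (simp add: cut.admissible_def)
  have field_eq: "integral {0..t} (\<lambda>s. X (P (zb s)) (ob s)) = integral {0..t} (\<lambda>s. X (zb s) (ob s))" if "t \<in> {0..S}" for t
    using that by (intro integral_cong) (simp add: P_zb)
  have traj: "cut.trajectory ob zb"
    unfolding cut.trajectory_def
  proof (intro conjI ballI zb_cont)
    fix t assume t: "t \<in> {0..S}"
    show "zb t = zb 0 + integral {0..t} (\<lambda>s. X (P (zb s)) (ob s))"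
      unfolding field_eq[OF t] by (rule zb_eq[OF t])
  qed
  interpret ref: reference_trajectory "\<lambda>z u. X (P z) u" U S "zb 0" B L ob zb "\<lambda>s. blinfun_apply (D (zb s) (ob s))"
  proof (rule reference_trajectory.intro[OF cut.control_system_axioms], rule reference_trajectory_axioms.intro)
    show "cut.admissible ob" "cut.trajectory ob zb" by fact+
    show "linear (blinfun_apply (D (zb s) (ob s)))" if "s \<in> {0..S}" for s
      by (rule bounded_linear.linear[OF blinfun.bounded_linear_right])
    show "(\<lambda>s. blinfun_apply (D (zb s) (ob s)) b) \<in> borel_measurable (lebesgue_on {0..S})" for b
    proof (rule borel_measurable_continuous_on_pair[OF _ zb_cont ob_meas ob_in, where h="\<lambda>z u. blinfun_apply (D z u) b"])
      have "continuous_on (UNIV \<times> U) (\<lambda>p. blinfun_apply ((\<lambda>(z,u). D z u) p) b)"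
        by (intro continuous_intros D_cont)
      then show "continuous_on (UNIV \<times> U) (\<lambda>(z,u). blinfun_apply (D z u) b)" by (simp add: case_prod_unfold)
    qed
    show "norm (blinfun_apply (D (zb s) (ob s)) x) \<le> L * norm x" if "s \<in> {0..S}" for s x
    proof -
      have "norm (blinfun_apply (D (zb s) (ob s)) x) \<le> norm (D (zb s) (ob s)) * norm x" by (rule norm_blinfun)
      also have "\<dots> \<le> L * norm x"
        using DL[of "zb s" "ob s"] R(2)[OF that] funcset_mem[OF ob_in that] by (intro mult_right_mono) auto
      finally show ?thesis .
    qed
    fix e :: real assume "e > 0"
    obtain d where d: "d > 0" "d \<le> 1" "\<forall>s\<in>{0..S}. \<forall>x. norm (x - zb s) < d \<longrightarrow>
        norm (X x (ob s) - X (zb s) (ob s) - blinfun_apply (D (zb s) (ob s)) (x - zb s)) \<le> e * norm (x - zb s)"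
      using uniform_linearization[OF R(2) \<open>e > 0\<close>] by blast
    show "\<exists>d>0. \<forall>s\<in>{0..S}. \<forall>x. norm (x - zb s) < d \<longrightarrow>
        norm (X (P x) (ob s) - X (P (zb s)) (ob s) - blinfun_apply (D (zb s) (ob s)) (x - zb s)) \<le> e * norm (x - zb s)"
    proof (intro exI[of _ d] conjI ballI allI impI)
      fix s x assume s: "s \<in> {0..S}" and x: "norm (x - zb s) < d"
      have "P x = x" using P_near[OF s, of x] x d(2) by simp
      then show "norm (X (P x) (ob s) - X (P (zb s)) (ob s) - blinfun_apply (D (zb s) (ob s)) (x - zb s)) \<le> e * norm (x - zb s)"
        using d(3) s x P_zb[OF s] by simp
    qed (rule d)
  qed
  have adj: "ref.adj = adjoint_field"
    by (intro ext) (simp add: ref.adj_def adjoint_field_def)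
  obtain \<nu> q N where \<nu>: "\<nu> \<noteq> 0" and q: "ref.costate (\<Sum>b\<in>Basis. (\<nu> \<bullet> \<theta>' b) *\<^sub>R b) q"
    and MQ: "\<forall>p\<in>Q. 0 \<le> \<nu> \<bullet> M p" and N: "negligible N"
    and needle: "\<forall>t\<in>{0<..<S} - N. \<forall>u\<in>U. q t \<bullet> (X (P (zb t)) u - X (P (zb t)) (ob t)) \<le> 0"
  proof -
    have "\<exists>\<nu> q N. \<nu> \<noteq> 0 \<and> ref.costate (\<Sum>b\<in>Basis. (\<nu> \<bullet> \<theta>' b) *\<^sub>R b) q \<and> (\<forall>p\<in>Q. 0 \<le> \<nu> \<bullet> M p) \<and> negligible N \<and>
      (\<forall>t\<in>{0<..<S} - N. \<forall>u\<in>U. q t \<bullet> (X (P (zb t)) u - X (P (zb t)) (ob t)) \<le> 0)"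
    proof (rule ref.endpoint_separation[OF \<theta> Q V F M])
      \<comment> \<open>Distance below 1 keeps competitors in the tube where the projection is the
        identity, so they solve the original equation.\<close>
      show "0 < min \<eta> 1" using \<open>\<eta> > 0\<close> by simp
      fix \<omega> z p r
      assume \<omega>: "cut.admissible \<omega>" and z: "cut.trajectory \<omega> z"
        and near: "\<And>t. t \<in> {0..S} \<Longrightarrow> norm (z t - zb t) < min \<eta> 1"
        and p: "p \<in> V \<inter> Q" "norm p < min \<eta> 1" and "0 < (r::real)"
      show "\<theta> (z S) \<noteq> F p - r *\<^sub>R dir"
      proof (rule optimal)
        show "\<omega> \<in> borel_measurable (lebesgue_on {0..S})" "\<omega> \<in> {0..S} \<rightarrow> U" using \<omega> by (auto simp: cut.admissible_def)
        show "continuous_on {0..S} z" by (rule cut.trajectoryD(1)[OF z])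
        show "z t = zb 0 + integral {0..t} (\<lambda>s. X (z s) (\<omega> s))" if t: "t \<in> {0..S}" for t
        proof -
          have "integral {0..t} (\<lambda>s. X (P (z s)) (\<omega> s)) = integral {0..t} (\<lambda>s. X (z s) (\<omega> s))"
          proof (rule integral_cong)
            fix s assume "s \<in> {0..t}"
            then have s: "s \<in> {0..S}" using t by auto
            have "P (z s) = z s" using P_near[OF s, of "z s"] near[OF s] by simp
            then show "X (P (z s)) (\<omega> s) = X (z s) (\<omega> s)" by simp
          qed
          then show ?thesis using cut.trajectoryD(2)[OF z t] by simp
        qed
        show "norm (z t - zb t) < \<eta>" if "t \<in> {0..S}" for t using near[OF that] by simp
      qed (use p \<open>0 < r\<close> in auto)
    qed
    then show thesis using that by blast
  qed
  have qc: "continuous_on {0..S} q" and qS: "q S = (\<Sum>b\<in>Basis. (\<nu> \<bullet> \<theta>' b) *\<^sub>R b)"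
    and q_eq: "\<And>t. t \<in> {0..S} \<Longrightarrow> q t = q 0 + integral {0..t} (\<lambda>s. - adjoint_field s (q s))"
    using q unfolding ref.costate_def adj by blast+
  obtain C where facts: "0 \<le> C" "\<forall>s\<in>{0..S}. norm (q s) \<le> C"
    "(\<lambda>s. - adjoint_field s (q s)) integrable_on {0..S}"
    "\<forall>s t. 0 \<le> s \<longrightarrow> s \<le> t \<longrightarrow> t \<le> S \<longrightarrow> norm (q t - q s) \<le> L * real DIM('z) * C * (t - s)"
    using ref.costate_facts[OF q] unfolding adj by (elim exE conjE)
  have AC: "AC_on 0 S q" by (rule Lipschitz_imp_AC_on[OF facts(4)[rule_format]])
  obtain N' where N': "negligible N'" "\<And>x. x \<in> {0..S} - N' \<Longrightarrow>
      ((\<lambda>t. integral {0..t} (\<lambda>s. - adjoint_field s (q s))) has_vector_derivative - adjoint_field x (q x)) (at x within {0..S})"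
    using indefinite_integral_has_vector_derivative_AE[OF facts(3)] by blast
  have q': "(q has_vector_derivative - adjoint_field t (q t)) (at t within {0..S})" if t: "t \<in> {0..S} - N'" for t
  proof -
    have "((\<lambda>t. q 0 + integral {0..t} (\<lambda>s. - adjoint_field s (q s))) has_vector_derivative - adjoint_field t (q t)) (at t within {0..S})"
      using has_vector_derivative_add[OF has_vector_derivative_const N'(2)[OF t], of "q 0"] by simp
    from has_vector_derivative_transform[OF _ q_eq this] t show ?thesis by simp
  qed
  \<comment> \<open>A direction along which the field does not vary is cyclic: the matching costate
    component has zero derivative. This is what makes p0, \<pi> and \<lambda> constants.\<close>
  have const: "q t \<bullet> b = q S \<bullet> b" if b: "b \<in> Basis" and zero: "\<forall>s\<in>{0..S}. blinfun_apply (D (zb s) (ob s)) b = 0" and t: "t \<in> {0..S}" for b t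
  proof -
    have 0: "q r \<bullet> b = q 0 \<bullet> b" if r: "r \<in> {0..S}" for r
    proof -
      have I: "(\<lambda>s. - adjoint_field s (q s)) integrable_on {0..r}"
        by (rule integrable_subinterval_real[OF facts(3)]) (use r in simp)
      have "integral {0..r} (\<lambda>s. - adjoint_field s (q s)) \<bullet> b = integral {0..r} (\<lambda>s. (- adjoint_field s (q s)) \<bullet> b)"
        by (rule integral_component_eq[OF I, symmetric])
      also have "\<dots> = integral {0..r} (\<lambda>s. 0)"
      proof (rule integral_cong)
        fix s assume "s \<in> {0..r}"
        then have "s \<in> {0..S}" using r by auto
        have "adjoint_field s (q s) \<bullet> b = q s \<bullet> blinfun_apply (D (zb s) (ob s)) b"
          unfolding adjoint_field_def using b by (rule inner_sum_left_Basis)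
        then show "(- adjoint_field s (q s)) \<bullet> b = 0" using zero \<open>s \<in> {0..S}\<close> by simp
      qed
      finally have "integral {0..r} (\<lambda>s. - adjoint_field s (q s)) \<bullet> b = 0" by simp
      then show ?thesis using arg_cong[OF q_eq[OF r], of "\<lambda>x. x \<bullet> b"] by (simp only: inner_add_left)
    qed
    show ?thesis using 0[OF t] 0[of S] S_pos by simp
  qed
  have "\<forall>t\<in>{0<..<S} - (N \<union> N'). \<forall>u\<in>U. q t \<bullet> (X (zb t) u - X (zb t) (ob t)) \<le> 0"
    using needle P_zb by simp
  moreover have "negligible (N \<union> N')" using N N'(1) by (rule negligible_Un)
  ultimately show ?thesis
    using \<nu> AC qc qS MQ const q'
    by (intro exI[of _ \<nu>] exI[of _ q] exI[of _ "N \<union> N'"]) simp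
qed

end

section \<open>The space-time problem as a control system\<close>

text \<open>Bridges the almost-everywhere clauses in the definition of a process and the explicit
  null sets used with the gauge integral.\<close>

lemma AE_lebesgue_on_iff_negligible:
  fixes a b :: real
  shows "(AE s in lebesgue_on {a..b}. P s) \<longleftrightarrow> (\<exists>N. negligible N \<and> (\<forall>s\<in>{a..b} - N. P s))"
proof
  assume "AE s in lebesgue_on {a..b}. P s"
  then have "AE s in lebesgue. s \<in> {a..b} \<longrightarrow> P s" by (subst (asm) AE_restrict_space_iff) auto
  then obtain N where "N \<in> null_sets lebesgue" "{s \<in> space lebesgue. \<not> (s \<in> {a..b} \<longrightarrow> P s)} \<subseteq> N"
    unfolding eventually_ae_filter by blast
  then show "\<exists>N. negligible N \<and> (\<forall>s\<in>{a..b} - N. P s)"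
    by (intro exI[of _ N]) (auto simp: negligible_iff_null_sets)
next
  assume "\<exists>N. negligible N \<and> (\<forall>s\<in>{a..b} - N. P s)"
  then obtain N where N: "N \<in> null_sets lebesgue" "\<forall>s\<in>{a..b} - N. P s" by (auto simp: negligible_iff_null_sets)
  have "AE s in lebesgue. s \<in> {a..b} \<longrightarrow> P s" by (rule AE_I'[OF N(1)]) (use N(2) in auto)
  then show "AE s in lebesgue_on {a..b}. P s" by (subst AE_restrict_space_iff) auto
qed

lemma has_integral_Pair:
  fixes f :: "real \<Rightarrow> 'a::euclidean_space" and g :: "real \<Rightarrow> 'b::euclidean_space"
  assumes "(f has_integral x) A" "(g has_integral y) A"
  shows "((\<lambda>s. (f s, g s)) has_integral (x, y)) A"
proof -
  have "((\<lambda>s. (f s, 0::'b)) has_integral (x, 0)) A"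
    using has_integral_linear[OF assms(1) bounded_linear_Pair[OF bounded_linear_ident bounded_linear_zero]] by (simp add: o_def)
  moreover have "((\<lambda>s. (0::'a, g s)) has_integral (0, y)) A"
    using has_integral_linear[OF assms(2) bounded_linear_Pair[OF bounded_linear_zero bounded_linear_ident]] by (simp add: o_def)
  ultimately have "((\<lambda>s. (f s, 0) + (0, g s)) has_integral (x, 0) + (0, y)) A" by (rule has_integral_add)
  then show ?thesis by simp
qed

text \<open>The state components are y0, y, \<beta> and the accumulated running cost, in this order.
  The right-hand side depends on y alone, so the other three directions are cyclic.\<close>

definition augmented_field ::
  "(real^'n \<Rightarrow> real^'q \<Rightarrow> real^'n) \<Rightarrow> ('m::finite \<Rightarrow> real^'n \<Rightarrow> real^'n) \<Rightarrow>
   (real^'n \<Rightarrow> real^'q \<Rightarrow> real) \<Rightarrow> (real^'n \<Rightarrow> real \<Rightarrow> real^'m \<Rightarrow> real) \<Rightarrow>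
   real \<times> (real^'n) \<times> real \<times> real \<Rightarrow> real \<times> (real^'m) \<times> (real^'q) \<Rightarrow> real \<times> (real^'n) \<times> real \<times> real" where
  "augmented_field f g l0 l1h z u =
     (fst u, dyn f g (fst (snd z)) (fst u) (fst (snd u)) (snd (snd u)), norm (fst (snd u)),
      ell_e l0 l1h (fst (snd z)) (fst u) (fst (snd u)) (snd (snd u)))"

text \<open>Canonical values satisfy w0 + |w| = 1, so the box holds them together with their doubles
  and halves. The lower bound provides the positivity required of processes, the upper one
  compactness.\<close>

definition control_box :: "(real^'q) set \<Rightarrow> (real^'m) set \<Rightarrow> (real \<times> (real^'m) \<times> (real^'q)) set" where
  "control_box A C = {u. 0 \<le> fst u \<and> fst (snd u) \<in> C \<and> snd (snd u) \<in> A \<and>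
     1 / 2 \<le> fst u + norm (fst (snd u)) \<and> fst u + norm (fst (snd u)) \<le> 2}"

text \<open>The bounds are kept general for two uses: 1/2 and 2 for the needle values, and 1 and 1
  for the product of W and A.\<close>

lemma compact_control_slab:
  fixes A :: "(real^'q) set" and C :: "(real^'m::finite) set"
  assumes "compact A" "closed C"
  shows "compact {u. 0 \<le> fst u \<and> fst (snd u) \<in> C \<and> snd (snd u) \<in> A \<and>
     r \<le> fst u + norm (fst (snd u)) \<and> fst u + norm (fst (snd u)) \<le> R}" (is "compact ?U")
proof -
  have "compact ({0..R} \<times> cball (0::real^'m) R \<times> A)"
    by (intro compact_Times compact_cball compact_Icc assms)
  moreover have "?U \<subseteq> {0..R} \<times> cball 0 R \<times> A"
  proof
    fix u :: "real \<times> (real^'m) \<times> (real^'q)" assume u: "u \<in> ?U"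
    have "0 \<le> norm (fst (snd u))" "0 \<le> fst u" "fst u + norm (fst (snd u)) \<le> R" using u by auto
    then have "fst u \<le> R" "norm (fst (snd u)) \<le> R" by linarith+
    with u show "u \<in> {0..R} \<times> cball 0 R \<times> A" by (auto simp: mem_Times_iff)
  qed
  moreover have "closed ?U"
  proof -
    have 1: "closed {u :: real \<times> (real^'m) \<times> (real^'q). 0 \<le> fst u}" by (intro closed_Collect_le continuous_intros)
    have 2: "closed ((\<lambda>u :: real \<times> (real^'m) \<times> (real^'q). fst (snd u)) -` C)"
      by (intro continuous_closed_vimage assms continuous_intros)
    have 3: "closed ((\<lambda>u :: real \<times> (real^'m) \<times> (real^'q). snd (snd u)) -` A)"
      by (intro continuous_closed_vimage compact_imp_closed assms continuous_intros)
    have 4: "closed {u :: real \<times> (real^'m) \<times> (real^'q). r \<le> fst u + norm (fst (snd u))}"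
      by (intro closed_Collect_le continuous_intros)
    have 5: "closed {u :: real \<times> (real^'m) \<times> (real^'q). fst u + norm (fst (snd u)) \<le> R}"
      by (intro closed_Collect_le continuous_intros)
    have "?U = {u. 0 \<le> fst u} \<inter> ((\<lambda>u. fst (snd u)) -` C) \<inter> ((\<lambda>u. snd (snd u)) -` A) \<inter>
        {u. r \<le> fst u + norm (fst (snd u))} \<inter> {u. fst u + norm (fst (snd u)) \<le> R}" by auto
    also have "closed \<dots>" by (intro closed_Int 1 2 3 4 5)
    finally show ?thesis .
  qed
  ultimately show ?thesis by (meson bounded_subset compact_eq_bounded_closed)
qed

lemma compact_control_box: "compact A \<Longrightarrow> closed C \<Longrightarrow> compact (control_box A C)"
  unfolding control_box_def by (rule compact_control_slab)

text \<open>The state derivative factors through the y-component, which gives the last conclusion. A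
  general \<open>U\<close> makes continuity available on the full cone of controls as well as on the
  box.\<close>

lemma augmented_field_smooth:
  fixes f :: "real^'n \<Rightarrow> real^'q \<Rightarrow> real^'n" and g :: "'m::finite \<Rightarrow> real^'n \<Rightarrow> real^'n"
  assumes f: "cont_with_cont_dx f A" and g: "\<And>i. C1_map (g i)" and l0: "cont_with_cont_dx l0 A"
    and l1h: "cont_with_cont_dx (\<lambda>x (w0, w). l1h x w0 w) ({0..} \<times> C)"
    and U: "U \<subseteq> {u. 0 \<le> fst u \<and> fst (snd u) \<in> C \<and> snd (snd u) \<in> A}"
  obtains D where "continuous_on (UNIV \<times> U) (\<lambda>(z,u). augmented_field f g l0 l1h z u)"
    "\<forall>z. \<forall>u\<in>U. ((\<lambda>z. augmented_field f g l0 l1h z u) has_derivative blinfun_apply (D z u)) (at z)"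
    "continuous_on (UNIV \<times> U) (\<lambda>(z,u). D z u)"
    "\<forall>z u h. fst (snd h) = 0 \<longrightarrow> blinfun_apply (D z u) h = 0"
proof -
  obtain Df where fc: "continuous_on (UNIV \<times> A) (\<lambda>(x,a). f x a)"
    and fd: "\<And>x a. a \<in> A \<Longrightarrow> ((\<lambda>x. f x a) has_derivative blinfun_apply (Df x a)) (at x)"
    and Dfc: "continuous_on (UNIV \<times> A) (\<lambda>(x,a). Df x a)"
    using f unfolding cont_with_cont_dx_def by blast
  obtain D0 where l0c: "continuous_on (UNIV \<times> A) (\<lambda>(x,a). l0 x a)"
    and l0d: "\<And>x a. a \<in> A \<Longrightarrow> ((\<lambda>x. l0 x a) has_derivative blinfun_apply (D0 x a)) (at x)"
    and D0c: "continuous_on (UNIV \<times> A) (\<lambda>(x,a). D0 x a)"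
    using l0 unfolding cont_with_cont_dx_def by blast
  obtain D1 where l1c: "continuous_on (UNIV \<times> ({0..} \<times> C)) (\<lambda>(x,w). (\<lambda>x (w0, w). l1h x w0 w) x w)"
    and l1d: "\<And>x w. w \<in> {0..} \<times> C \<Longrightarrow> ((\<lambda>x. (\<lambda>x (w0, w). l1h x w0 w) x w) has_derivative blinfun_apply (D1 x w)) (at x)"
    and D1c: "continuous_on (UNIV \<times> ({0..} \<times> C)) (\<lambda>(x,w). D1 x w)"
    using l1h unfolding cont_with_cont_dx_def by blast
  have "\<forall>i. \<exists>D. (\<forall>x. (g i has_derivative blinfun_apply (D x)) (at x)) \<and> continuous_on UNIV D"
    using g unfolding C1_map_def by blast
  then obtain Dg where gd: "\<And>i x. (g i has_derivative blinfun_apply (Dg i x)) (at x)"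
    and Dgc: "\<And>i. continuous_on UNIV (Dg i)" by metis
  have gc: "continuous_on UNIV (g i)" for i
    using gd has_derivative_continuous by (metis continuous_at_imp_continuous_on)
  \<comment> \<open>\<open>Y\<close> extracts the y-component of an increment; \<open>E2\<close> and
    \<open>E4\<close> insert the resulting changes of y and of the cost. Building \<open>D\<close>
    by composition reduces its continuity to that of the given derivatives.\<close>
  define Y :: "(real \<times> (real^'n) \<times> real \<times> real) \<Rightarrow>\<^sub>L (real^'n)" where "Y = Blinfun (\<lambda>h. fst (snd h))"
  define E2 :: "(real^'n) \<Rightarrow>\<^sub>L (real \<times> (real^'n) \<times> real \<times> real)" where "E2 = Blinfun (\<lambda>y. (0, y, 0, 0))"
  define E4 :: "real \<Rightarrow>\<^sub>L (real \<times> (real^'n) \<times> real \<times> real)" where "E4 = Blinfun (\<lambda>c. (0, 0, 0, c))"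
  have Y: "blinfun_apply Y h = fst (snd h)" for h
    unfolding Y_def by (subst bounded_linear_Blinfun_apply) (auto intro!: bounded_linear_intros)
  have E2: "blinfun_apply E2 y = (0, y, 0, 0)" for y
    unfolding E2_def by (subst bounded_linear_Blinfun_apply) (auto intro!: bounded_linear_Pair bounded_linear_ident bounded_linear_zero)
  have E4: "blinfun_apply E4 c = (0, 0, 0, c)" for c
    unfolding E4_def by (subst bounded_linear_Blinfun_apply) (auto intro!: bounded_linear_Pair bounded_linear_ident bounded_linear_zero)
  define Ddyn where "Ddyn y u = fst u *\<^sub>R Df y (snd (snd u)) + (\<Sum>i\<in>UNIV. (fst (snd u) $ i) *\<^sub>R Dg i y)"
    for y and u :: "real \<times> (real^'m) \<times> (real^'q)"
  define Dell where "Dell y u = fst u *\<^sub>R D0 y (snd (snd u)) + D1 y (fst u, fst (snd u))"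
    for y and u :: "real \<times> (real^'m) \<times> (real^'q)"
  define D where "D z u = (E2 o\<^sub>L (Ddyn (fst (snd z)) u o\<^sub>L Y)) + (E4 o\<^sub>L (Dell (fst (snd z)) u o\<^sub>L Y))"
    for z :: "real \<times> (real^'n) \<times> real \<times> real" and u :: "real \<times> (real^'m) \<times> (real^'q)"
  have cU: "continuous_on ((UNIV :: (real \<times> (real^'n) \<times> real \<times> real) set) \<times> U) (\<lambda>p. h (fst (snd (fst p))) (snd (snd (snd p))))"
    if "continuous_on (UNIV \<times> A) (\<lambda>(x,a). h x a)" for h :: "real^'n \<Rightarrow> real^'q \<Rightarrow> 'x::topological_space"
  proof -
    have "continuous_on ((UNIV :: (real \<times> (real^'n) \<times> real \<times> real) set) \<times> U)
        (\<lambda>p. (\<lambda>(x,a). h x a) (fst (snd (fst p)), snd (snd (snd p))))"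
      by (rule continuous_on_compose2[OF that]) (use U in \<open>auto intro!: continuous_intros\<close>)
    then show ?thesis by simp
  qed
  have cV: "continuous_on ((UNIV :: (real \<times> (real^'n) \<times> real \<times> real) set) \<times> U) (\<lambda>p. h (fst (snd (fst p))) (fst (snd p), fst (snd (snd p))))"
    if "continuous_on (UNIV \<times> ({0..} \<times> C)) (\<lambda>(x,w). h x w)" for h :: "real^'n \<Rightarrow> real \<times> (real^'m) \<Rightarrow> 'x::topological_space"
  proof -
    have "continuous_on ((UNIV :: (real \<times> (real^'n) \<times> real \<times> real) set) \<times> U)
        (\<lambda>p. (\<lambda>(x,w). h x w) (fst (snd (fst p)), (fst (snd p), fst (snd (snd p)))))"
      by (rule continuous_on_compose2[OF that]) (use U in \<open>auto intro!: continuous_intros\<close>)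
    then show ?thesis by simp
  qed
  have cg: "continuous_on ((UNIV :: (real \<times> (real^'n) \<times> real \<times> real) set) \<times> U) (\<lambda>p. h (fst (snd (fst p))))"
    if "continuous_on UNIV h" for h :: "real^'n \<Rightarrow> 'x::topological_space"
    by (rule continuous_on_compose2[OF that, where s="(UNIV :: (real \<times> (real^'n) \<times> real \<times> real) set) \<times> U"])
      (auto intro!: continuous_intros)
  have ccoord: "continuous_on (UNIV \<times> U) (\<lambda>p. fst (snd (snd p)) $ i)" for i
    by (intro continuous_intros)
  show ?thesis
  proof (rule that[of D])
    have "continuous_on (UNIV \<times> U) (\<lambda>p. augmented_field f g l0 l1h (fst p) (snd p))"
      unfolding augmented_field_def dyn_def ell_e_def
      by (intro continuous_on_Pair continuous_on_add continuous_on_sum continuous_on_scaleR continuous_on_mult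
          continuous_on_norm ccoord cU[OF fc] cU[OF l0c] cg[OF gc] cV[OF l1c, simplified])
        (intro continuous_intros)+
    then show "continuous_on (UNIV \<times> U) (\<lambda>(z,u). augmented_field f g l0 l1h z u)" by (simp add: case_prod_unfold)
    have "continuous_on (UNIV \<times> U) (\<lambda>p. D (fst p) (snd p))"
      unfolding D_def Ddyn_def Dell_def
      by (intro continuous_on_add bounded_bilinear.continuous_on[OF bounded_bilinear_blinfun_compose]
          continuous_on_sum continuous_on_scaleR continuous_on_const
          ccoord cU[OF Dfc] cU[OF D0c] cg[OF Dgc] cV[OF D1c])
        (intro continuous_intros)+
    then show "continuous_on (UNIV \<times> U) (\<lambda>(z,u). D z u)" by (simp add: case_prod_unfold)
    show "\<forall>z u h. fst (snd h) = 0 \<longrightarrow> blinfun_apply (D z u) h = 0"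
      by (simp add: D_def blinfun.add_left Y E2 E4 zero_prod_def)
    show "\<forall>z. \<forall>u\<in>U. ((\<lambda>z. augmented_field f g l0 l1h z u) has_derivative blinfun_apply (D z u)) (at z)"
    proof (intro allI ballI)
      fix z :: "real \<times> (real^'n) \<times> real \<times> real" and u assume u: "u \<in> U"
      define y where "y = fst (snd z)"
      have uA: "snd (snd u) \<in> A" and uw: "(fst u, fst (snd u)) \<in> {0..} \<times> C" using u U by auto
      have dd: "((\<lambda>y. dyn f g y (fst u) (fst (snd u)) (snd (snd u))) has_derivative blinfun_apply (Ddyn y u)) (at y)"
      proof -
        have "((\<lambda>y. fst u *\<^sub>R f y (snd (snd u)) + (\<Sum>i\<in>UNIV. (fst (snd u) $ i) *\<^sub>R g i y)) has_derivative
          (\<lambda>h. fst u *\<^sub>R blinfun_apply (Df y (snd (snd u))) h + (\<Sum>i\<in>UNIV. (fst (snd u) $ i) *\<^sub>R blinfun_apply (Dg i y) h))) (at y)"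
          by (intro has_derivative_add has_derivative_sum has_derivative_scaleR_right fd[OF uA] gd)
        then show ?thesis
          unfolding dyn_def Ddyn_def 
          by (rule has_derivative_subst) (simp add: fun_eq_iff blinfun.add_left blinfun.sum_left blinfun.scaleR_left)
      qed
      have de: "((\<lambda>y. ell_e l0 l1h y (fst u) (fst (snd u)) (snd (snd u))) has_derivative blinfun_apply (Dell y u)) (at y)"
      proof -
        have "((\<lambda>y. l0 y (snd (snd u)) * fst u + l1h y (fst u) (fst (snd u))) has_derivative
          (\<lambda>h. blinfun_apply (D0 y (snd (snd u))) h * fst u + blinfun_apply (D1 y (fst u, fst (snd u))) h)) (at y)"
          by (intro has_derivative_add has_derivative_mult_left l0d[OF uA] l1d[OF uw, simplified])
        then show ?thesis
          unfolding ell_e_def Dell_def 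
          by (rule has_derivative_subst) (simp add: fun_eq_iff blinfun.add_left blinfun.scaleR_left mult.commute)
      qed
      have ys: "((\<lambda>z :: real \<times> (real^'n) \<times> real \<times> real. fst (snd z)) has_derivative (\<lambda>h. fst (snd h))) (at z)"
        by (intro bounded_linear_imp_has_derivative bounded_linear_intros)
      have "((\<lambda>z. augmented_field f g l0 l1h z u) has_derivative
          (\<lambda>h. (0, blinfun_apply (Ddyn y u) (fst (snd h)), 0, blinfun_apply (Dell y u) (fst (snd h))))) (at z)"
        unfolding augmented_field_def
        by (intro has_derivative_Pair has_derivative_const
            has_derivative_compose[OF ys, where g="\<lambda>y. dyn f g y (fst u) (fst (snd u)) (snd (snd u))"]
            has_derivative_compose[OF ys, where g="\<lambda>y. ell_e l0 l1h y (fst u) (fst (snd u)) (snd (snd u))"])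
          (use dd de in \<open>simp_all add: y_def\<close>)
      then show "((\<lambda>z. augmented_field f g l0 l1h z u) has_derivative blinfun_apply (D z u)) (at z)"
        by (rule has_derivative_subst) (simp add: fun_eq_iff D_def blinfun.add_left Y E2 E4 y_def)
    qed
  qed
qed

text \<open>Substitute \<open>c * r\<close> for \<open>r\<close> in the defining limit. Uniqueness
  of limits applies because \<open>w0\<close> is a limit point of the positive reals, also when
  \<open>w0 = 0\<close>.\<close>

lemma recession_homogeneous:
  fixes l1 :: "'x \<Rightarrow> 'w::real_normed_vector \<Rightarrow> real"
  assumes lim: "\<And>w0 w. w0 \<ge> 0 \<and> w \<in> C \<Longrightarrow>
        ((\<lambda>r. r * l1 x ((1 / r) *\<^sub>R w)) \<longlongrightarrow> l1h x w0 w) (at w0 within {0<..})"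
    and "pcone C" "w0 \<ge> 0" "w \<in> C" "c > 0"
  shows "l1h x (c * w0) (c *\<^sub>R w) = c * l1h x w0 w"
proof -
  have "c *\<^sub>R w \<in> C" using assms by (simp add: pcone_def)
  then have 1: "((\<lambda>r. r * l1 x ((1 / r) *\<^sub>R (c *\<^sub>R w))) \<longlongrightarrow> l1h x (c * w0) (c *\<^sub>R w)) (at (c * w0) within {0<..})"
    using assms by (intro lim) auto
  have "filterlim (\<lambda>r. c * r) (at (c * w0) within {0<..}) (at w0 within {0<..})"
    unfolding filterlim_at
  proof
    show "\<forall>\<^sub>F r in at w0 within {0<..}. c * r \<in> {0<..} \<and> c * r \<noteq> c * w0"
      using \<open>c > 0\<close> by (simp add: eventually_at_filter)
    show "((\<lambda>r. c * r) \<longlongrightarrow> c * w0) (at w0 within {0<..})" by (intro tendsto_intros)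
  qed
  from filterlim_compose[OF 1 this]
  have "((\<lambda>r. c * r * l1 x ((1 / (c * r)) *\<^sub>R (c *\<^sub>R w))) \<longlongrightarrow> l1h x (c * w0) (c *\<^sub>R w)) (at w0 within {0<..})" .
  moreover have "c * r * l1 x ((1 / (c * r)) *\<^sub>R (c *\<^sub>R w)) = c * (r * l1 x ((1 / r) *\<^sub>R w))" for r
    using \<open>c > 0\<close> by simp
  ultimately have "((\<lambda>r. c * (r * l1 x ((1 / r) *\<^sub>R w))) \<longlongrightarrow> l1h x (c * w0) (c *\<^sub>R w)) (at w0 within {0<..})"
    by (simp only:)
  moreover have "((\<lambda>r. c * (r * l1 x ((1 / r) *\<^sub>R w))) \<longlongrightarrow> c * l1h x w0 w) (at w0 within {0<..})"
    using assms by (intro tendsto_intros lim) auto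
  moreover have "at w0 within {0<..} \<noteq> bot"
  proof -
    have "w0 islimpt {0<..}"
      unfolding islimpt_approachable
    proof (intro allI impI)
      fix e :: real assume "e > 0"
      then show "\<exists>x'\<in>{0<..}. x' \<noteq> w0 \<and> dist x' w0 < e"
        using \<open>w0 \<ge> 0\<close> by (intro bexI[of _ "w0 + e / 2"]) (auto simp: dist_real_def)
    qed
    then show ?thesis by (simp add: trivial_limit_within)
  qed
  ultimately show ?thesis by (intro tendsto_unique)
qed

text \<open>Sums of closed sets can fail to be closed. Here the summands live on complementary
  coordinates, so the sum is the intersection of the preimages of \<open>C1\<close> and
  \<open>C2\<close> under the two coordinate projections.\<close>

lemma closed_cone_split_sum:
  fixes C1 C2 :: "(real^'m::finite) set"
  assumes "closed C1" "closed C2" "\<forall>u\<in>C1. \<forall>i. i \<notin> I \<longrightarrow> u $ i = 0" "\<forall>v\<in>C2. \<forall>i\<in>I. v $ i = 0"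
  shows "closed {u + v | u v. u \<in> C1 \<and> v \<in> C2}"
proof -
  define P1 where "P1 w = (\<chi> i. if i \<in> I then w $ i else 0)" for w :: "real^'m"
  define P2 where "P2 w = (\<chi> i. if i \<in> I then 0 else w $ i)" for w :: "real^'m"
  have c: "continuous_on UNIV P1" "continuous_on UNIV P2"
    unfolding P1_def P2_def
    by (intro continuous_on_vec_lambda; rename_tac i; case_tac "i \<in> I"; simp add: continuous_on_component)+
  have "{u + v | u v. u \<in> C1 \<and> v \<in> C2} = P1 -` C1 \<inter> P2 -` C2"
  proof (intro equalityI subsetI)
    fix w assume "w \<in> {u + v | u v. u \<in> C1 \<and> v \<in> C2}"
    then obtain u v where "w = u + v" "u \<in> C1" "v \<in> C2" by blast
    moreover from this have "P1 w = u" "P2 w = v"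
      using assms(3,4) by (auto simp: P1_def P2_def vec_eq_iff)
    ultimately show "w \<in> P1 -` C1 \<inter> P2 -` C2" by simp
  next
    fix w assume w: "w \<in> P1 -` C1 \<inter> P2 -` C2"
    have "w = P1 w + P2 w" by (auto simp: P1_def P2_def vec_eq_iff)
    then show "w \<in> {u + v | u v. u \<in> C1 \<and> v \<in> C2}" using w by blast
  qed
  also have "closed \<dots>"
    using c assms(1,2) by (intro closed_Int continuous_closed_vimage) (auto simp: continuous_on_eq_continuous_at)
  finally show ?thesis .
qed

lemma closed_pcone_contains_0:
  fixes C :: "'a::real_normed_vector set"
  assumes "closed C" "pcone C" "x \<in> C"
  shows "0 \<in> C"
proof -
  have "(\<lambda>n. (1 / real (Suc n)) *\<^sub>R x) \<longlonglongrightarrow> 0 *\<^sub>R x"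
    by (intro tendsto_scaleR tendsto_const LIMSEQ_Suc lim_1_over_n)
  moreover have "(1 / real (Suc n)) *\<^sub>R x \<in> C" for n using assms(2,3) by (simp add: pcone_def)
  ultimately show ?thesis using closed_sequentially[OF assms(1)] by fastforce
qed

section \<open>Passing absolute continuity and measurability along\<close>

lemma norm_fst_bound: "norm (fst p) \<le> norm p"
  using norm_fst_le[of "fst p" "snd p"] by simp

lemma norm_snd_bound: "norm (snd p) \<le> norm p"
  using norm_snd_le[of "snd p" "fst p"] by simp

lemma AC_on_subinterval:
  assumes "AC_on a b h" "b' \<le> b"
  shows "AC_on a b' h"
  unfolding AC_on_def
proof (intro allI impI)
  fix e :: real assume "e > 0"
  then obtain d where "d > 0" and d: "\<forall>I. finite I \<longrightarrow> (\<forall>(u,v)\<in>I. a \<le> u \<and> u \<le> v \<and> v \<le> b) \<longrightarrow>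
      (\<forall>(u,v)\<in>I. \<forall>(u',v')\<in>I. (u,v) \<noteq> (u',v') \<longrightarrow> {u<..<v} \<inter> {u'<..<v'} = {}) \<longrightarrow>
      (\<Sum>(u,v)\<in>I. v - u) < d \<longrightarrow> (\<Sum>(u,v)\<in>I. norm (h v - h u)) < e"
    using assms(1)[unfolded AC_on_def, THEN spec, of e] by (elim impE exE conjE)
  show "\<exists>d>0. \<forall>I. finite I \<longrightarrow> (\<forall>(u,v)\<in>I. a \<le> u \<and> u \<le> v \<and> v \<le> b') \<longrightarrow>
      (\<forall>(u,v)\<in>I. \<forall>(u',v')\<in>I. (u,v) \<noteq> (u',v') \<longrightarrow> {u<..<v} \<inter> {u'<..<v'} = {}) \<longrightarrow>
      (\<Sum>(u,v)\<in>I. v - u) < d \<longrightarrow> (\<Sum>(u,v)\<in>I. norm (h v - h u)) < e"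
  proof (rule exI[of _ d], intro conjI allI impI)
    fix I :: "(real \<times> real) set"
    assume I: "finite I" and b': "\<forall>(u,v)\<in>I. a \<le> u \<and> u \<le> v \<and> v \<le> b'"
      and dj: "\<forall>(u,v)\<in>I. \<forall>(u',v')\<in>I. (u,v) \<noteq> (u',v') \<longrightarrow> {u<..<v} \<inter> {u'<..<v'} = {}"
      and sm: "(\<Sum>(u,v)\<in>I. v - u) < d"
    have "\<forall>(u,v)\<in>I. a \<le> u \<and> u \<le> v \<and> v \<le> b" using b' \<open>b' \<le> b\<close> by force
    from d[THEN spec, THEN mp, OF I, THEN mp, OF this, THEN mp, OF dj, THEN mp, OF sm]
    show "(\<Sum>(u,v)\<in>I. norm (h v - h u)) < e" .
  qed (rule \<open>d > 0\<close>)
qed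

text \<open>Serves to hand absolute continuity from the full costate to its component
  \<open>p\<close>.\<close>

lemma AC_on_dominated:
  assumes "AC_on a b h" and le: "\<And>u v. norm (k v - k u) \<le> norm (h v - h u)"
  shows "AC_on a b k"
  unfolding AC_on_def
proof (intro allI impI)
  fix e :: real assume "e > 0"
  then obtain d where d: "d > 0" "\<forall>I. finite I \<longrightarrow> (\<forall>(u,v)\<in>I. a \<le> u \<and> u \<le> v \<and> v \<le> b) \<longrightarrow>
      (\<forall>(u,v)\<in>I. \<forall>(u',v')\<in>I. (u,v) \<noteq> (u',v') \<longrightarrow> {u<..<v} \<inter> {u'<..<v'} = {}) \<longrightarrow>
      (\<Sum>(u,v)\<in>I. v - u) < d \<longrightarrow> (\<Sum>(u,v)\<in>I. norm (h v - h u)) < e"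
    using assms(1)[unfolded AC_on_def, THEN spec, of e] by (elim impE exE conjE)
  have sum_le: "(\<Sum>(u,v)\<in>I. norm (k v - k u)) \<le> (\<Sum>(u,v)\<in>I. norm (h v - h u))" for I
    by (rule sum_mono) (use le in auto)
  show "\<exists>d>0. \<forall>I. finite I \<longrightarrow> (\<forall>(u,v)\<in>I. a \<le> u \<and> u \<le> v \<and> v \<le> b) \<longrightarrow>
      (\<forall>(u,v)\<in>I. \<forall>(u',v')\<in>I. (u,v) \<noteq> (u',v') \<longrightarrow> {u<..<v} \<inter> {u'<..<v'} = {}) \<longrightarrow>
      (\<Sum>(u,v)\<in>I. v - u) < d \<longrightarrow> (\<Sum>(u,v)\<in>I. norm (k v - k u)) < e"
    by (rule exI[of _ d], intro conjI allI impI, rule d(1), rule le_less_trans[OF sum_le],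
        rule d(2)[THEN spec, THEN mp, THEN mp, THEN mp, THEN mp])
qed

lemma borel_measurable_lebesgue_on_AE:
  fixes h k :: "real \<Rightarrow> 'a::euclidean_space"
  assumes h: "h \<in> borel_measurable (lebesgue_on {a..b})" and ae: "AE s in lebesgue_on {a..b}. h s = k s"
  shows "k \<in> borel_measurable (lebesgue_on {a..b})"
proof -
  have "(\<lambda>x. if x \<in> {a..b} then h x else 0) \<in> borel_measurable lebesgue"
    using h by (subst borel_measurable_if) auto
  moreover have "AE x in lebesgue. x \<in> {a..b} \<longrightarrow> h x = k x"
    using ae by (subst (asm) AE_restrict_space_iff) auto
  then have "AE x in lebesgue. (if x \<in> {a..b} then h x else 0) = (if x \<in> {a..b} then k x else 0)"
    by eventually_elim simp
  ultimately have "(\<lambda>x. if x \<in> {a..b} then k x else 0) \<in> borel_measurable lebesgue"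
    by (rule borel_measurable_AE)
  then show ?thesis by (subst (asm) borel_measurable_if) auto
qed

lemma AC_on_has_integral:
  fixes F :: "real \<Rightarrow> 'a::banach"
  assumes AC: "AC_on 0 S F" and N: "negligible N" and t: "t \<in> {0..S}"
    and der: "\<And>x. x \<in> {0..S} - N \<Longrightarrow> (F has_vector_derivative h x) (at x within {0..S})"
  shows "(h has_integral (F t - F 0)) {0..t}"
proof (rule fundamental_theorem_of_calculus_AC[OF _ AC_on_subinterval[OF AC] N])
  show "0 \<le> t" "t \<le> S" using t by auto
  show "(F has_vector_derivative h x) (at x within {0..t})" if "x \<in> {0..t} - N" for x
    by (rule has_vector_derivative_within_subset[OF der]) (use that t in auto)
qed

section \<open>Space-time processes as trajectories of the augmented system\<close>

locale space_time =
  fixes T :: "(real \<times> (real^'n)) set" and A :: "(real^'q) set"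
    and I1 :: "'m::finite set" and C1 C2 C :: "(real^'m) set"
    and f :: "real^'n \<Rightarrow> real^'q \<Rightarrow> real^'n" and g :: "'m \<Rightarrow> real^'n \<Rightarrow> real^'n"
    and l0 :: "real^'n \<Rightarrow> real^'q \<Rightarrow> real" and l1 :: "real^'n \<Rightarrow> real^'m \<Rightarrow> real"
    and l1h :: "real^'n \<Rightarrow> real \<Rightarrow> real^'m \<Rightarrow> real"
    and Psi :: "real \<times> (real^'n) \<Rightarrow> real"
  assumes hyps: "standing_hyps T A I1 C1 C2 C f g l0 l1 l1h Psi"
begin

abbreviation X where "X \<equiv> augmented_field f g l0 l1h"
abbreviation U where "U \<equiv> control_box A C"

lemma compact_A: "compact A" and f_smooth: "cont_with_cont_dx f A" and g_smooth: "C1_map (g i)"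
  and l0_smooth: "cont_with_cont_dx l0 A"
  and l1h_smooth: "cont_with_cont_dx (\<lambda>x (w0, w). l1h x w0 w) ({0..} \<times> C)" and Psi_smooth: "C1_map Psi"
  using hyps unfolding standing_hyps_def by - (elim conjE, simp)+

lemma closed_C: "closed C"
proof -
  have "closed {u + v | u v. u \<in> C1 \<and> v \<in> C2}"
    using hyps unfolding standing_hyps_def by (elim conjE) (rule closed_cone_split_sum)
  then show ?thesis using hyps unfolding standing_hyps_def by (elim conjE) simp
qed

lemma pcone_C: "pcone C"
proof -
  have C: "C = {u + v | u v. u \<in> C1 \<and> v \<in> C2}" and p: "pcone C1" "pcone C2"
    using hyps unfolding standing_hyps_def by - (elim conjE, assumption)+
  show ?thesis
    unfolding pcone_def
  proof (intro ballI allI impI)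
    fix x and c :: real assume "x \<in> C" "c > 0"
    then obtain u v where uv: "x = u + v" "u \<in> C1" "v \<in> C2" unfolding C by blast
    then have "c *\<^sub>R u \<in> C1" "c *\<^sub>R v \<in> C2" using p \<open>c > 0\<close> by (auto simp: pcone_def)
    then show "c *\<^sub>R x \<in> C" unfolding C using uv by (auto simp: scaleR_add_right)
  qed
qed

lemma compact_U: "compact U"
  by (rule compact_control_box[OF compact_A closed_C])

lemma U_subset: "U \<subseteq> {u. 0 \<le> fst u \<and> fst (snd u) \<in> C \<and> snd (snd u) \<in> A}"
  by (auto simp: control_box_def)

lemma recession_limit: "\<forall>x w0 w. w0 \<ge> 0 \<and> w \<in> C \<longrightarrow>
    ((\<lambda>r. r * l1 x ((1 / r) *\<^sub>R w)) \<longlongrightarrow> l1h x w0 w) (at w0 within {0<..})"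
  using hyps unfolding standing_hyps_def by (elim conjE)

lemma X_homogeneous:
  assumes "c > 0" "w0 \<ge> 0" "w \<in> C"
  shows "X z (c * w0, c *\<^sub>R w, a) = c *\<^sub>R X z (w0, w, a)"
proof -
  have "((\<lambda>r. r * l1 x ((1 / r) *\<^sub>R w)) \<longlongrightarrow> l1h x w0 w) (at w0 within {0<..})" if "w0 \<ge> 0 \<and> w \<in> C" for x w0 w
    by (rule recession_limit[rule_format, OF that])
  from recession_homogeneous[OF this pcone_C assms(2,3,1)]
  have 1: "l1h (fst (snd z)) (c * w0) (c *\<^sub>R w) = c * l1h (fst (snd z)) w0 w" .
  have "ell_e l0 l1h (fst (snd z)) (c * w0) (c *\<^sub>R w) a = c * ell_e l0 l1h (fst (snd z)) w0 w a"
    unfolding ell_e_def 1 by (simp add: distrib_left)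
  moreover have "dyn f g (fst (snd z)) (c * w0) (c *\<^sub>R w) a = c *\<^sub>R dyn f g (fst (snd z)) w0 w a"
    unfolding dyn_def by (simp add: scaleR_add_right scaleR_sum_right)
  ultimately show ?thesis using assms(1) by (simp add: augmented_field_def)
qed

lemma X_continuous: "continuous_on (UNIV \<times> {u. 0 \<le> fst u \<and> fst (snd u) \<in> C \<and> snd (snd u) \<in> A}) (\<lambda>(z,u). X z u)"
  by (rule augmented_field_smooth[OF f_smooth g_smooth l0_smooth l1h_smooth subset_refl])

lemma X_field_facts:
  fixes S :: real
  assumes \<omega>: "\<omega> \<in> borel_measurable (lebesgue_on {0..S})" "\<omega> \<in> {0..S} \<rightarrow> U" and z: "continuous_on {0..S} z"
  shows "(\<lambda>s. X (z s) (\<omega> s)) \<in> borel_measurable (lebesgue_on {0..S})"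
    "\<exists>B. \<forall>s\<in>{0..S}. norm (X (z s) (\<omega> s)) \<le> B"
    "(\<lambda>s. X (z s) (\<omega> s)) integrable_on {0..S}"
proof -
  have Xc: "continuous_on (UNIV \<times> U) (\<lambda>(z,u). X z u)"
    by (rule continuous_on_subset[OF X_continuous]) (use U_subset in auto)
  show m: "(\<lambda>s. X (z s) (\<omega> s)) \<in> borel_measurable (lebesgue_on {0..S})"
    by (rule borel_measurable_continuous_on_pair[OF Xc z \<omega>])
  have comp: "compact ((\<lambda>(z,u). X z u) ` (z ` {0..S} \<times> U))"
    by (intro compact_continuous_image compact_Times compact_U z compact_Icc continuous_on_subset[OF Xc]) auto
  obtain B where im: "\<forall>x\<in>(\<lambda>(z,u). X z u) ` (z ` {0..S} \<times> U). norm x \<le> B"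
    using bounded_iff[THEN iffD1, OF compact_imp_bounded[OF comp]] by (elim exE)
  have B: "norm (X (z s) (\<omega> s)) \<le> B" if "s \<in> {0..S}" for s
  proof -
    have "(z s, \<omega> s) \<in> z ` {0..S} \<times> U" using that funcset_mem[OF \<omega>(2) that] by blast
    then have "(\<lambda>(z,u). X z u) (z s, \<omega> s) \<in> (\<lambda>(z,u). X z u) ` (z ` {0..S} \<times> U)" by (rule imageI)
    from bspec[OF im this] show ?thesis by simp
  qed
  show "\<exists>B. \<forall>s\<in>{0..S}. norm (X (z s) (\<omega> s)) \<le> B" by (intro exI[of _ B] ballI B)
  show "(\<lambda>s. X (z s) (\<omega> s)) integrable_on {0..S}"
    by (rule bounded_measurable_integrable_on[OF m B])
qed

text \<open>The cost is a Lebesgue integral, the fourth state component a gauge integral;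
  boundedness of the field on the compact control box makes the two agree.\<close>

lemma running_cost_eq:
  fixes S :: real
  assumes \<omega>: "\<omega> \<in> borel_measurable (lebesgue_on {0..S})" "\<omega> \<in> {0..S} \<rightarrow> U" and z: "continuous_on {0..S} z"
  shows "integral\<^sup>L (lebesgue_on {0..S}) (\<lambda>s. ell_e l0 l1h (fst (snd (z s))) (fst (\<omega> s)) (fst (snd (\<omega> s))) (snd (snd (\<omega> s))))
    = snd (snd (snd (integral {0..S} (\<lambda>s. X (z s) (\<omega> s)))))"
proof -
  have bl: "bounded_linear (\<lambda>x :: real \<times> (real^'n) \<times> real \<times> real. snd (snd (snd x)))"
    by (intro bounded_linear_intros)
  define h where "h s = snd (snd (snd (X (z s) (\<omega> s))))" for s
  have h: "h = (\<lambda>s. ell_e l0 l1h (fst (snd (z s))) (fst (\<omega> s)) (fst (snd (\<omega> s))) (snd (snd (\<omega> s))))"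
    by (simp add: h_def augmented_field_def fun_eq_iff)
  note facts = X_field_facts[OF assms]
  obtain B where B: "\<forall>s\<in>{0..S}. norm (X (z s) (\<omega> s)) \<le> B" using facts(2) by blast
  have "integrable (lebesgue_on {0..S}) h"
  proof (rule measurable_bounded_by_integrable_imp_lebesgue_integrable)
    show "h \<in> borel_measurable (lebesgue_on {0..S})"
      unfolding h_def by (rule borel_measurable_continuous_on[OF linear_continuous_on[OF bl] facts(1)])
    show "integrable (lebesgue_on {0..S}) (\<lambda>_. B)"
      by (intro finite_measure.integrable_const finite_measure_lebesgue_on) auto
    fix s assume "s \<in> {0..S}"
    have "norm (h s) \<le> norm (snd (snd (X (z s) (\<omega> s))))" unfolding h_def by (rule norm_snd_bound)
    also have "\<dots> \<le> norm (snd (X (z s) (\<omega> s)))" by (rule norm_snd_bound)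
    also have "\<dots> \<le> norm (X (z s) (\<omega> s))" by (rule norm_snd_bound)
    finally show "norm (h s) \<le> B" using B \<open>s \<in> {0..S}\<close> by fastforce
  qed simp
  then have "integral\<^sup>L (lebesgue_on {0..S}) h = integral {0..S} h"
    by (rule lebesgue_integral_eq_integral) simp
  also have "\<dots> = snd (snd (snd (integral {0..S} (\<lambda>s. X (z s) (\<omega> s)))))"
    using integral_linear[OF facts(3) bl] unfolding h_def[abs_def] o_def .
  finally show ?thesis by (simp add: h)
qed

text \<open>Turns trajectories built with needles into competitors for the minimisation. The lower
  bound 1/2 of the box provides the essential positivity, and boundedness of the field provides
  absolute continuity.\<close>

lemma trajectory_is_process:
  assumes "0 < S" and \<omega>: "\<omega> \<in> borel_measurable (lebesgue_on {0..S})" "\<omega> \<in> {0..S} \<rightarrow> U"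
    and z: "continuous_on {0..S} z" "\<And>t. t \<in> {0..S} \<Longrightarrow> z t = (0, xc, 0, 0) + integral {0..t} (\<lambda>s. X (z s) (\<omega> s))"
  shows "st_process f g xc A C S (\<lambda>s. fst (\<omega> s)) (\<lambda>s. fst (snd (\<omega> s))) (\<lambda>s. snd (snd (\<omega> s)))
    (\<lambda>s. fst (z s)) (\<lambda>s. fst (snd (z s))) (\<lambda>s. fst (snd (snd (z s))))"
proof -
  note facts = X_field_facts[OF \<omega> z(1)]
  obtain B where B: "\<forall>s\<in>{0..S}. norm (X (z s) (\<omega> s)) \<le> B" using facts(2) by blast
  have lip: "norm (z t - z s) \<le> B * (t - s)" if "0 \<le> s" "s \<le> t" "t \<le> S" for s t
  proof -
    have "norm (integral {0..t} (\<lambda>s. X (z s) (\<omega> s)) - integral {0..s} (\<lambda>s. X (z s) (\<omega> s))) \<le> B * (t - s)"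
      by (rule indefinite_integral_Lipschitz[OF facts(3) B[rule_format] that])
    then show ?thesis using z(2)[of s] z(2)[of t] that by simp
  qed
  have 0: "z 0 = (0, xc, 0, 0)" using z(2)[of 0] \<open>0 < S\<close> by simp
  obtain N where N: "negligible N" "\<And>x. x \<in> {0..S} - N \<Longrightarrow>
      ((\<lambda>t. integral {0..t} (\<lambda>s. X (z s) (\<omega> s))) has_vector_derivative X (z x) (\<omega> x)) (at x within {0..S})"
    using indefinite_integral_has_vector_derivative_AE[OF facts(3)] by blast
  have z': "(z has_vector_derivative X (z t) (\<omega> t)) (at t within {0..S})" if t: "t \<in> {0..S} - N" for t
  proof -
    have "((\<lambda>t. (0, xc, 0, 0) + integral {0..t} (\<lambda>s. X (z s) (\<omega> s))) has_vector_derivative X (z t) (\<omega> t)) (at t within {0..S})"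
      using has_vector_derivative_add[OF has_vector_derivative_const N(2)[OF t], of "(0, xc, 0, 0)"] by simp
    from has_vector_derivative_transform[OF _ z(2) this] t show ?thesis by simp
  qed
  have Us: "0 \<le> fst (\<omega> s)" "fst (snd (\<omega> s)) \<in> C" "snd (snd (\<omega> s)) \<in> A"
      "1 / 2 \<le> fst (\<omega> s) + norm (fst (snd (\<omega> s)))" "fst (\<omega> s) + norm (fst (snd (\<omega> s))) \<le> 2" if "s \<in> {0..S}" for s
    using funcset_mem[OF \<omega>(2) that] by (auto simp: control_box_def)
  obtain BA where BA: "\<forall>a\<in>A. norm a \<le> BA" using compact_imp_bounded[OF compact_A] unfolding bounded_iff by blast
  have all_AE: "AE s in lebesgue_on {0..S}. P s" if "\<And>s. s \<in> {0..S} \<Longrightarrow> P s" for P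
    unfolding AE_lebesgue_on_iff_negligible using that by (intro exI[of _ "{}"]) auto
  show ?thesis
    unfolding st_process_def
  proof (intro conjI)
    show "(\<lambda>s. fst (\<omega> s)) \<in> borel_measurable (lebesgue_on {0..S})"
      "(\<lambda>s. fst (snd (\<omega> s))) \<in> borel_measurable (lebesgue_on {0..S})"
      "(\<lambda>s. snd (snd (\<omega> s))) \<in> borel_measurable (lebesgue_on {0..S})"
      by (rule borel_measurable_continuous_on[OF _ \<omega>(1)], intro continuous_intros)+
    show "\<exists>B. AE s in lebesgue_on {0..S}. \<bar>fst (\<omega> s)\<bar> \<le> B \<and> norm (fst (snd (\<omega> s))) \<le> B \<and> norm (snd (snd (\<omega> s))) \<le> B"
    proof (intro exI[of _ "\<bar>BA\<bar> + 2"] all_AE)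
      fix s assume s: "s \<in> {0..S}"
      note u = Us[OF s]
      have "norm (snd (snd (\<omega> s))) \<le> BA" using BA u(3) by blast
      moreover have "0 \<le> norm (fst (snd (\<omega> s)))" by simp
      ultimately show "\<bar>fst (\<omega> s)\<bar> \<le> \<bar>BA\<bar> + 2 \<and> norm (fst (snd (\<omega> s))) \<le> \<bar>BA\<bar> + 2 \<and> norm (snd (snd (\<omega> s))) \<le> \<bar>BA\<bar> + 2"
        using u(1,5) by linarith
    qed
    show "AE s in lebesgue_on {0..S}. 0 \<le> fst (\<omega> s) \<and> fst (snd (\<omega> s)) \<in> C \<and> snd (snd (\<omega> s)) \<in> A"
      using Us by (intro all_AE) blast
    show "\<exists>c>0. AE s in lebesgue_on {0..S}. c \<le> fst (\<omega> s) + norm (fst (snd (\<omega> s)))"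
      using Us(4) by (intro exI[of _ "1/2"] conjI all_AE) auto
    show "AC_on 0 S (\<lambda>s. fst (z s))"
      by (rule Lipschitz_imp_AC_on[OF order_trans[OF _ lip]]) (simp only: fst_diff[symmetric] norm_fst_bound)
    show "AC_on 0 S (\<lambda>s. fst (snd (z s)))"
      by (rule Lipschitz_imp_AC_on[OF order_trans[OF _ lip]])
        (simp only: fst_diff[symmetric] snd_diff[symmetric] order_trans[OF norm_fst_bound norm_snd_bound])
    show "AC_on 0 S (\<lambda>s. fst (snd (snd (z s))))"
      by (rule Lipschitz_imp_AC_on[OF order_trans[OF _ lip]])
        (simp only: fst_diff[symmetric] snd_diff[symmetric] order_trans[OF norm_fst_bound order_trans[OF norm_snd_bound norm_snd_bound]])
    have ders: "(((\<lambda>s. fst (z s)) has_real_derivative fst (\<omega> s)) (at s within {0..S}) \<and>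
        ((\<lambda>s. fst (snd (z s))) has_vector_derivative dyn f g (fst (snd (z s))) (fst (\<omega> s)) (fst (snd (\<omega> s))) (snd (snd (\<omega> s)))) (at s within {0..S}) \<and>
        ((\<lambda>s. fst (snd (snd (z s)))) has_real_derivative norm (fst (snd (\<omega> s)))) (at s within {0..S}))"
      if s: "s \<in> {0..S} - N" for s
    proof (intro conjI)
      show "((\<lambda>s. fst (z s)) has_real_derivative fst (\<omega> s)) (at s within {0..S})"
        using bounded_linear.has_vector_derivative[OF bounded_linear_fst z'[OF s]]
        by (simp add: has_real_derivative_iff_has_vector_derivative augmented_field_def)
      show "((\<lambda>s. fst (snd (z s))) has_vector_derivative dyn f g (fst (snd (z s))) (fst (\<omega> s)) (fst (snd (\<omega> s))) (snd (snd (\<omega> s)))) (at s within {0..S})"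
        using bounded_linear.has_vector_derivative[OF bounded_linear_fst bounded_linear.has_vector_derivative[OF bounded_linear_snd z'[OF s]]]
        by (simp add: augmented_field_def)
      show "((\<lambda>s. fst (snd (snd (z s)))) has_real_derivative norm (fst (snd (\<omega> s)))) (at s within {0..S})"
        using bounded_linear.has_vector_derivative[OF bounded_linear_fst bounded_linear.has_vector_derivative[OF bounded_linear_snd
              bounded_linear.has_vector_derivative[OF bounded_linear_snd z'[OF s]]]]
        by (simp add: has_real_derivative_iff_has_vector_derivative augmented_field_def)
    qed
    show "AE s in lebesgue_on {0..S}. (((\<lambda>s. fst (z s)) has_real_derivative fst (\<omega> s)) (at s within {0..S}) \<and>
        ((\<lambda>s. fst (snd (z s))) has_vector_derivative dyn f g (fst (snd (z s))) (fst (\<omega> s)) (fst (snd (\<omega> s))) (snd (snd (\<omega> s)))) (at s within {0..S}) \<and>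
        ((\<lambda>s. fst (snd (snd (z s)))) has_real_derivative norm (fst (snd (\<omega> s)))) (at s within {0..S}))"
      unfolding AE_lebesgue_on_iff_negligible
      by (rule exI[of _ N], rule conjI, rule N(1), rule ballI, rule ders)
  qed (use \<open>0 < S\<close> 0 in auto)
qed

text \<open>The converse passage, for the minimiser. Canonicity places its controls in the box, and
  the fundamental theorem for absolutely continuous functions turns derivatives almost everywhere
  into integral equations.\<close>

lemma process_is_trajectory:
  assumes proc: "st_process f g xc A C S w0 w \<alpha> y0 y \<beta>" and can: "canonical S w0 w"
  shows "\<exists>ob zb N. ob \<in> borel_measurable (lebesgue_on {0..S}) \<and> ob \<in> {0..S} \<rightarrow> U \<and> negligible N \<and>
    (\<forall>s\<in>{0..S} - N. ob s = (w0 s, w s, \<alpha> s) \<and> (w0 s, w s) \<in> Wset C \<and> \<alpha> s \<in> A) \<and>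
    continuous_on {0..S} zb \<and> zb 0 = (0, xc, 0, 0) \<and>
    (\<forall>t\<in>{0..S}. fst (zb t) = y0 t \<and> fst (snd (zb t)) = y t \<and> fst (snd (snd (zb t))) = \<beta> t) \<and>
    (\<forall>t\<in>{0..S}. zb t = zb 0 + integral {0..t} (\<lambda>s. X (zb s) (ob s))) \<and>
    snd (snd (snd (zb S))) = integral\<^sup>L (lebesgue_on {0..S}) (\<lambda>s. ell_e l0 l1h (y s) (w0 s) (w s) (\<alpha> s))"
proof -
  have S: "0 < S" and meas: "w0 \<in> borel_measurable (lebesgue_on {0..S})" "w \<in> borel_measurable (lebesgue_on {0..S})"
      "\<alpha> \<in> borel_measurable (lebesgue_on {0..S})"
    and AC: "AC_on 0 S y0" "AC_on 0 S y" "AC_on 0 S \<beta>" and init: "y0 0 = 0" "y 0 = xc" "\<beta> 0 = 0"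
    using proc unfolding st_process_def by blast+
  have "AE s in lebesgue_on {0..S}. (w0 s \<ge> 0 \<and> w s \<in> C \<and> \<alpha> s \<in> A) \<and> w0 s + norm (w s) = 1 \<and>
        (y0 has_real_derivative w0 s) (at s within {0..S}) \<and>
        (y has_vector_derivative dyn f g (y s) (w0 s) (w s) (\<alpha> s)) (at s within {0..S}) \<and>
        (\<beta> has_real_derivative norm (w s)) (at s within {0..S})"
    using proc can unfolding st_process_def canonical_def 
    by (elim conjE) (rule AE_conjI, assumption, rule AE_conjI; assumption)
  then obtain N where N: "negligible N" and good: "\<forall>s\<in>{0..S} - N. (w0 s \<ge> 0 \<and> w s \<in> C \<and> \<alpha> s \<in> A) \<and> w0 s + norm (w s) = 1 \<and>
        (y0 has_real_derivative w0 s) (at s within {0..S}) \<and>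
        (y has_vector_derivative dyn f g (y s) (w0 s) (w s) (\<alpha> s)) (at s within {0..S}) \<and>
        (\<beta> has_real_derivative norm (w s)) (at s within {0..S})"
    unfolding AE_lebesgue_on_iff_negligible by blast
  have "\<not> negligible {0..S}" using S by (simp add: negligible_iff_measure)
  then have "\<not> {0..S} \<subseteq> N" using N negligible_subset by blast
  \<comment> \<open>The control value at one good instant replaces the control on the null set, so
    that \<open>ob\<close> lies in the box at every time.\<close>
  then obtain r where r: "r \<in> {0..S} - N" by blast
  define ob where "ob s = (if s \<in> N then (w0 r, w r, \<alpha> r) else (w0 s, w s, \<alpha> s))" for s
  have obN: "ob s = (w0 s, w s, \<alpha> s)" if "s \<notin> N" for s using that by (simp add: ob_def)
  have inW: "(w0 s, w s) \<in> Wset C" "\<alpha> s \<in> A" if "s \<in> {0..S} - N" for s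
    using good that by (auto simp: Wset_def)
  have inU: "(w0 s, w s, \<alpha> s) \<in> U" if "s \<in> {0..S} - N" for s
    using bspec[OF good that] by (auto simp: control_box_def)
  have ob_in: "ob \<in> {0..S} \<rightarrow> U" using inU r by (auto simp: ob_def)
  have ob_meas: "ob \<in> borel_measurable (lebesgue_on {0..S})"
    unfolding ob_def
  proof (rule measurable_If)
    show "(\<lambda>s. (w0 s, w s, \<alpha> s)) \<in> borel_measurable (lebesgue_on {0..S})"
      by (intro borel_measurable_Pair meas)
    have "{s \<in> space (lebesgue_on {0..S}). s \<in> N} = {0..S} \<inter> N" by auto
    moreover have "{0..S} \<inter> N \<in> sets (lebesgue_on {0..S})"
      using negligible_imp_sets[OF N] by (simp add: sets_restrict_space)
    ultimately show "{s \<in> space (lebesgue_on {0..S}). s \<in> N} \<in> sets (lebesgue_on {0..S})" by simp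
  qed simp
  have i0: "(w0 has_integral y0 t - y0 0) {0..t}" if "t \<in> {0..S}" for t
    by (rule AC_on_has_integral[OF AC(1) N that]) (use good in \<open>simp add: has_real_derivative_iff_has_vector_derivative\<close>)
  have i1: "((\<lambda>s. dyn f g (y s) (w0 s) (w s) (\<alpha> s)) has_integral y t - y 0) {0..t}" if "t \<in> {0..S}" for t
    by (rule AC_on_has_integral[OF AC(2) N that]) (use good in simp)
  have i2: "((\<lambda>s. norm (w s)) has_integral \<beta> t - \<beta> 0) {0..t}" if "t \<in> {0..S}" for t
    by (rule AC_on_has_integral[OF AC(3) N that]) (use good in \<open>simp add: has_real_derivative_iff_has_vector_derivative\<close>)
  have yc: "continuous_on {0..S} h" if h: "\<And>t. t \<in> {0..S} \<Longrightarrow> (k has_integral h t - h 0) {0..t}"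
    for h k :: "real \<Rightarrow> 'x::banach"
  proof -
    have "k integrable_on {0..S}" using h[of S] S by (auto simp: has_integral_integrable)
    then have "continuous_on {0..S} (\<lambda>t. h 0 + integral {0..t} k)"
      by (intro continuous_intros indefinite_integral_continuous_1)
    then show ?thesis
    proof (rule continuous_on_eq)
      fix t assume "t \<in> {0..S}"
      from integral_unique[OF h[OF this]] show "h 0 + integral {0..t} k = h t" by simp
    qed
  qed
  have cont: "continuous_on {0..S} y0" "continuous_on {0..S} y" "continuous_on {0..S} \<beta>"
    by (rule yc[OF i0], assumption) (rule yc[OF i1] yc[OF i2], assumption)+
  define L where "L s = ell_e l0 l1h (y s) (fst (ob s)) (fst (snd (ob s))) (snd (snd (ob s)))" for s
  define zb where "zb t = (y0 t, y t, \<beta> t, integral {0..t} L)" for t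
  \<comment> \<open>\<open>zb\<close> cannot be used yet, since its fourth component is the integral
    whose existence is at stake. A dummy state with the same y-component has the same running
    cost.\<close>
  have c0: "continuous_on {0..S} (\<lambda>s. (0::real, y s, 0::real, 0::real))" by (intro continuous_intros cont)
  have bl: "bounded_linear (\<lambda>x :: real \<times> (real^'n) \<times> real \<times> real. snd (snd (snd x)))"
    by (intro bounded_linear_intros)
  have "L integrable_on {0..S}"
    using integrable_linear[OF X_field_facts(3)[OF ob_meas ob_in c0] bl] 
    by (simp add: o_def L_def[abs_def] augmented_field_def)
  then have Lt: "L integrable_on {0..t}" if "t \<in> {0..S}" for t
    by (rule integrable_subinterval_real) (use that in simp)
  have zc: "continuous_on {0..S} zb"
    unfolding zb_def by (intro continuous_intros cont indefinite_integral_continuous_1 \<open>L integrable_on {0..S}\<close>)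
  have zb0: "zb 0 = (0, xc, 0, 0)" by (simp add: zb_def init)
  have zeq: "zb t = zb 0 + integral {0..t} (\<lambda>s. X (zb s) (ob s))" if t: "t \<in> {0..S}" for t
  proof -
    have "((\<lambda>s. (w0 s, dyn f g (y s) (w0 s) (w s) (\<alpha> s), norm (w s), L s)) has_integral
        (y0 t - y0 0, y t - y 0, \<beta> t - \<beta> 0, integral {0..t} L)) {0..t}"
      by (intro has_integral_Pair i0[OF t] i1[OF t] i2[OF t] integrable_integral Lt[OF t])
    then have "((\<lambda>s. X (zb s) (ob s)) has_integral (y0 t - y0 0, y t - y 0, \<beta> t - \<beta> 0, integral {0..t} L)) {0..t}"
      by (rule has_integral_spike[OF N, rotated]) (simp add: augmented_field_def zb_def obN L_def)
    from integral_unique[OF this] show ?thesis by (simp add: zb_def init)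
  qed
  have "snd (snd (snd (zb S))) = integral\<^sup>L (lebesgue_on {0..S}) (\<lambda>s. ell_e l0 l1h (fst (snd (zb s))) (fst (ob s)) (fst (snd (ob s))) (snd (snd (ob s))))"
    unfolding running_cost_eq[OF ob_meas ob_in zc] using zeq[of S] S zb0 by simp
  also have "\<dots> = integral\<^sup>L (lebesgue_on {0..S}) (\<lambda>s. ell_e l0 l1h (y s) (w0 s) (w s) (\<alpha> s))"
  proof (rule integral_cong_AE)
    have "(\<lambda>s. ell_e l0 l1h (fst (snd (zb s))) (fst (ob s)) (fst (snd (ob s))) (snd (snd (ob s)))) = (\<lambda>s. snd (snd (snd (X (zb s) (ob s)))))"
      by (simp add: augmented_field_def)
    moreover have "(\<lambda>s. snd (snd (snd (X (zb s) (ob s))))) \<in> borel_measurable (lebesgue_on {0..S})"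
      by (rule borel_measurable_continuous_on[OF linear_continuous_on[OF bl] X_field_facts(1)[OF ob_meas ob_in zc]])
    ultimately show m: "(\<lambda>s. ell_e l0 l1h (fst (snd (zb s))) (fst (ob s)) (fst (snd (ob s))) (snd (snd (ob s)))) \<in> borel_measurable (lebesgue_on {0..S})"
      by simp
    show eq: "AE s in lebesgue_on {0..S}. ell_e l0 l1h (fst (snd (zb s))) (fst (ob s)) (fst (snd (ob s))) (snd (snd (ob s)))
        = ell_e l0 l1h (y s) (w0 s) (w s) (\<alpha> s)"
      unfolding AE_lebesgue_on_iff_negligible using N by (intro exI[of _ N]) (auto simp: obN zb_def)
    show "(\<lambda>s. ell_e l0 l1h (y s) (w0 s) (w s) (\<alpha> s)) \<in> borel_measurable (lebesgue_on {0..S})"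
      by (rule borel_measurable_lebesgue_on_AE[OF m eq])
  qed
  finally have cost: "snd (snd (snd (zb S))) = integral\<^sup>L (lebesgue_on {0..S}) (\<lambda>s. ell_e l0 l1h (y s) (w0 s) (w s) (\<alpha> s))" .
  have goodN: "\<forall>s\<in>{0..S} - N. ob s = (w0 s, w s, \<alpha> s) \<and> (w0 s, w s) \<in> Wset C \<and> \<alpha> s \<in> A"
    using inW obN by blast
  have comps: "\<forall>t\<in>{0..S}. fst (zb t) = y0 t \<and> fst (snd (zb t)) = y t \<and> fst (snd (snd (zb t))) = \<beta> t"
    by (simp add: zb_def)
  have eqs: "\<forall>t\<in>{0..S}. zb t = zb 0 + integral {0..t} (\<lambda>s. X (zb s) (ob s))" by (intro ballI zeq)
  show ?thesis
    by (rule exI[of _ ob], rule exI[of _ zb], rule exI[of _ N])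
      (intro conjI ob_meas ob_in N goodN zc zb0 comps eqs cost)
qed

end

section \<open>From needle inequalities to the Hamiltonian conditions\<close>

lemma Ham_eq_inner:
  "Ham f g l0 l1h (fst (snd z)) p0 p \<pi> lam w0 w a = (p0, p, \<pi>, - lam) \<bullet> augmented_field f g l0 l1h z (w0, w, a)"
  by (simp add: Ham_def augmented_field_def inner_prod_def)

text \<open>A nonempty open interval is never null; this carries relations from almost every instant
  to every instant.\<close>

lemma dense_off_negligible:
  fixes S :: real
  assumes "0 < S" "negligible N" "s \<in> {0..S}"
  shows "s \<in> closure ({0<..<S} - N)"
  unfolding closure_approachable
proof (intro allI impI)
  fix e :: real assume "e > 0"
  define G where "G = {max 0 (s - e)<..<min S (s + e)}"
  have "open G" "G \<noteq> {}" unfolding G_def using assms \<open>e > 0\<close> by auto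
  then have "\<not> negligible G" by (rule open_not_negligible)
  then have "\<not> G \<subseteq> N" using assms(2) negligible_subset by blast
  then obtain t where "t \<in> G" "t \<notin> N" by blast
  then show "\<exists>t\<in>{0<..<S} - N. dist t s < e"
    by (intro bexI[of _ t]) (auto simp: G_def dist_real_def)
qed

lemma norm_augmented_le:
  fixes z z' :: "real \<times> 'y::real_inner \<times> real \<times> real"
  shows "norm ((fst z, fst (snd z), fst (snd (snd z))) - (fst z', fst (snd z'), fst (snd (snd z')))) \<le> norm (z - z')"
proof -
  have "norm (fst (snd (snd (z - z')))) \<le> norm (snd (snd (z - z')))" by (rule norm_fst_bound)
  then show ?thesis
    by (simp add: norm_prod_def)
qed

context space_time
begin

lemma reference_smooth:
  assumes "0 < S" "ob \<in> borel_measurable (lebesgue_on {0..S})" "ob \<in> {0..S} \<rightarrow> U" "continuous_on {0..S} zb"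
    "\<And>t. t \<in> {0..S} \<Longrightarrow> zb t = zb 0 + integral {0..t} (\<lambda>s. X (zb s) (ob s))"
  obtains D where "smooth_reference X D U S ob zb" "\<forall>z u h. fst (snd h) = 0 \<longrightarrow> blinfun_apply (D z u) h = 0"
proof -
  from augmented_field_smooth[OF f_smooth g_smooth l0_smooth l1h_smooth U_subset]
  obtain D where D: "continuous_on (UNIV \<times> U) (\<lambda>(z,u). X z u)"
    "\<forall>z. \<forall>u\<in>U. ((\<lambda>z. X z u) has_derivative blinfun_apply (D z u)) (at z)"
    "continuous_on (UNIV \<times> U) (\<lambda>(z,u). D z u)"
    "\<forall>z u h. fst (snd h) = 0 \<longrightarrow> blinfun_apply (D z u) h = 0" .
  have "smooth_reference X D U S ob zb"
    by (rule smooth_reference.intro[OF assms(1) compact_U D(1) D(2)[rule_format] D(3) assms(2-4) assms(5)])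
  then show thesis using D(4) by (rule that)
qed

text \<open>At an exceptional instant the reference control carries no information, so the control
  of the third claim is found as a limit of reference values along good instants; compactness of the
  slice \<open>K\<close> provides a convergent subsequence.\<close>

lemma hamiltonian_conditions:
  fixes S :: real
  assumes "0 < S" and N: "negligible N" and qc: "continuous_on {0..S} q" and zc: "continuous_on {0..S} zb"
    and A0: "\<And>s. s \<in> {0..S} - N \<Longrightarrow> \<exists>w0 w a. ob s = (w0, w, a) \<and> (w0, w) \<in> Wset C \<and> a \<in> A"
    and needle: "\<And>t u. t \<in> {0<..<S} - N \<Longrightarrow> u \<in> U \<Longrightarrow> q t \<bullet> (X (zb t) u - X (zb t) (ob t)) \<le> 0"
  shows "s \<in> {0<..<S} - N \<Longrightarrow> q s \<bullet> X (zb s) (ob s) = 0"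
    "s \<in> {0..S} \<Longrightarrow> (w0, w) \<in> Wset C \<Longrightarrow> a \<in> A \<Longrightarrow> q s \<bullet> X (zb s) (w0, w, a) \<le> 0"
    "s \<in> {0..S} \<Longrightarrow> \<exists>w0 w a. (w0, w) \<in> Wset C \<and> a \<in> A \<and> q s \<bullet> X (zb s) (w0, w, a) = 0"
proof -
  define K where "K = {u. 0 \<le> fst u \<and> fst (snd u) \<in> C \<and> snd (snd u) \<in> A \<and>
     1 \<le> fst u + norm (fst (snd u)) \<and> fst u + norm (fst (snd u)) \<le> 1}"
  have K_iff: "(w0, w, a) \<in> K \<longleftrightarrow> (w0, w) \<in> Wset C \<and> a \<in> A" for w0 w a
    by (auto simp: K_def Wset_def)
  have K: "compact K" unfolding K_def by (rule compact_control_slab[OF compact_A closed_C])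
  have zero: "q s \<bullet> X (zb s) (ob s) = 0" if s: "s \<in> {0<..<S} - N" for s
  proof -
    have "s \<in> {0..S} - N" using s by auto
    from A0[OF this] obtain w0 w a where o: "ob s = (w0, w, a)" "(w0, w) \<in> Wset C" "a \<in> A" by blast
    have w: "w0 \<ge> 0" "w \<in> C" "w0 + norm w = 1" using o(2) by (auto simp: Wset_def)
    have cw: "c *\<^sub>R w \<in> C" if "c > 0" for c using pcone_C w(2) that by (auto simp: pcone_def)
    \<comment> \<open>With h = q . X at the reference control, the two needles give (2 - 1) h \<le>
      0 and (1/2 - 1) h \<le> 0.\<close>
    have "(2 * w0, 2 *\<^sub>R w, a) \<in> U" "((1/2) * w0, (1/2) *\<^sub>R w, a) \<in> U"
      using w o(3) cw[of 2] cw[of "1/2"] by (auto simp: control_box_def)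
    from needle[OF s this(1)] needle[OF s this(2)]
    show ?thesis
      by (simp add: o(1) inner_diff_right X_homogeneous[of 2 w0 w] X_homogeneous[of "1/2" w0 w, simplified] w)
  qed
  then show "s \<in> {0<..<S} - N \<Longrightarrow> q s \<bullet> X (zb s) (ob s) = 0" .
  have Hc: "continuous_on ({0..S} \<times> K) (\<lambda>p. q (fst p) \<bullet> X (zb (fst p)) (snd p))"
  proof -
    have "continuous_on ({0..S} \<times> K) (\<lambda>p. (\<lambda>(z,u). X z u) (zb (fst p), snd p))"
    proof (rule continuous_on_compose2[OF X_continuous])
      show "continuous_on ({0..S} \<times> K) (\<lambda>p. (zb (fst p), snd p))"
        by (intro continuous_on_Pair continuous_on_compose2[OF zc continuous_on_fst[OF continuous_on_id]]
            continuous_on_snd[OF continuous_on_id]) auto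
    qed (auto simp: K_def)
    then have "continuous_on ({0..S} \<times> K) (\<lambda>p. X (zb (fst p)) (snd p))" by simp
    moreover have "continuous_on ({0..S} \<times> K) (\<lambda>p. q (fst p))"
      by (rule continuous_on_compose2[OF qc continuous_on_fst[OF continuous_on_id]]) auto
    ultimately show ?thesis by (intro continuous_on_inner)
  qed
  have seq: "\<exists>\<sigma>. (\<forall>n. \<sigma> n \<in> {0<..<S} - N) \<and> \<sigma> \<longlonglongrightarrow> s" if "s \<in> {0..S}" for s
    using dense_off_negligible[OF \<open>0 < S\<close> N that] unfolding closure_sequential by blast
  have limit: "(\<lambda>n. q (\<sigma> n) \<bullet> X (zb (\<sigma> n)) (u n)) \<longlonglongrightarrow> q s \<bullet> X (zb s) v"
    if "\<And>n. \<sigma> n \<in> {0..S}" "\<And>n. u n \<in> K" "\<sigma> \<longlonglongrightarrow> s" "u \<longlonglongrightarrow> v" "s \<in> {0..S}" "v \<in> K" for \<sigma> u s v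
  proof -
    have "(\<lambda>n. (\<lambda>p. q (fst p) \<bullet> X (zb (fst p)) (snd p)) (\<sigma> n, u n)) \<longlonglongrightarrow> (\<lambda>p. q (fst p) \<bullet> X (zb (fst p)) (snd p)) (s, v)"
      by (rule continuous_on_tendsto_compose[OF Hc]) (use that in \<open>auto intro!: tendsto_Pair\<close>)
    then show ?thesis by simp
  qed
  have le: "q t \<bullet> X (zb t) (w0, w, a) \<le> 0" if t: "t \<in> {0<..<S} - N" and u: "(w0, w, a) \<in> K" for t w0 w a
  proof -
    have "(w0, w, a) \<in> U" using u by (auto simp: K_def control_box_def)
    from needle[OF t this] show ?thesis by (simp add: inner_diff_right zero[OF t])
  qed
  show "q s \<bullet> X (zb s) (w0, w, a) \<le> 0" if s: "s \<in> {0..S}" and u: "(w0, w) \<in> Wset C" "a \<in> A"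
  proof -
    have uK: "(w0, w, a) \<in> K" using u by (simp add: K_iff)
    obtain \<sigma> where \<sigma>: "\<forall>n. \<sigma> n \<in> {0<..<S} - N" "\<sigma> \<longlonglongrightarrow> s" using seq[OF s] by blast
    have "\<sigma> n \<in> {0..S}" for n using \<sigma>(1)[THEN spec, of n] by auto
    from limit[OF this uK \<sigma>(2) tendsto_const s uK]
    have "(\<lambda>n. q (\<sigma> n) \<bullet> X (zb (\<sigma> n)) (w0, w, a)) \<longlonglongrightarrow> q s \<bullet> X (zb s) (w0, w, a)" .
    then show ?thesis
      by (rule LIMSEQ_le_const2) (use le[OF _ uK] \<sigma>(1) in blast)
  qed
  show "\<exists>w0 w a. (w0, w) \<in> Wset C \<and> a \<in> A \<and> q s \<bullet> X (zb s) (w0, w, a) = 0" if s: "s \<in> {0..S}"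
  proof -
    obtain \<sigma> where \<sigma>: "\<forall>n. \<sigma> n \<in> {0<..<S} - N" "\<sigma> \<longlonglongrightarrow> s" using seq[OF s] by blast
    have obK: "ob (\<sigma> n) \<in> K" for n
    proof -
      have "\<sigma> n \<in> {0..S} - N" using \<sigma>(1)[THEN spec, of n] by auto
      from A0[OF this] show ?thesis using K_iff by auto
    qed
    obtain v r where v: "v \<in> K" "strict_mono r" "((\<lambda>n. ob (\<sigma> n)) \<circ> r) \<longlonglongrightarrow> v"
      using K[unfolded compact_def, THEN spec, of "\<lambda>n. ob (\<sigma> n)"] obK by auto
    have "(\<lambda>n. q (\<sigma> (r n)) \<bullet> X (zb (\<sigma> (r n))) (ob (\<sigma> (r n)))) \<longlonglongrightarrow> q s \<bullet> X (zb s) v"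
    proof (rule limit[OF _ obK _ _ s v(1)])
      show "\<sigma> (r n) \<in> {0..S}" for n using \<sigma>(1)[THEN spec, of "r n"] by auto
      show "(\<lambda>n. \<sigma> (r n)) \<longlonglongrightarrow> s" using LIMSEQ_subseq_LIMSEQ[OF \<sigma>(2) v(2)] by (simp add: o_def)
      show "(\<lambda>n. ob (\<sigma> (r n))) \<longlonglongrightarrow> v" using v(3) by (simp add: o_def)
    qed
    moreover have "q (\<sigma> (r n)) \<bullet> X (zb (\<sigma> (r n))) (ob (\<sigma> (r n))) = 0" for n using zero \<sigma>(1) by blast
    ultimately have "(\<lambda>n. 0) \<longlonglongrightarrow> q s \<bullet> X (zb s) v" by simp
    then have "q s \<bullet> X (zb s) v = 0" by (simp add: LIMSEQ_const_iff)
    moreover obtain w0 w a where "v = (w0, w, a)" by (cases v)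
    ultimately show ?thesis using v(1) K_iff by auto
  qed
qed

end

section \<open>The covector supplied by local minimality\<close>

lemma C1_map_gradient:
  fixes h :: "'a::euclidean_space \<Rightarrow> real"
  assumes "C1_map h"
  shows "continuous_on UNIV h" "\<exists>v. GDERIV h x :> v"
proof -
  obtain D where D: "\<And>x. (h has_derivative blinfun_apply (D x)) (at x)"
    using assms unfolding C1_map_def by blast
  show "continuous_on UNIV h"
    using D has_derivative_continuous by (metis continuous_at_imp_continuous_on)
  have "blinfun_apply (D x) y = y \<bullet> (\<Sum>b\<in>Basis. blinfun_apply (D x) b *\<^sub>R b)" for y
  proof -
    have "blinfun_apply (D x) y = blinfun_apply (D x) (\<Sum>b\<in>Basis. (y \<bullet> b) *\<^sub>R b)"
      by (simp add: euclidean_representation)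
    also have "\<dots> = y \<bullet> (\<Sum>b\<in>Basis. blinfun_apply (D x) b *\<^sub>R b)"
      by (simp add: blinfun.sum_right blinfun.scaleR_right inner_sum_right mult.commute)
    finally show ?thesis .
  qed
  then have "blinfun_apply (D x) = (\<lambda>y. y \<bullet> (\<Sum>b\<in>Basis. blinfun_apply (D x) b *\<^sub>R b))" by (rule ext)
  with D[of x] show "\<exists>v. GDERIV h x :> v" unfolding gderiv_def by metis
qed

context space_time
begin

text \<open>For the non-triviality arguments: a vanishing velocity component leaves \<beta> or y0 at
  its initial value 0, against the hypotheses on their final values.\<close>

lemma component_constant:
  fixes S :: real
  assumes "0 < S" and ob: "ob \<in> borel_measurable (lebesgue_on {0..S})" "ob \<in> {0..S} \<rightarrow> U"
    and zc: "continuous_on {0..S} zb" and zS: "zb S = zb 0 + integral {0..S} (\<lambda>s. X (zb s) (ob s))"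
    and N: "negligible N" and k: "bounded_linear k" "\<And>s. s \<in> {0..S} - N \<Longrightarrow> k (X (zb s) (ob s)) = (0::real)"
  shows "k (zb S) = k (zb 0)"
proof -
  have "(k \<circ> (\<lambda>s. X (zb s) (ob s)) has_integral k (integral {0..S} (\<lambda>s. X (zb s) (ob s)))) {0..S}"
    by (rule has_integral_linear[OF integrable_integral[OF X_field_facts(3)[OF ob zc]] k(1)])
  moreover have "(k \<circ> (\<lambda>s. X (zb s) (ob s)) has_integral 0) {0..S}"
    by (rule has_integral_spike[OF N _ has_integral_0]) (simp add: k(2))
  ultimately have "k (integral {0..S} (\<lambda>s. X (zb s) (ob s))) = 0" by (rule has_integral_unique)
  then show ?thesis
    by (subst zS) (simp add: linear_add[OF bounded_linear.linear[OF k(1)]])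
qed

text \<open>Admissible endpoint data are parametrised by a point of the Boltyanski cone together with slacks
  for the variation bound and the cost; the slack for the bound is free when the bound is inactive.\<close>

lemma separating_covector:
  fixes Cp :: "(real^'M) set"
  assumes locmin: "st_local_minimizer f g xc A C T K Psi l0 l1h Sb w0b wb \<alpha>b y0b yb \<beta>b"
    and bolt: "boltyanski_cone Cp \<Gamma> T (y0b Sb, yb Sb)"
    and ob: "ob \<in> borel_measurable (lebesgue_on {0..Sb})" "ob \<in> {0..Sb} \<rightarrow> U"
    and zc: "continuous_on {0..Sb} zb" and zb0: "zb 0 = (0, xc, 0, 0)"
    and comps: "\<forall>t\<in>{0..Sb}. fst (zb t) = y0b t \<and> fst (snd (zb t)) = yb t \<and> fst (snd (snd (zb t))) = \<beta>b t"
    and zeq: "\<forall>t\<in>{0..Sb}. zb t = zb 0 + integral {0..t} (\<lambda>s. X (zb s) (ob s))"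
    and cost: "snd (snd (snd (zb Sb))) = integral\<^sup>L (lebesgue_on {0..Sb}) (\<lambda>s. ell_e l0 l1h (yb s) (w0b s) (wb s) (\<alpha>b s))"
    and D: "smooth_reference X D U Sb ob zb" "\<forall>z u h. fst (snd h) = 0 \<longrightarrow> blinfun_apply (D z u) h = 0"
    and grad: "GDERIV Psi (y0b Sb, yb Sb) :> v"
  shows "\<exists>\<nu>0 \<nu>1 \<nu>2 \<nu>3 q N. (\<nu>0, \<nu>1, \<nu>2, \<nu>3) \<noteq> 0 \<and> AC_on 0 Sb q \<and> continuous_on {0..Sb} q \<and>
    (\<forall>t\<in>{0..Sb}. q t = (\<nu>0 + \<nu>3 * fst v, fst (snd (q t)), \<nu>2, \<nu>3)) \<and> fst (snd (q Sb)) = \<nu>1 + \<nu>3 *\<^sub>R snd v \<and>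
    \<nu>2 \<le> 0 \<and> (ereal (\<beta>b Sb) < K \<longrightarrow> \<nu>2 = 0) \<and> \<nu>3 \<le> 0 \<and> - (\<nu>0, \<nu>1) \<in> polar \<Gamma> \<and> negligible N \<and>
    (\<forall>t\<in>{0..Sb} - N. (q has_vector_derivative - smooth_reference.adjoint_field D ob zb t (q t)) (at t within {0..Sb})) \<and>
    (\<forall>t\<in>{0<..<Sb} - N. \<forall>u\<in>U. q t \<bullet> (X (zb t) u - X (zb t) (ob t)) \<le> 0)"
proof -
  interpret ref: smooth_reference X D U Sb ob zb by (rule D(1))
  have feas: "st_feasible f g xc A C T K Sb w0b wb \<alpha>b y0b yb \<beta>b" using locmin unfolding st_local_minimizer_def by blast
  then have \<beta>K: "ereal (\<beta>b Sb) \<le> K" unfolding st_feasible_def by blast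
  obtain \<delta> where "\<delta> > 0" and min: "\<forall>S w0 w \<alpha> y0 y \<beta>. st_feasible f g xc A C T K S w0 w \<alpha> y0 y \<beta> \<longrightarrow>
        \<bar>S - Sb\<bar> + (SUP s\<in>{0..}. norm (ext_traj S y0 y \<beta> s - ext_traj Sb y0b yb \<beta>b s)) < \<delta> \<longrightarrow>
        st_cost Psi l0 l1h Sb w0b wb \<alpha>b y0b yb \<le> st_cost Psi l0 l1h S w0 w \<alpha> y0 y"
    using locmin unfolding st_local_minimizer_def by (elim conjE exE)
  have S: "0 < Sb" by (rule ref.S_pos)
  have SS: "Sb \<in> {0..Sb}" using S by simp
  have Cp: "convex Cp" "pcone Cp" "0 \<in> Cp"
    using bolt unfolding boltyanski_cone_def by blast+
  obtain V F L where V: "0 \<in> interior V" and Fc: "continuous_on (V \<inter> Cp) F" and FT: "F ` (V \<inter> Cp) \<subseteq> T"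
    and F0: "F 0 = (y0b Sb, yb Sb)" and L: "linear L" "L ` Cp = \<Gamma>"
    and approx: "\<forall>e>0. \<exists>d>0. \<forall>v\<in>V \<inter> Cp. norm v < d \<longrightarrow> norm (F v - (y0b Sb, yb Sb) - L v) \<le> e * norm v"
    using bolt unfolding boltyanski_cone_def by (elim conjE exE)
  define J where "J = Psi (y0b Sb, yb Sb) + snd (snd (snd (zb Sb)))"
  have Jcost: "st_cost Psi l0 l1h Sb w0b wb \<alpha>b y0b yb = J" by (simp add: st_cost_def J_def cost)
  \<comment> \<open>Endpoint data: target coordinates, variation, and total cost with
    \<open>Psi\<close> included. Placing \<open>Psi\<close> here brings its gradient into the
    terminal value of the costate.\<close>
  define \<theta> where "\<theta> z = (fst z, fst (snd z), fst (snd (snd z)), Psi (fst z, fst (snd z)) + snd (snd (snd z)))"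
    for z :: "real \<times> (real^'n) \<times> real \<times> real"
  define \<theta>' where "\<theta>' h = (fst h, fst (snd h), fst (snd (snd h)), (fst h, fst (snd h)) \<bullet> v + snd (snd (snd h)))"
    for h :: "real \<times> (real^'n) \<times> real \<times> real"
  define Q where "Q = {p :: (real^'M) \<times> real \<times> real. fst p \<in> Cp \<and> (\<not> ereal (\<beta>b Sb) < K \<longrightarrow> 0 \<le> fst (snd p)) \<and> 0 \<le> snd (snd p)}"
  \<comment> \<open>Slacks enter with a minus sign: a positive slack lowers the variation or the
    cost. A further decrease in the last coordinate then contradicts optimality, which is why
    \<open>dir\<close> will be the last axis.\<close>
  define FF where "FF p = (fst (F (fst p)), snd (F (fst p)), \<beta>b Sb - fst (snd p), J - snd (snd p))" for p :: "(real^'M) \<times> real \<times> real"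
  define MM where "MM p = (fst (L (fst p)), snd (L (fst p)), - fst (snd p), - snd (snd p))" for p :: "(real^'M) \<times> real \<times> real"
  have zbS: "fst (zb Sb) = y0b Sb" "fst (snd (zb Sb)) = yb Sb" "fst (snd (snd (zb Sb))) = \<beta>b Sb" using comps SS by auto
  have \<theta>c: "continuous_on UNIV \<theta>"
    unfolding \<theta>_def
    by (intro continuous_on_Pair continuous_on_add
        continuous_on_compose2[OF C1_map_gradient(1)[OF Psi_smooth], of UNIV "\<lambda>z. (fst z, fst (snd z))"])
      (auto intro!: continuous_intros)
  have \<theta>d: "(\<theta> has_derivative \<theta>') (at (zb Sb))"
  proof -
    have P: "((\<lambda>z :: real \<times> (real^'n) \<times> real \<times> real. (fst z, fst (snd z))) has_derivative (\<lambda>h. (fst h, fst (snd h)))) (at (zb Sb))"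
      by (intro bounded_linear_imp_has_derivative bounded_linear_Pair bounded_linear_intros)
    have "(Psi has_derivative (\<lambda>h. h \<bullet> v)) (at (fst (zb Sb), fst (snd (zb Sb))))"
      using grad unfolding gderiv_def zbS .
    from has_derivative_compose[OF P this]
    have "((\<lambda>z. Psi (fst z, fst (snd z))) has_derivative (\<lambda>h. (fst h, fst (snd h)) \<bullet> v)) (at (zb Sb))" .
    then show ?thesis
      unfolding \<theta>_def \<theta>'_def
      by (intro has_derivative_Pair has_derivative_add bounded_linear_imp_has_derivative bounded_linear_intros)
  qed
  have Qc: "convex Q"
    unfolding convex_def
  proof (intro ballI allI impI)
    fix x y :: "(real^'M) \<times> real \<times> real" and u w :: real
    assume "x \<in> Q" "y \<in> Q" "0 \<le> u" "0 \<le> w" "u + w = 1"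
    then show "u *\<^sub>R x + w *\<^sub>R y \<in> Q" using convexD[OF Cp(1), of "fst x" "fst y" u w] by (auto simp: Q_def)
  qed
  have Qp: "pcone Q" using Cp(2) unfolding pcone_def Q_def by auto
  have Q0: "0 \<in> Q" using Cp(3) by (simp add: Q_def)
  have VQ: "(fst p \<in> V \<inter> Cp)" if "p \<in> (V \<times> UNIV) \<inter> Q" for p using that by (auto simp: Q_def)
  have VV: "0 \<in> interior (V \<times> (UNIV :: (real \<times> real) set))" using V by (simp add: interior_Times zero_prod_def)
  have FFc: "continuous_on ((V \<times> UNIV) \<inter> Q) FF"
  proof -
    have "continuous_on ((V \<times> UNIV) \<inter> Q) (\<lambda>p. F (fst p))"
      by (rule continuous_on_compose2[OF Fc continuous_on_fst[OF continuous_on_id]]) (use VQ in auto)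
    then show ?thesis unfolding FF_def by (intro continuous_intros)
  qed
  have FF0: "FF 0 = \<theta> (zb Sb)" by (simp add: FF_def \<theta>_def F0 zbS J_def)
  have MMl: "linear MM"
    by (rule linearI) (simp_all add: MM_def linear_add[OF L(1)] linear_scale[OF L(1)])
  have MMa: "\<exists>d>0. \<forall>p\<in>(V \<times> UNIV) \<inter> Q. norm p < d \<longrightarrow> norm (FF p - FF 0 - MM p) \<le> e * norm p" if "e > 0" for e
  proof -
    obtain d where d: "d > 0" "\<forall>u\<in>V \<inter> Cp. norm u < d \<longrightarrow> norm (F u - (y0b Sb, yb Sb) - L u) \<le> e * norm u"
      using approx \<open>e > 0\<close> by blast
    show ?thesis
    proof (intro exI[of _ d] conjI ballI impI d(1))
      fix p :: "(real^'M) \<times> real \<times> real" assume p: "p \<in> (V \<times> UNIV) \<inter> Q" and "norm p < d"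
      define E where "E = F (fst p) - (y0b Sb, yb Sb) - L (fst p)"
      have np: "norm (fst p) \<le> norm p" by (rule norm_fst_bound)
      have "FF p - FF 0 - MM p = (fst E, snd E, 0, 0)"
        by (simp add: FF_def MM_def E_def F0 zero_prod_def)
      then have "norm (FF p - FF 0 - MM p) = norm E" by (simp add: norm_prod_def)
      also have "\<dots> \<le> e * norm (fst p)" unfolding E_def using d(2) VQ[OF p] np \<open>norm p < d\<close> by simp
      also have "\<dots> \<le> e * norm p" using np \<open>e > 0\<close> by simp
      finally show "norm (FF p - FF 0 - MM p) \<le> e * norm p" .
    qed
  qed
  \<comment> \<open>The room between \<beta>(S) and K when the bound is inactive; it absorbs a slack
    of either sign. In the active case any positive value will do.\<close>
  obtain \<kappa> where \<kappa>: "\<kappa> > 0" "\<And>b. ereal (\<beta>b Sb) < K \<Longrightarrow> b \<le> \<beta>b Sb + \<kappa> \<Longrightarrow> ereal b \<le> K"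
  proof (cases "ereal (\<beta>b Sb) < K")
    case True
    then obtain x where x: "ereal (\<beta>b Sb) < ereal x" "ereal x < K" using ereal_dense2 by blast
    show ?thesis
    proof (rule that[of "x - \<beta>b Sb"])
      show "x - \<beta>b Sb > 0" using x by simp
      fix b assume "b \<le> \<beta>b Sb + (x - \<beta>b Sb)"
      then have "ereal b \<le> ereal x" by simp
      then show "ereal b \<le> K" using less_imp_le[OF x(2)] by (rule order_trans)
    qed
  next
    case False
    then show ?thesis using that[of 1] by simp
  qed
  \<comment> \<open>Local minimality asks for a strict bound on a supremum, of which only \<le>
    \<open>\<eta>\<close> is known; halving \<open>\<delta>\<close> restores strictness.\<close>
  define \<eta> where "\<eta> = min (\<delta> / 2) \<kappa>"
  have \<eta>: "\<eta> > 0" "\<eta> < \<delta>" "\<eta> \<le> \<kappa>" using \<open>\<delta> > 0\<close> \<kappa>(1) by (auto simp: \<eta>_def)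
  have optimal: "\<theta> (z Sb) \<noteq> FF p - r *\<^sub>R (0, 0, 0, 1)"
    if \<omega>: "\<omega> \<in> borel_measurable (lebesgue_on {0..Sb})" "\<omega> \<in> {0..Sb} \<rightarrow> U" and z: "continuous_on {0..Sb} z"
      "\<And>t. t \<in> {0..Sb} \<Longrightarrow> z t = zb 0 + integral {0..t} (\<lambda>s. X (z s) (\<omega> s))"
      and near: "\<And>t. t \<in> {0..Sb} \<Longrightarrow> norm (z t - zb t) < \<eta>"
      and p: "p \<in> (V \<times> UNIV) \<inter> Q" "norm p < \<eta>" and r: "r > 0" for \<omega> z p r
  proof
    \<comment> \<open>Equality would describe a feasible process near the minimiser of cost J - b -
      r, with b \<ge> 0 and r > 0.\<close>
    assume eq: "\<theta> (z Sb) = FF p - r *\<^sub>R (0, 0, 0, 1)"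
    define a where "a = fst (snd p)"
    define b where "b = snd (snd p)"
    have e1: "(fst (z Sb), fst (snd (z Sb))) = F (fst p)" and e2: "fst (snd (snd (z Sb))) = \<beta>b Sb - a"
      and e3: "Psi (fst (z Sb), fst (snd (z Sb))) + snd (snd (snd (z Sb))) = J - b - r"
      using eq by (auto simp: \<theta>_def FF_def a_def b_def prod_eq_iff)
    have zeq': "z t = (0, xc, 0, 0) + integral {0..t} (\<lambda>s. X (z s) (\<omega> s))" if "t \<in> {0..Sb}" for t
      using z(2)[OF that] zb0 by simp
    have proc: "st_process f g xc A C Sb (\<lambda>s. fst (\<omega> s)) (\<lambda>s. fst (snd (\<omega> s))) (\<lambda>s. snd (snd (\<omega> s)))
        (\<lambda>s. fst (z s)) (\<lambda>s. fst (snd (z s))) (\<lambda>s. fst (snd (snd (z s))))"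
      by (rule trajectory_is_process[OF S \<omega> z(1) zeq'])
    have "norm (snd p) \<le> norm p" "norm (fst (snd p)) \<le> norm (snd p)" by (rule norm_snd_bound norm_fst_bound)+
    then have "\<bar>a\<bar> < \<eta>" using p(2) by (simp add: a_def)
    have "ereal (\<beta>b Sb - a) \<le> K"
    proof (cases "ereal (\<beta>b Sb) < K")
      case True
      then show ?thesis using \<open>\<bar>a\<bar> < \<eta>\<close> \<eta>(3) by (intro \<kappa>(2)) auto
    next
      case False
      then have "0 \<le> a" using p(1) by (auto simp: Q_def a_def)
      then have "ereal (\<beta>b Sb - a) \<le> ereal (\<beta>b Sb)" by simp
      then show ?thesis using \<beta>K by (rule order_trans)
    qed
    moreover have "F (fst p) \<in> T" using VQ[OF p(1)] FT by blast
    ultimately have feas': "st_feasible f g xc A C T K Sb (\<lambda>s. fst (\<omega> s)) (\<lambda>s. fst (snd (\<omega> s))) (\<lambda>s. snd (snd (\<omega> s)))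
        (\<lambda>s. fst (z s)) (\<lambda>s. fst (snd (z s))) (\<lambda>s. fst (snd (snd (z s))))"
      unfolding st_feasible_def using proc e1 e2 by simp
    have "(SUP s\<in>{0..}. norm (ext_traj Sb (\<lambda>s. fst (z s)) (\<lambda>s. fst (snd (z s))) (\<lambda>s. fst (snd (snd (z s)))) s
        - ext_traj Sb y0b yb \<beta>b s)) \<le> \<eta>"
    proof (rule cSUP_least)
      fix s :: real assume "s \<in> {0..}"
      then have t: "min s Sb \<in> {0..Sb}" using S by auto
      have "ext_traj Sb y0b yb \<beta>b s = (fst (zb (min s Sb)), fst (snd (zb (min s Sb))), fst (snd (snd (zb (min s Sb)))))"
        using comps t by (simp add: ext_traj_def)
      then have "norm (ext_traj Sb (\<lambda>s. fst (z s)) (\<lambda>s. fst (snd (z s))) (\<lambda>s. fst (snd (snd (z s)))) s - ext_traj Sb y0b yb \<beta>b s)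
          \<le> norm (z (min s Sb) - zb (min s Sb))"
        using norm_augmented_le[of "z (min s Sb)" "zb (min s Sb)"] by (simp only: ext_traj_def)
      then show "norm (ext_traj Sb (\<lambda>s. fst (z s)) (\<lambda>s. fst (snd (z s))) (\<lambda>s. fst (snd (snd (z s)))) s - ext_traj Sb y0b yb \<beta>b s) \<le> \<eta>"
        using near[OF t] by linarith
    qed simp
    then have close: "\<bar>Sb - Sb\<bar> + (SUP s\<in>{0..}. norm (ext_traj Sb (\<lambda>s. fst (z s)) (\<lambda>s. fst (snd (z s))) (\<lambda>s. fst (snd (snd (z s)))) s
        - ext_traj Sb y0b yb \<beta>b s)) < \<delta>" using \<eta>(2) by simp
    have "snd (snd (snd (z Sb))) = snd (snd (snd (integral {0..Sb} (\<lambda>s. X (z s) (\<omega> s)))))"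
      using arg_cong[OF zeq'[OF SS], of "\<lambda>x. snd (snd (snd x))"] by simp
    then have "st_cost Psi l0 l1h Sb (\<lambda>s. fst (\<omega> s)) (\<lambda>s. fst (snd (\<omega> s))) (\<lambda>s. snd (snd (\<omega> s))) (\<lambda>s. fst (z s)) (\<lambda>s. fst (snd (z s)))
        = J - b - r"
      unfolding st_cost_def running_cost_eq[OF \<omega> z(1)] using e3 by simp
    moreover have "0 \<le> b" using p(1) by (auto simp: Q_def b_def)
    ultimately show False
      using min[rule_format, OF feas' close] r unfolding Jcost by linarith
  qed
  have "\<exists>\<nu> q N. \<nu> \<noteq> 0 \<and> AC_on 0 Sb q \<and> continuous_on {0..Sb} q \<and> q Sb = (\<Sum>b\<in>Basis. (\<nu> \<bullet> \<theta>' b) *\<^sub>R b) \<and>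
    (\<forall>b\<in>Basis. (\<forall>s\<in>{0..Sb}. blinfun_apply (D (zb s) (ob s)) b = 0) \<longrightarrow> (\<forall>t\<in>{0..Sb}. q t \<bullet> b = q Sb \<bullet> b)) \<and>
    (\<forall>p\<in>Q. 0 \<le> \<nu> \<bullet> MM p) \<and> negligible N \<and>
    (\<forall>t\<in>{0..Sb} - N. (q has_vector_derivative - ref.adjoint_field t (q t)) (at t within {0..Sb})) \<and>
    (\<forall>t\<in>{0<..<Sb} - N. \<forall>u\<in>U. q t \<bullet> (X (zb t) u - X (zb t) (ob t)) \<le> 0)"
  proof (rule ref.pontryagin_separation[where \<eta>=\<eta> and dir="(0, 0, 0, 1)", OF \<theta>c \<theta>d Qc Qp Q0 VV FFc FF0 MMl])
    show "\<exists>d>0. \<forall>p\<in>(V \<times> UNIV) \<inter> Q. norm p < d \<longrightarrow> norm (FF p - FF 0 - MM p) \<le> e * norm p" if "e > 0" for e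
      by (rule MMa[OF that])
    show "\<eta> > 0" by (rule \<eta>(1))
    fix \<omega> z p and r :: real
    assume "\<omega> \<in> borel_measurable (lebesgue_on {0..Sb})" "\<omega> \<in> {0..Sb} \<rightarrow> U" "continuous_on {0..Sb} z"
        "\<And>t. t \<in> {0..Sb} \<Longrightarrow> z t = zb 0 + integral {0..t} (\<lambda>s. X (z s) (\<omega> s))"
        "\<And>t. t \<in> {0..Sb} \<Longrightarrow> norm (z t - zb t) < \<eta>" "p \<in> (V \<times> UNIV) \<inter> Q" "norm p < \<eta>" "0 < r"
    then show "\<theta> (z Sb) \<noteq> FF p - r *\<^sub>R (0, 0, 0, 1)" by (rule optimal)
  qed
  then obtain \<nu> q N where \<nu>: "\<nu> \<noteq> 0" and AC: "AC_on 0 Sb q" and qc: "continuous_on {0..Sb} q"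
    and qS: "q Sb = (\<Sum>b\<in>Basis. (\<nu> \<bullet> \<theta>' b) *\<^sub>R b)"
    and const: "\<forall>b\<in>Basis. (\<forall>s\<in>{0..Sb}. blinfun_apply (D (zb s) (ob s)) b = 0) \<longrightarrow> (\<forall>t\<in>{0..Sb}. q t \<bullet> b = q Sb \<bullet> b)"
    and MQ: "\<forall>p\<in>Q. 0 \<le> \<nu> \<bullet> MM p" and N: "negligible N"
    and q': "\<forall>t\<in>{0..Sb} - N. (q has_vector_derivative - ref.adjoint_field t (q t)) (at t within {0..Sb})"
    and needle: "\<forall>t\<in>{0<..<Sb} - N. \<forall>u\<in>U. q t \<bullet> (X (zb t) u - X (zb t) (ob t)) \<le> 0"
    by (elim exE conjE)
  obtain \<nu>0 \<nu>1 \<nu>2 \<nu>3 where \<nu>eq: "\<nu> = (\<nu>0, \<nu>1, \<nu>2, \<nu>3)" by (cases \<nu>)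
  have lin: "linear \<theta>'" by (rule has_derivative_linear[OF \<theta>d])
  \<comment> \<open>The terminal costate is the transpose of \<theta>' applied to \<nu>, identified
    by testing against every \<open>h\<close>.\<close>
  have qSh: "q Sb \<bullet> h = (\<nu>0 + \<nu>3 * fst v, \<nu>1 + \<nu>3 *\<^sub>R snd v, \<nu>2, \<nu>3) \<bullet> h" for h
  proof -
    have "q Sb \<bullet> h = (\<Sum>b\<in>Basis. (\<nu> \<bullet> \<theta>' b) * (b \<bullet> h))" unfolding qS by (simp add: inner_sum_left)
    also have "\<dots> = \<nu> \<bullet> \<theta>' (\<Sum>b\<in>Basis. (h \<bullet> b) *\<^sub>R b)"
      by (simp add: linear_sum[OF lin] linear_scale[OF lin] inner_sum_right inner_commute mult.commute)
    also have "\<dots> = \<nu> \<bullet> \<theta>' h" by (simp add: euclidean_representation)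
    also have "\<dots> = (\<nu>0 + \<nu>3 * fst v, \<nu>1 + \<nu>3 *\<^sub>R snd v, \<nu>2, \<nu>3) \<bullet> h"
      unfolding \<nu>eq \<theta>'_def 
      by (simp add: inner_prod_def inner_add_left inner_add_right distrib_left distrib_right inner_commute mult_ac)
    finally show ?thesis .
  qed
  then have qSeq: "q Sb = (\<nu>0 + \<nu>3 * fst v, \<nu>1 + \<nu>3 *\<^sub>R snd v, \<nu>2, \<nu>3)"
    using vector_eq_rdot by blast
  \<comment> \<open>The axes of y0, \<beta> and the cost: the three cyclic directions.\<close>
  have b: "(1, 0, 0, 0) \<in> (Basis :: (real \<times> (real^'n) \<times> real \<times> real) set)"
      "(0, 0, 1, 0) \<in> (Basis :: (real \<times> (real^'n) \<times> real \<times> real) set)"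
      "(0, 0, 0, 1) \<in> (Basis :: (real \<times> (real^'n) \<times> real \<times> real) set)"
    by (auto simp: Basis_prod_def zero_prod_def)
  have qt: "q t = (\<nu>0 + \<nu>3 * fst v, fst (snd (q t)), \<nu>2, \<nu>3)" if t: "t \<in> {0..Sb}" for t
  proof -
    have c: "q t \<bullet> b = q Sb \<bullet> b" if "b \<in> Basis" "fst (snd b) = 0" for b
      using const that D(2) t by blast
    have "fst (q t) = \<nu>0 + \<nu>3 * fst v" using c[OF b(1)] by (simp add: inner_prod_def qSeq)
    moreover have "fst (snd (snd (q t))) = \<nu>2" using c[OF b(2)] by (simp add: inner_prod_def qSeq)
    moreover have "snd (snd (snd (q t))) = \<nu>3" using c[OF b(3)] by (simp add: inner_prod_def qSeq)
    ultimately show ?thesis by (simp add: prod_eq_iff)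
  qed
  have M1: "0 \<le> \<nu>0 * fst (L u) + \<nu>1 \<bullet> snd (L u) - \<nu>2 * a - \<nu>3 * c" if "(u, a, c) \<in> Q" for u a c
    using bspec[OF MQ that] by (simp add: \<nu>eq MM_def inner_prod_def)
  have L0: "L 0 = 0" by (rule linear_0[OF L(1)])
  \<comment> \<open>The signs come from single slacks: \<open>a = 1\<close>, then
    \<open>a = - 1\<close> if the bound is inactive, and \<open>c = 1\<close>. The cone part alone
    gives the polar condition.\<close>
  have "\<nu>2 \<le> 0" using M1[of 0 1 0] Cp(3) by (simp add: Q_def L0)
  moreover have "\<nu>2 = 0" if "ereal (\<beta>b Sb) < K"
    using M1[of 0 "-1" 0] Cp(3) \<open>\<nu>2 \<le> 0\<close> that by (simp add: Q_def L0)
  moreover have "\<nu>3 \<le> 0" using M1[of 0 0 1] Cp(3) by (simp add: Q_def L0)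
  moreover have "- (\<nu>0, \<nu>1) \<in> polar \<Gamma>"
    unfolding polar_def L(2)[symmetric]
  proof (intro CollectI ballI, elim imageE)
    fix x u assume "x = L u" "u \<in> Cp"
    then show "- (\<nu>0, \<nu>1) \<bullet> x \<le> 0" using M1[of u 0 0] by (simp add: Q_def inner_prod_def)
  qed
  moreover have "fst (snd (q Sb)) = \<nu>1 + \<nu>3 *\<^sub>R snd v" by (simp add: qSeq)
  moreover have "\<forall>t\<in>{0..Sb}. q t = (\<nu>0 + \<nu>3 * fst v, fst (snd (q t)), \<nu>2, \<nu>3)" using qt by blast
  moreover have "(\<nu>0, \<nu>1, \<nu>2, \<nu>3) \<noteq> 0" using \<nu> by (simp add: \<nu>eq)
  ultimately show ?thesis
    using AC qc N q' needle
    by (intro exI[of _ \<nu>0] exI[of _ \<nu>1] exI[of _ \<nu>2] exI[of _ \<nu>3] exI[of _ q] exI[of _ N] conjI impI)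
qed

end

section \<open>Reading off the multiplier\<close>

theorem mainTheorem1:
  fixes T :: "(real \<times> (real^'n)) set" and A :: "(real^'q) set"
    and I1 :: "'m::finite set" and C1 C2 C :: "(real^'m) set"
    and f :: "real^'n \<Rightarrow> real^'q \<Rightarrow> real^'n" and g :: "'m \<Rightarrow> real^'n \<Rightarrow> real^'n"
    and l0 :: "real^'n \<Rightarrow> real^'q \<Rightarrow> real" and l1 :: "real^'n \<Rightarrow> real^'m \<Rightarrow> real"
    and l1h :: "real^'n \<Rightarrow> real \<Rightarrow> real^'m \<Rightarrow> real"
    and Psi :: "real \<times> (real^'n) \<Rightarrow> real"
    and K :: ereal and xc :: "real^'n"
    and Sb :: real and w0b :: "real \<Rightarrow> real" and wb :: "real \<Rightarrow> real^'m"
    and \<alpha>b :: "real \<Rightarrow> real^'q" and y0b :: "real \<Rightarrow> real" and yb :: "real \<Rightarrow> real^'n"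
    and \<beta>b :: "real \<Rightarrow> real"
    and \<Gamma> :: "(real \<times> (real^'n)) set" and Cp :: "(real^'M) set"
  assumes hyps: "standing_hyps T A I1 C1 C2 C f g l0 l1 l1h Psi"
    and K_pos: "K > 0"
    and locmin: "st_local_minimizer f g xc A C T K Psi l0 l1h Sb w0b wb \<alpha>b y0b yb \<beta>b"
    and canon: "canonical Sb w0b wb"
    and bolt: "boltyanski_cone Cp \<Gamma> T (y0b Sb, yb Sb)"
  shows "\<exists>p0 (p :: real \<Rightarrow> real^'n) \<pi> lam.
           AC_on 0 Sb p \<and> \<pi> \<le> 0 \<and> lam \<ge> 0 \<and>
           \<comment> \<open>(i) non-triviality\<close>
           (p0 \<noteq> 0 \<or> (\<exists>s\<in>{0..Sb}. p s \<noteq> 0) \<or> lam \<noteq> 0) \<and>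
           (y0b Sb > 0 \<longrightarrow> (\<exists>s\<in>{0..Sb}. p s \<noteq> 0) \<or> lam \<noteq> 0) \<and>
           \<comment> \<open>(ii) non-transversality\<close>
           (\<exists>DPsi. GDERIV Psi (y0b Sb, yb Sb) :> DPsi \<and>
              (p0, p Sb) \<in> (\<lambda>\<gamma>. - (lam *\<^sub>R DPsi) - \<gamma>) ` polar \<Gamma>) \<and>
           (ereal (\<beta>b Sb) < K \<longrightarrow> \<pi> = 0) \<and>
           \<comment> \<open>(iii) adjoint equation\<close>
           (AE s in lebesgue_on {0..Sb}.
              \<exists>DH. GDERIV (\<lambda>x. Ham f g l0 l1h x p0 (p s) \<pi> lam (w0b s) (wb s) (\<alpha>b s)) (yb s) :> DH \<and>
                   (p has_vector_derivative - DH) (at s within {0..Sb})) \<and>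
           \<comment> \<open>(iv) maximization\<close>
           (AE s in lebesgue_on {0..Sb}.
              Ham f g l0 l1h (yb s) p0 (p s) \<pi> lam (w0b s) (wb s) (\<alpha>b s)
                = HamMax f g l0 l1h A C (yb s) p0 (p s) \<pi> lam) \<and>
           \<comment> \<open>(v) vanishing of the Hamiltonian\<close>
           (\<forall>s\<in>{0..Sb}. HamMax f g l0 l1h A C (yb s) p0 (p s) \<pi> lam = 0)"
proof -
  interpret space_time T A I1 C1 C2 C f g l0 l1 l1h Psi by (rule space_time.intro[OF hyps])
  have feas: "st_feasible f g xc A C T K Sb w0b wb \<alpha>b y0b yb \<beta>b"
    using locmin unfolding st_local_minimizer_def by blast
  then have proc: "st_process f g xc A C Sb w0b wb \<alpha>b y0b yb \<beta>b" unfolding st_feasible_def by blast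
  then have S: "0 < Sb" unfolding st_process_def by blast
  then have SS: "Sb \<in> {0..Sb}" by simp
  obtain ob zb N0 where ob: "ob \<in> borel_measurable (lebesgue_on {0..Sb})" "ob \<in> {0..Sb} \<rightarrow> U" and N0: "negligible N0"
    and good: "\<forall>s\<in>{0..Sb} - N0. ob s = (w0b s, wb s, \<alpha>b s) \<and> (w0b s, wb s) \<in> Wset C \<and> \<alpha>b s \<in> A"
    and zc: "continuous_on {0..Sb} zb" and zb0: "zb 0 = (0, xc, 0, 0)"
    and comps: "\<forall>t\<in>{0..Sb}. fst (zb t) = y0b t \<and> fst (snd (zb t)) = yb t \<and> fst (snd (snd (zb t))) = \<beta>b t"
    and zeq: "\<forall>t\<in>{0..Sb}. zb t = zb 0 + integral {0..t} (\<lambda>s. X (zb s) (ob s))"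
    and cost: "snd (snd (snd (zb Sb))) = integral\<^sup>L (lebesgue_on {0..Sb}) (\<lambda>s. ell_e l0 l1h (yb s) (w0b s) (wb s) (\<alpha>b s))"
    using process_is_trajectory[OF proc canon] by (elim exE conjE)
  from reference_smooth[OF S ob zc zeq[rule_format]]
  obtain D where D: "smooth_reference X D U Sb ob zb" "\<forall>z u h. fst (snd h) = 0 \<longrightarrow> blinfun_apply (D z u) h = 0" .
  interpret ref: smooth_reference X D U Sb ob zb by (rule D(1))
  obtain v where v: "GDERIV Psi (y0b Sb, yb Sb) :> v" using C1_map_gradient(2)[OF Psi_smooth] by blast
  obtain \<nu>0 \<nu>1 \<nu>2 \<nu>3 q N1 where \<nu>: "(\<nu>0, \<nu>1, \<nu>2, \<nu>3) \<noteq> 0" and AC: "AC_on 0 Sb q" and qc: "continuous_on {0..Sb} q"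
    and qt: "\<forall>t\<in>{0..Sb}. q t = (\<nu>0 + \<nu>3 * fst v, fst (snd (q t)), \<nu>2, \<nu>3)" and qS: "fst (snd (q Sb)) = \<nu>1 + \<nu>3 *\<^sub>R snd v"
    and \<nu>2: "\<nu>2 \<le> 0" "ereal (\<beta>b Sb) < K \<longrightarrow> \<nu>2 = 0" and \<nu>3: "\<nu>3 \<le> 0" and pol: "- (\<nu>0, \<nu>1) \<in> polar \<Gamma>"
    and N1: "negligible N1"
    and q': "\<forall>t\<in>{0..Sb} - N1. (q has_vector_derivative - ref.adjoint_field t (q t)) (at t within {0..Sb})"
    and needle: "\<forall>t\<in>{0<..<Sb} - N1. \<forall>u\<in>U. q t \<bullet> (X (zb t) u - X (zb t) (ob t)) \<le> 0"
    using separating_covector[OF locmin bolt ob zc zb0 comps zeq cost D v] by (elim exE conjE)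
  define N where "N = N0 \<union> N1 \<union> {0, Sb}"
  have N: "negligible N" unfolding N_def by (intro negligible_Un N0 N1) simp
  have off: "s \<in> {0<..<Sb} - N" "s \<in> {0..Sb} - N0" "s \<in> {0..Sb} - N1" "s \<in> {0..Sb}" if "s \<in> {0..Sb} - N" for s
    using that by (auto simp: N_def)
  note goodN = good[rule_format, OF off(2)]
  \<comment> \<open>Dictionary: the costate of the augmented system is (p0, p, \<pi>, - \<lambda>),
    and \<open>qt\<close> says that all its components except p are constant. The time derivative of
    \<open>Psi\<close> enters \<open>p0\<close> with the factor
    \<open>\<nu>3 = - lam\<close>.\<close>
  define p0 where "p0 = \<nu>0 + \<nu>3 * fst v"
  define p where "p t = fst (snd (q t))" for t
  define \<pi> where "\<pi> = \<nu>2"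
  define lam where "lam = - \<nu>3"
  have qeq: "q t = (p0, p t, \<pi>, - lam)" if "t \<in> {0..Sb}" for t
    using qt that by (simp add: p0_def p_def \<pi>_def lam_def)
  have ham: "Ham f g l0 l1h (yb s) p0 (p s) \<pi> lam w0 w a = q s \<bullet> X (zb s) (w0, w, a)" if "s \<in> {0..Sb}" for s w0 w a
    using Ham_eq_inner[of f g l0 l1h "zb s" p0 "p s" \<pi> lam w0 w a] comps that by (simp add: qeq)
  have A0: "\<exists>w0 w a. ob s = (w0, w, a) \<and> (w0, w) \<in> Wset C \<and> a \<in> A" if "s \<in> {0..Sb} - N" for s
    using goodN[OF that] by blast
  have needleN: "q t \<bullet> (X (zb t) u - X (zb t) (ob t)) \<le> 0" if "t \<in> {0<..<Sb} - N" "u \<in> U" for t u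
    using needle that by (auto simp: N_def)
  have hc1: "q s \<bullet> X (zb s) (ob s) = 0" if "s \<in> {0<..<Sb} - N" for s
    by (rule hamiltonian_conditions(1)[OF S N qc zc A0 needleN that])
  have hc2: "q s \<bullet> X (zb s) (w0, w, a) \<le> 0" if "s \<in> {0..Sb}" "(w0, w) \<in> Wset C" "a \<in> A" for s w0 w a
    by (rule hamiltonian_conditions(2)[OF S N qc zc A0 needleN that])
  have hc3: "\<exists>w0 w a. (w0, w) \<in> Wset C \<and> a \<in> A \<and> q s \<bullet> X (zb s) (w0, w, a) = 0" if "s \<in> {0..Sb}" for s
    by (rule hamiltonian_conditions(3)[OF S N qc zc A0 needleN that])
  have zero: "q s \<bullet> X (zb s) (w0b s, wb s, \<alpha>b s) = 0" if "s \<in> {0..Sb} - N" for s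
    using hc1[OF off(1)[OF that]] goodN[OF that] by simp
  \<comment> \<open>The supremum is attained: \<open>hc2\<close> makes 0 an upper bound and
    \<open>hc3\<close> a value.\<close>
  have max0: "HamMax f g l0 l1h A C (yb s) p0 (p s) \<pi> lam = 0" if s: "s \<in> {0..Sb}" for s
    unfolding HamMax_def
  proof (rule cSup_eq_maximum)
    obtain w0 w a where "(w0, w) \<in> Wset C" "a \<in> A" "q s \<bullet> X (zb s) (w0, w, a) = 0" using hc3[OF s] by blast
    then show "0 \<in> (\<lambda>z. Ham f g l0 l1h (yb s) p0 (p s) \<pi> lam (fst (fst z)) (snd (fst z)) (snd z)) ` (Wset C \<times> A)"
      by (intro image_eqI[of _ _ "((w0, w), a)"]) (auto simp: ham[OF s])
    fix x assume "x \<in> (\<lambda>z. Ham f g l0 l1h (yb s) p0 (p s) \<pi> lam (fst (fst z)) (snd (fst z)) (snd z)) ` (Wset C \<times> A)"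
    then show "x \<le> 0" using hc2[OF s] by (auto simp: ham[OF s])
  qed
  have "\<not> {0..Sb} \<subseteq> N"
  proof
    assume "{0..Sb} \<subseteq> N"
    then have "negligible {0..Sb}" using N negligible_subset by blast
    then show False using S by (simp add: negligible_iff_measure)
  qed
  then obtain s0 where s0: "s0 \<in> {0..Sb} - N" by blast
  have triv1: "p0 \<noteq> 0 \<or> (\<exists>s\<in>{0..Sb}. p s \<noteq> 0) \<or> lam \<noteq> 0"
  proof (rule ccontr)
    assume "\<not> (p0 \<noteq> 0 \<or> (\<exists>s\<in>{0..Sb}. p s \<noteq> 0) \<or> lam \<noteq> 0)"
    then have z: "p0 = 0" "lam = 0" "\<And>s. s \<in> {0..Sb} \<Longrightarrow> p s = 0" by auto
    have "\<nu>3 = 0" using z(2) by (simp add: lam_def)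
    moreover have "\<nu>0 = 0" using z(1) \<open>\<nu>3 = 0\<close> by (simp add: p0_def)
    moreover have "\<nu>1 = 0" using z(3)[OF SS] qS \<open>\<nu>3 = 0\<close> by (simp add: p_def)
    \<comment> \<open>The separating covector is nonzero, so \<open>\<nu>2\<close> is its one
      surviving component; slackness then puts \<beta>(S) at the bound K.\<close>
    ultimately have "\<nu>2 \<noteq> 0" using \<nu> by (auto simp: zero_prod_def)
    then have nl: "\<not> ereal (\<beta>b Sb) < K" using \<nu>2(2) by blast
    have "fst (snd (snd (zb Sb))) = fst (snd (snd (zb 0)))"
    proof (rule component_constant[OF S ob zc zeq[rule_format, OF SS] N, of "\<lambda>x. fst (snd (snd x))"])
      show "bounded_linear (\<lambda>x :: real \<times> (real^'n) \<times> real \<times> real. fst (snd (snd x)))" by (intro bounded_linear_intros)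
      fix s assume s: "s \<in> {0..Sb} - N"
      have "q s = (0, 0, \<nu>2, 0)" using qeq[OF off(4)[OF s]] z off(4)[OF s] by (simp add: \<pi>_def)
      then have "\<nu>2 * norm (wb s) = 0" using zero[OF s] by (simp add: augmented_field_def inner_prod_def)
      then have "wb s = 0" using \<open>\<nu>2 \<noteq> 0\<close> by simp
      then show "fst (snd (snd (X (zb s) (ob s)))) = 0" using goodN[OF s] by (simp add: augmented_field_def)
    qed
    then have "\<beta>b Sb = 0" using comps SS zb0 by simp
    then show False using nl K_pos by (simp add: zero_ereal_def)
  qed
  have triv2: "(\<exists>s\<in>{0..Sb}. p s \<noteq> 0) \<or> lam \<noteq> 0" if "y0b Sb > 0"
  proof (rule ccontr)
    assume "\<not> ((\<exists>s\<in>{0..Sb}. p s \<noteq> 0) \<or> lam \<noteq> 0)"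
    then have z: "lam = 0" "\<And>s. s \<in> {0..Sb} \<Longrightarrow> p s = 0" by auto
    with triv1 have "p0 \<noteq> 0" by auto
    have qs: "q s = (p0, 0, \<nu>2, 0)" if "s \<in> {0..Sb}" for s using qeq[OF that] z(1) z(2)[OF that] by (simp add: \<pi>_def)
    \<comment> \<open>Pure drift, w0 = 1 with w = 0, is admissible because a nonempty closed cone
      contains 0; testing with it gives the sign of \<open>p0\<close>.\<close>
    have "0 \<in> C" using closed_pcone_contains_0[OF closed_C pcone_C, of "wb s0"] goodN[OF s0] by (auto simp: Wset_def)
    then have "(1, 0) \<in> Wset C" by (simp add: Wset_def)
    from hc2[OF off(4)[OF s0] this, of "\<alpha>b s0"] goodN[OF s0]
    have "p0 \<le> 0" by (simp add: qs[OF off(4)[OF s0]] augmented_field_def inner_prod_def)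
    have "fst (zb Sb) = fst (zb 0)"
    proof (rule component_constant[OF S ob zc zeq[rule_format, OF SS] N, of fst])
      show "bounded_linear (fst :: real \<times> (real^'n) \<times> real \<times> real \<Rightarrow> real)" by (rule bounded_linear_fst)
      fix s assume s: "s \<in> {0..Sb} - N"
      have eq: "p0 * w0b s + \<nu>2 * norm (wb s) = 0"
        using zero[OF s] by (simp add: qs[OF off(4)[OF s]] augmented_field_def inner_prod_def)
      have "0 \<le> w0b s" using goodN[OF s] by (auto simp: Wset_def)
      then have "p0 * w0b s \<le> 0" "\<nu>2 * norm (wb s) \<le> 0"
        using \<open>p0 \<le> 0\<close> \<nu>2(1) by (auto simp: mult_nonpos_nonneg)
      with eq have "p0 * w0b s = 0" by linarith
      then have "w0b s = 0" using \<open>p0 \<noteq> 0\<close> by simp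
      then show "fst (X (zb s) (ob s)) = 0" using goodN[OF s] by (simp add: augmented_field_def)
    qed
    then show False using comps SS zb0 that by simp
  qed
  have trans: "(p0, p Sb) \<in> (\<lambda>\<gamma>. - (lam *\<^sub>R v) - \<gamma>) ` polar \<Gamma>"
  proof (rule image_eqI[OF _ pol])
    show "(p0, p Sb) = - (lam *\<^sub>R v) - - (\<nu>0, \<nu>1)"
      by (simp add: p0_def p_def qS lam_def prod_eq_iff)
  qed
  have pAC: "AC_on 0 Sb p"
  proof (rule AC_on_dominated[OF AC])
    fix a b
    have "norm (fst (snd (q b - q a))) \<le> norm (q b - q a)" by (rule order_trans[OF norm_fst_bound norm_snd_bound])
    then show "norm (p b - p a) \<le> norm (q b - q a)" by (simp add: p_def)
  qed
  have adjoint: "\<exists>DH. GDERIV (\<lambda>x. Ham f g l0 l1h x p0 (p s) \<pi> lam (w0b s) (wb s) (\<alpha>b s)) (yb s) :> DH \<and>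
                   (p has_vector_derivative - DH) (at s within {0..Sb})" if s: "s \<in> {0..Sb} - N" for s
  proof (intro exI conjI)
    have sS: "s \<in> {0..Sb}" by (rule off(4)[OF s])
    define DH where "DH = fst (snd (ref.adjoint_field s (q s)))"
    have obU: "ob s \<in> U" by (rule funcset_mem[OF ob(2) sS])
    have obs: "ob s = (w0b s, wb s, \<alpha>b s)" using goodN[OF s] by blast
    have ys: "fst (snd (zb s)) = yb s" using comps sS by blast
    \<comment> \<open>Only the second state component varies with x, so the gradient of the
      Hamiltonian is the second component of the transposed field applied to the costate.\<close>
    have emb: "((\<lambda>x. (fst (zb s), x, snd (snd (zb s)))) has_derivative (\<lambda>h. (0, h, 0))) (at (yb s))"
      by (intro has_derivative_Pair has_derivative_const has_derivative_ident)
    have base: "(fst (zb s), yb s, snd (snd (zb s))) = zb s" by (simp add: ys[symmetric])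
    have "((\<lambda>z. X z (ob s)) has_derivative blinfun_apply (D (zb s) (ob s))) (at (fst (zb s), yb s, snd (snd (zb s))))"
      unfolding base by (rule ref.X_deriv[OF obU])
    from has_derivative_inner_right[OF has_derivative_compose[OF emb this], of "q s"]
    have "((\<lambda>x. q s \<bullet> X (fst (zb s), x, snd (snd (zb s))) (ob s)) has_derivative
        (\<lambda>h. q s \<bullet> blinfun_apply (D (zb s) (ob s)) (0, h, 0))) (at (yb s))" .
    moreover have "q s \<bullet> X (fst (zb s), x, snd (snd (zb s))) (ob s)
        = Ham f g l0 l1h x p0 (p s) \<pi> lam (w0b s) (wb s) (\<alpha>b s)" for x
      using Ham_eq_inner[of f g l0 l1h "(fst (zb s), x, snd (snd (zb s)))" p0 "p s" \<pi> lam "w0b s" "wb s" "\<alpha>b s"]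
      by (simp add: qeq[OF sS] obs)
    moreover have "q s \<bullet> blinfun_apply (D (zb s) (ob s)) (0, h, 0) = h \<bullet> DH" for h
    proof -
      have "q s \<bullet> blinfun_apply (D (zb s) (ob s)) (0, h, 0) = ref.adjoint_field s (q s) \<bullet> (0, h, 0)"
        by (rule ref.adjoint_field_inner[symmetric])
      also have "\<dots> = h \<bullet> DH" by (simp add: inner_prod_def DH_def inner_commute)
      finally show ?thesis .
    qed
    ultimately show "GDERIV (\<lambda>x. Ham f g l0 l1h x p0 (p s) \<pi> lam (w0b s) (wb s) (\<alpha>b s)) (yb s) :> DH"
      by (simp add: gderiv_def)
    have "(q has_vector_derivative - ref.adjoint_field s (q s)) (at s within {0..Sb})"
      using q' off(3)[OF s] by blast
    from bounded_linear.has_vector_derivative[OF bounded_linear_fst bounded_linear.has_vector_derivative[OF bounded_linear_snd this]]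
    show "(p has_vector_derivative - DH) (at s within {0..Sb})" by (simp add: p_def[abs_def] DH_def)
  qed
  show ?thesis
  proof (rule exI[of _ p0], rule exI[of _ p], rule exI[of _ \<pi>], rule exI[of _ lam], intro conjI)
    show "AC_on 0 Sb p" by (rule pAC)
    show "\<pi> \<le> 0" "lam \<ge> 0" using \<nu>2(1) \<nu>3 by (simp_all add: \<pi>_def lam_def)
    show "p0 \<noteq> 0 \<or> (\<exists>s\<in>{0..Sb}. p s \<noteq> 0) \<or> lam \<noteq> 0" by (rule triv1)
    show "y0b Sb > 0 \<longrightarrow> (\<exists>s\<in>{0..Sb}. p s \<noteq> 0) \<or> lam \<noteq> 0" using triv2 by blast
    show "\<exists>DPsi. GDERIV Psi (y0b Sb, yb Sb) :> DPsi \<and> (p0, p Sb) \<in> (\<lambda>\<gamma>. - (lam *\<^sub>R DPsi) - \<gamma>) ` polar \<Gamma>"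
      by (intro exI[of _ v] conjI v trans)
    show "ereal (\<beta>b Sb) < K \<longrightarrow> \<pi> = 0" using \<nu>2(2) by (simp add: \<pi>_def)
    show "AE s in lebesgue_on {0..Sb}.
              \<exists>DH. GDERIV (\<lambda>x. Ham f g l0 l1h x p0 (p s) \<pi> lam (w0b s) (wb s) (\<alpha>b s)) (yb s) :> DH \<and>
                   (p has_vector_derivative - DH) (at s within {0..Sb})"
      unfolding AE_lebesgue_on_iff_negligible by (rule exI[of _ N], rule conjI, rule N, rule ballI, rule adjoint)
    show "AE s in lebesgue_on {0..Sb}. Ham f g l0 l1h (yb s) p0 (p s) \<pi> lam (w0b s) (wb s) (\<alpha>b s)
                = HamMax f g l0 l1h A C (yb s) p0 (p s) \<pi> lam"
      unfolding AE_lebesgue_on_iff_negligible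
    proof (intro exI[of _ N] conjI ballI N)
      fix s assume s: "s \<in> {0..Sb} - N"
      show "Ham f g l0 l1h (yb s) p0 (p s) \<pi> lam (w0b s) (wb s) (\<alpha>b s) = HamMax f g l0 l1h A C (yb s) p0 (p s) \<pi> lam"
        by (simp add: ham[OF off(4)[OF s]] zero[OF s] max0[OF off(4)[OF s]])
    qed
    show "\<forall>s\<in>{0..Sb}. HamMax f g l0 l1h A C (yb s) p0 (p s) \<pi> lam = 0" using max0 by blast
  qed
qed

end
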